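(* Let $\Gamma$ be a cyclic group of order $2$, let $(G,\psi)$ be a $\Gamma$-gain graph, let $\tau:\Gamma\to\mathcal{C}_s$ be a faithful representation (where $\mathcal{C}_s=\{\mathrm{id},\sigma\}$, $\sigma$ the reflection of $\mathbb{R}^2$ in the $y$-axis), and let $p:V(G)\to\mathbb{R}^2$ be $\mathcal{C}_s$-generic. Then: (a) if $(G,\psi)$ is $(2,1,3,1)$-gain-tight, then the covering framework $(\tilde G,\tilde p)$ is fully-symmetrically isostatic (i.e. $\rho_0$-symmetrically isostatic); (b) if $(G,\psi)$ is $(2,1,3,2)$-gain-tight, then the covering framework $(\tilde G,\tilde p)$ is anti-symmetrically isostatic (i.e. $\rho_1$-symmetrically isostatic).
   Context: **Gain graphs.** A $\Gamma$-gain graph is a pair $(G,\psi)$ with $G$ a finite directed multigraph, $V(G)=V_0(G)\,\dot\cup\,\overline{V(G)}$ a partition into fixed and free vertices, no fixed vertex having a loop or being incident to parallel edges, and $\psi:E(G)\to\Gamma$ such that: $\psi(e)=\mathrm{id}$ if both ends of $e$ are fixed; parallel edges $e,f$ satisfy $\psi(e)\ne\psi(f)$ if they have the same direction and $\psi(e)\ne\psi(f)^{-1}$ if opposite; $\psi(e)\ne\mathrm{id}$ for a loop $e$. Its covering $\tilde G$ is the simple graph with vertices $v$ for $v\in V_0(G)$ and $gv$ ($g\in\Gamma$) for $v\in\overline{V(G)}$; an edge $(u,v)$ of $G$ gives the edge $\{u,v\}$ if both ends are fixed, the edges $\{u,gv\}$, $g\in\Gamma$, if $u$ is fixed and $v$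 free (similarly with roles exchanged), and the edges $\{hu,h\psi(e)v\}$, $h\in\Gamma$, if both are free. $\Gamma$ acts on $\tilde G$. **Frameworks.** Given $p:V(G)\to\mathbb{R}^2$ (with fixed vertices placed on the $y$-axis), the covering framework $(\tilde G,\tilde p)$ has $\tilde p(gv)=\tau(g)p(v)$; $\tilde p$ is required to be injective, and it is a standing assumption that the points of a framework affinely span $\mathbb{R}^2$. $\Gamma=\langle\gamma\rangle$. The rigidity map $R=R(\tilde G,\tilde p)$ sends $m:V(\tilde G)\to\mathbb{C}^2$ to $\{u,v\}\mapsto(\tilde p(u)-\tilde p(v))^T(m(u)-m(v))$ on $E(\tilde G)$; $m$ is an infinitesimal motion if $Rm=0$, trivial if $m(u)=M\tilde p(u)+t$ for a fixed skew-symmetric $M$ and vector $t$ (complex entries). $p$ is $\mathcal{C}_s$-generic if $\operatorname{rank}R(\tilde G,\tilde p)\ge\operatorname{rank}R(\tilde G,\tilde q)$ for all $\mathcal{C}_s$-symmetric realisations $(\tilde G,\tilde q)$, i.e. those with $\tilde q(gv)=\tau(g)\tilde q(v)$ for all $g,v$. **$\rho_j$-symmetrically isostatic.** For $j=0,1$ let $\rho_j(\gamma)=(-1)^j$, $V^j=\{m:V(\tilde G)\to\mathbb{C}^2\mid m(gv)=\overline{\rho_j(g)}\,\tau(g)m(v)\ \forall g,v\}$, $W^j=\{w:E(\tilde G)\to\mathbb{C}\mid w(ge)=\overline{\rho_j(g)}\,w(e)\ \forall g,e\}$. $R$ maps $V^j$ into $W^j$; the block $\tilde R_j(\tilde G,\tilde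 p)$ is a matrix of $R|_{V^j}:V^j\to W^j$ (rows correspond to a basis of $W^j$). A motion is $\rho_j$-symmetric if it lies in $V^j$. $(\tilde G,\tilde p)$ is $\rho_j$-symmetrically isostatic if all its $\rho_j$-symmetric infinitesimal motions are trivial and $\tilde R_j(\tilde G,\tilde p)$ has no non-trivial row dependence (equivalently $R|_{V^j}:V^j\to W^j$ is onto). **Sparsity.** For a subgraph $H$ of $G$, $V_0(H)=V(H)\cap V_0(G)$, $\overline{V(H)}=V(H)\cap\overline{V(G)}$. The gain of a walk is the product of $\psi(e)^{\pm1}$ along it (sign according to orientation). $H$ is balanced if, after deleting all fixed vertices and their incident edges, every cycle (including loops and 2-cycles of parallel edges) has gain $\mathrm{id}$. $(G,\psi)$ is $(2,m,3,l)$-gain-sparse if $|E(H)|\le2|V(H)|-3$ for every balanced subgraph $H$ with $E(H)\ne\emptyset$ and $|E(H)|\le2|\overline{V(H)}|+m|V_0(H)|-l$ for every subgraph $H$ with $E(H)\ne\emptyset$; it is $(2,m,3,l)$-gain-tight if moreover $|E(G)|=2|\overline{V(G)}|+m|V_0(G)|-l$. *)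

theory Defs
  imports
    "HOL-Analysis.Analysis"
    "HOL-Algebra.Elementary_Groups"
    "HOL-Library.Function_Algebras"
    "Graph_Theory.Digraph_Component"
begin

section \<open>Gain graphs\<close>

text \<open>
  Two distinct arcs are parallel if they have the same set of end vertices; two loops at the
  same vertex are thus parallel, with the same and with opposite direction at once.
\<close>

definition parallel_arcs :: "('v, 'e) pre_digraph \<Rightarrow> 'e \<Rightarrow> 'e \<Rightarrow> bool" where
  "parallel_arcs G e f \<longleftrightarrow> e \<in> arcs G \<and> f \<in> arcs G \<and> e \<noteq> f \<and>
     {tail G e, head G e} = {tail G f, head G f}"

definition gain_graph ::
  "('g, 'b) monoid_scheme \<Rightarrow> ('v, 'e) pre_digraph \<Rightarrow> 'v set \<Rightarrow> ('e \<Rightarrow> 'g) \<Rightarrow> bool" where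
  "gain_graph \<Gamma> G V0 \<psi> \<longleftrightarrow>
     fin_digraph G \<and> V0 \<subseteq> verts G \<and>
     (\<forall>e\<in>arcs G. \<psi> e \<in> carrier \<Gamma>) \<and>
     (\<forall>e\<in>arcs G. tail G e \<in> V0 \<longrightarrow> tail G e \<noteq> head G e) \<and>
     (\<forall>e f. parallel_arcs G e f \<longrightarrow> tail G e \<notin> V0 \<and> head G e \<notin> V0) \<and>
     (\<forall>e\<in>arcs G. tail G e \<in> V0 \<and> head G e \<in> V0 \<longrightarrow> \<psi> e = \<one>\<^bsub>\<Gamma>\<^esub>) \<and>
     (\<forall>e f. parallel_arcs G e f \<and> tail G e = tail G f \<and> head G e = head G f \<longrightarrow>
        \<psi> e \<noteq> \<psi> f) \<and>
     (\<forall>e f. parallel_arcs G e f \<and> tail G e = head G f \<and> head G e = tail G f \<longrightarrow>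
        \<psi> e \<noteq> inv\<^bsub>\<Gamma>\<^esub> (\<psi> f)) \<and>
     (\<forall>e\<in>arcs G. tail G e = head G e \<longrightarrow> \<psi> e \<noteq> \<one>\<^bsub>\<Gamma>\<^esub>)"


section \<open>Balancedness and gain sparsity\<close>

text \<open>
  Walks ignore the orientation of the arcs: a step \<open>(e, True)\<close> traverses \<open>e\<close> from tail to head,
  a step \<open>(e, False)\<close> from head to tail.
\<close>

fun step_from :: "('v, 'e) pre_digraph \<Rightarrow> 'e \<times> bool \<Rightarrow> 'v" where
  "step_from G (e, b) = (if b then tail G e else head G e)"

fun step_to :: "('v, 'e) pre_digraph \<Rightarrow> 'e \<times> bool \<Rightarrow> 'v" where
  "step_to G (e, b) = (if b then head G e else tail G e)"

fun step_gain :: "('g, 'b) monoid_scheme \<Rightarrow> ('e \<Rightarrow> 'g) \<Rightarrow> 'e \<times> bool \<Rightarrow> 'g" where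
  "step_gain \<Gamma> \<psi> (e, b) = (if b then \<psi> e else inv\<^bsub>\<Gamma>\<^esub> (\<psi> e))"

fun gain_walk :: "('v, 'e) pre_digraph \<Rightarrow> 'v \<Rightarrow> ('e \<times> bool) list \<Rightarrow> 'v \<Rightarrow> bool" where
  "gain_walk G u [] v \<longleftrightarrow> u \<in> verts G \<and> u = v"
| "gain_walk G u (s # ss) v \<longleftrightarrow>
     fst s \<in> arcs G \<and> step_from G s = u \<and> gain_walk G (step_to G s) ss v"

fun walk_gain :: "('g, 'b) monoid_scheme \<Rightarrow> ('e \<Rightarrow> 'g) \<Rightarrow> ('e \<times> bool) list \<Rightarrow> 'g" where
  "walk_gain \<Gamma> \<psi> [] = \<one>\<^bsub>\<Gamma>\<^esub>"
| "walk_gain \<Gamma> \<psi> (s # ss) = step_gain \<Gamma> \<psi> s \<otimes>\<^bsub>\<Gamma>\<^esub> walk_gain \<Gamma> \<psi> ss"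

text \<open>Loops are cycles of length one, pairs of parallel arcs are cycles of length two.\<close>

definition gain_cycle :: "('v, 'e) pre_digraph \<Rightarrow> ('e \<times> bool) list \<Rightarrow> bool" where
  "gain_cycle G ss \<longleftrightarrow> ss \<noteq> [] \<and> (\<exists>u. gain_walk G u ss u) \<and>
     distinct (map (step_from G) ss) \<and> distinct (map fst ss)"

definition balanced ::
  "('g, 'b) monoid_scheme \<Rightarrow> 'v set \<Rightarrow> ('e \<Rightarrow> 'g) \<Rightarrow> ('v, 'e) pre_digraph \<Rightarrow> bool" where
  "balanced \<Gamma> V0 \<psi> H \<longleftrightarrow>
     (\<forall>ss. gain_cycle (H \<restriction> (verts H - V0)) ss \<longrightarrow> walk_gain \<Gamma> \<psi> ss = \<one>\<^bsub>\<Gamma>\<^esub>)"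

text \<open>\<open>(2, m, 3, l)\<close>-gain-sparsity and -tightness; the counts are integers.\<close>

definition gain_sparse ::
  "nat \<Rightarrow> nat \<Rightarrow> ('g, 'b) monoid_scheme \<Rightarrow> ('v, 'e) pre_digraph \<Rightarrow> 'v set \<Rightarrow> ('e \<Rightarrow> 'g) \<Rightarrow> bool" where
  "gain_sparse m l \<Gamma> G V0 \<psi> \<longleftrightarrow>
     (\<forall>H. subgraph H G \<and> arcs H \<noteq> {} \<and> balanced \<Gamma> V0 \<psi> H \<longrightarrow>
        int (card (arcs H)) \<le> 2 * int (card (verts H)) - 3) \<and>
     (\<forall>H. subgraph H G \<and> arcs H \<noteq> {} \<longrightarrow>
        int (card (arcs H)) \<le>
          2 * int (card (verts H - V0)) + int m * int (card (verts H \<inter> V0)) - int l)"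

definition gain_tight ::
  "nat \<Rightarrow> nat \<Rightarrow> ('g, 'b) monoid_scheme \<Rightarrow> ('v, 'e) pre_digraph \<Rightarrow> 'v set \<Rightarrow> ('e \<Rightarrow> 'g) \<Rightarrow> bool" where
  "gain_tight m l \<Gamma> G V0 \<psi> \<longleftrightarrow> gain_sparse m l \<Gamma> G V0 \<psi> \<and>
     int (card (arcs G)) =
       2 * int (card (verts G - V0)) + int m * int (card (verts G \<inter> V0)) - int l"


section \<open>The covering graph\<close>

datatype ('g, 'v) cov_vertex = Fixed 'v | Free 'g 'v

definition cov_verts ::
  "('g, 'b) monoid_scheme \<Rightarrow> ('v, 'e) pre_digraph \<Rightarrow> 'v set \<Rightarrow> ('g, 'v) cov_vertex set" where
  "cov_verts \<Gamma> G V0 = Fixed ` V0 \<union> {Free g v | g v. g \<in> carrier \<Gamma> \<and> v \<in> verts G - V0}"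

definition cov_lift :: "'v set \<Rightarrow> 'g \<Rightarrow> 'v \<Rightarrow> ('g, 'v) cov_vertex" where
  "cov_lift V0 g v = (if v \<in> V0 then Fixed v else Free g v)"

text \<open>
  The three kinds of edges of the covering are treated uniformly: at a fixed end vertex
  the group element is discarded by \<^const>\<open>cov_lift\<close>, and if only the head is free then
  \<open>h \<otimes> \<psi> e\<close> runs through the whole group.
\<close>

definition cov_edges ::
  "('g, 'b) monoid_scheme \<Rightarrow> ('v, 'e) pre_digraph \<Rightarrow> 'v set \<Rightarrow> ('e \<Rightarrow> 'g) \<Rightarrow>
     ('g, 'v) cov_vertex set set" where
  "cov_edges \<Gamma> G V0 \<psi> =
     {{cov_lift V0 h (tail G e), cov_lift V0 (h \<otimes>\<^bsub>\<Gamma>\<^esub> \<psi> e) (head G e)} | h e.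
        h \<in> carrier \<Gamma> \<and> e \<in> arcs G}"

fun cov_act :: "('g, 'b) monoid_scheme \<Rightarrow> 'g \<Rightarrow> ('g, 'v) cov_vertex \<Rightarrow> ('g, 'v) cov_vertex" where
  "cov_act \<Gamma> h (Fixed v) = Fixed v"
| "cov_act \<Gamma> h (Free g v) = Free (h \<otimes>\<^bsub>\<Gamma>\<^esub> g) v"


section \<open>Symmetric frameworks in the plane\<close>

definition reflection_y :: "real^2^2" where
  "reflection_y = vector [vector [-1, 0], vector [0, 1]]"

definition C_s :: "(real^2^2) monoid" where
  "C_s = \<lparr>carrier = {mat 1, reflection_y}, monoid.mult = (**), one = mat 1\<rparr>"

fun cov_placement :: "('g \<Rightarrow> real^2^2) \<Rightarrow> ('v \<Rightarrow> real^2) \<Rightarrow> ('g, 'v) cov_vertex \<Rightarrow> real^2" where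
  "cov_placement \<tau> p (Fixed v) = p v"
| "cov_placement \<tau> p (Free g v) = \<tau> g *v p v"

definition covering_framework ::
  "('g, 'b) monoid_scheme \<Rightarrow> ('v, 'e) pre_digraph \<Rightarrow> 'v set \<Rightarrow> ('g \<Rightarrow> real^2^2) \<Rightarrow>
     ('v \<Rightarrow> real^2) \<Rightarrow> bool" where
  "covering_framework \<Gamma> G V0 \<tau> p \<longleftrightarrow>
     (\<forall>v\<in>V0. p v $ 1 = 0) \<and>
     inj_on (cov_placement \<tau> p) (cov_verts \<Gamma> G V0) \<and>
     affine hull (cov_placement \<tau> p ` cov_verts \<Gamma> G V0) = UNIV"

definition symmetric_realisation ::
  "('g, 'b) monoid_scheme \<Rightarrow> ('v, 'e) pre_digraph \<Rightarrow> 'v set \<Rightarrow> ('g \<Rightarrow> real^2^2) \<Rightarrow>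
     (('g, 'v) cov_vertex \<Rightarrow> real^2) \<Rightarrow> bool" where
  "symmetric_realisation \<Gamma> G V0 \<tau> q \<longleftrightarrow>
     (\<forall>g\<in>carrier \<Gamma>. \<forall>x\<in>cov_verts \<Gamma> G V0. q (cov_act \<Gamma> g x) = \<tau> g *v q x)"


section \<open>Complex vector spaces of functions\<close>

definition cfun_scale :: "complex \<Rightarrow> ('a \<Rightarrow> complex) \<Rightarrow> 'a \<Rightarrow> complex" where
  "cfun_scale c f = (\<lambda>x. c * f x)"

definition cvec_scale :: "complex \<Rightarrow> ('a \<Rightarrow> complex^2) \<Rightarrow> 'a \<Rightarrow> complex^2" where
  "cvec_scale c f = (\<lambda>x. c *s f x)"

global_interpretation cfun: vector_space "cfun_scale :: complex \<Rightarrow> ('a \<Rightarrow> complex) \<Rightarrow> _"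
  by unfold_locales (auto simp: cfun_scale_def fun_eq_iff algebra_simps)

global_interpretation cvec: vector_space "cvec_scale :: complex \<Rightarrow> ('a \<Rightarrow> complex^2) \<Rightarrow> _"
  by unfold_locales (auto simp: cvec_scale_def fun_eq_iff vec_eq_iff algebra_simps)


section \<open>The rigidity map and its blocks\<close>

definition cvec_of :: "real^2 \<Rightarrow> complex^2" where
  "cvec_of x = (\<chi> i. complex_of_real (x $ i))"

definition cmat_of :: "real^2^2 \<Rightarrow> complex^2^2" where
  "cmat_of = map_matrix complex_of_real"

text \<open>
  Assignments \<open>V \<rightarrow> \<complex>\<^sup>2\<close> and \<open>E \<rightarrow> \<complex>\<close> are represented by functions vanishing
  outside \<open>V\<close> and \<open>E\<close>.  The expression below is symmetric in \<open>u\<close> and \<open>v\<close>, so it is a function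
  of the unordered pair \<open>{u, v}\<close>; it is bilinear, no conjugation being involved.
\<close>

definition displacements :: "'w set \<Rightarrow> ('w \<Rightarrow> complex^2) set" where
  "displacements V = {m. \<forall>x. x \<notin> V \<longrightarrow> m x = 0}"

definition edge_value :: "('w \<Rightarrow> real^2) \<Rightarrow> ('w \<Rightarrow> complex^2) \<Rightarrow> 'w \<Rightarrow> 'w \<Rightarrow> complex" where
  "edge_value q m u v = (\<Sum>i\<in>UNIV. cvec_of (q u - q v) $ i * (m u - m v) $ i)"

definition rigidity_map ::
  "'w set set \<Rightarrow> ('w \<Rightarrow> real^2) \<Rightarrow> ('w \<Rightarrow> complex^2) \<Rightarrow> 'w set \<Rightarrow> complex" where
  "rigidity_map E q m =
     (\<lambda>e. if e \<in> E then (THE c. \<exists>u v. e = {u, v} \<and> c = edge_value q m u v) else 0)"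

lemma edge_value_commute: "edge_value q m u v = edge_value q m v u"
  by (simp add: edge_value_def cvec_of_def sum_2 algebra_simps)

lemma rigidity_map_edge:
  assumes "{u, v} \<in> E"
  shows "rigidity_map E q m {u, v} = edge_value q m u v"
proof -
  have "(THE c. \<exists>u' v'. {u, v} = {u', v'} \<and> c = edge_value q m u' v') = edge_value q m u v"
    by (rule the_equality) (auto simp: doubleton_eq_iff edge_value_commute)
  then show ?thesis
    using assms by (simp add: rigidity_map_def)
qed

definition rigidity_rank :: "'w set \<Rightarrow> 'w set set \<Rightarrow> ('w \<Rightarrow> real^2) \<Rightarrow> nat" where
  "rigidity_rank V E q = cfun.dim (rigidity_map E q ` displacements V)"

definition trivial_on :: "'w set \<Rightarrow> ('w \<Rightarrow> real^2) \<Rightarrow> ('w \<Rightarrow> complex^2) \<Rightarrow> bool" where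
  "trivial_on V q m \<longleftrightarrow>
     (\<exists>(M :: complex^2^2) t. transpose M = - M \<and> (\<forall>u\<in>V. m u = M *v cvec_of (q u) + t))"

definition Cs_generic ::
  "('g, 'b) monoid_scheme \<Rightarrow> ('v, 'e) pre_digraph \<Rightarrow> 'v set \<Rightarrow> ('e \<Rightarrow> 'g) \<Rightarrow> ('g \<Rightarrow> real^2^2) \<Rightarrow>
     ('v \<Rightarrow> real^2) \<Rightarrow> bool" where
  "Cs_generic \<Gamma> G V0 \<psi> \<tau> p \<longleftrightarrow>
     (\<forall>q. symmetric_realisation \<Gamma> G V0 \<tau> q \<longrightarrow>
        rigidity_rank (cov_verts \<Gamma> G V0) (cov_edges \<Gamma> G V0 \<psi>) q
          \<le> rigidity_rank (cov_verts \<Gamma> G V0) (cov_edges \<Gamma> G V0 \<psi>) (cov_placement \<tau> p))"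

text \<open>
  The characters of a group of order two: the non-trivial element is mapped to \<open>(-1)\<^sup>j\<close>.
\<close>

definition rho :: "('g, 'b) monoid_scheme \<Rightarrow> nat \<Rightarrow> 'g \<Rightarrow> complex" where
  "rho \<Gamma> j g = (if g = \<one>\<^bsub>\<Gamma>\<^esub> then 1 else (-1) ^ j)"

definition V_rho ::
  "('g, 'b) monoid_scheme \<Rightarrow> ('v, 'e) pre_digraph \<Rightarrow> 'v set \<Rightarrow> ('g \<Rightarrow> real^2^2) \<Rightarrow> nat \<Rightarrow>
     (('g, 'v) cov_vertex \<Rightarrow> complex^2) set" where
  "V_rho \<Gamma> G V0 \<tau> j = {m \<in> displacements (cov_verts \<Gamma> G V0).
     \<forall>g\<in>carrier \<Gamma>. \<forall>x\<in>cov_verts \<Gamma> G V0.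
       m (cov_act \<Gamma> g x) = cnj (rho \<Gamma> j g) *s (cmat_of (\<tau> g) *v m x)}"

definition W_rho ::
  "('g, 'b) monoid_scheme \<Rightarrow> ('v, 'e) pre_digraph \<Rightarrow> 'v set \<Rightarrow> ('e \<Rightarrow> 'g) \<Rightarrow> nat \<Rightarrow>
     (('g, 'v) cov_vertex set \<Rightarrow> complex) set" where
  "W_rho \<Gamma> G V0 \<psi> j = {w. (\<forall>e. e \<notin> cov_edges \<Gamma> G V0 \<psi> \<longrightarrow> w e = 0) \<and>
     (\<forall>g\<in>carrier \<Gamma>. \<forall>e\<in>cov_edges \<Gamma> G V0 \<psi>.
        w (cov_act \<Gamma> g ` e) = cnj (rho \<Gamma> j g) * w e)}"

lemma V_rho_subspace: "cvec.subspace (V_rho \<Gamma> G V0 \<tau> j)"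
  by (auto simp: cvec.subspace_def V_rho_def displacements_def cvec_scale_def
      matrix_vector_right_distrib vector_scalar_commute vector_add_ldistrib
      vector_smult_assoc mult.commute)

lemma W_rho_subspace: "cfun.subspace (W_rho \<Gamma> G V0 \<psi> j)"
  by (auto simp: cfun.subspace_def W_rho_def cfun_scale_def algebra_simps)

text \<open>
  The matrix of \<open>R\<close> with respect to a basis \<open>B\<close> of the domain and a basis \<open>C\<close> of the codomain has
  rows indexed by \<open>C\<close>, columns indexed by \<open>B\<close>, and entries \<open>block_entry R C c b\<close>.
\<close>

definition block_entry ::
  "(('w \<Rightarrow> complex^2) \<Rightarrow> 'f \<Rightarrow> complex) \<Rightarrow> ('f \<Rightarrow> complex) set \<Rightarrow>
     ('f \<Rightarrow> complex) \<Rightarrow> ('w \<Rightarrow> complex^2) \<Rightarrow> complex" where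
  "block_entry R C c b = cfun.representation C (R b) c"

definition no_row_dependence ::
  "(('w \<Rightarrow> complex^2) \<Rightarrow> 'f \<Rightarrow> complex) \<Rightarrow> ('w \<Rightarrow> complex^2) set \<Rightarrow> ('f \<Rightarrow> complex) set \<Rightarrow>
     bool" where
  "no_row_dependence R B C \<longleftrightarrow>
     (\<forall>a. (\<forall>b\<in>B. (\<Sum>c\<in>C. a c * block_entry R C c b) = 0) \<longrightarrow> (\<forall>c\<in>C. a c = 0))"

lemma V_rho_basis: "\<exists>B. cvec.independent B \<and> cvec.span B = V_rho \<Gamma> G V0 \<tau> j"
  by (metis cvec.basis_exists cvec.span_minimal subset_antisym V_rho_subspace)

lemma W_rho_basis: "\<exists>C. cfun.independent C \<and> cfun.span C = W_rho \<Gamma> G V0 \<psi> j"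
  by (metis cfun.basis_exists cfun.span_minimal subset_antisym W_rho_subspace)

text \<open>
  Whether the rows of the block are dependent does not depend on the bases chosen; the
  condition below is required for all of them, and they exist by the two lemmas above.
\<close>

definition rho_isostatic ::
  "nat \<Rightarrow> ('g, 'b) monoid_scheme \<Rightarrow> ('v, 'e) pre_digraph \<Rightarrow> 'v set \<Rightarrow> ('e \<Rightarrow> 'g) \<Rightarrow>
     ('g \<Rightarrow> real^2^2) \<Rightarrow> ('v \<Rightarrow> real^2) \<Rightarrow> bool" where
  "rho_isostatic j \<Gamma> G V0 \<psi> \<tau> p \<longleftrightarrow>
     (let R = rigidity_map (cov_edges \<Gamma> G V0 \<psi>) (cov_placement \<tau> p);
          V = V_rho \<Gamma> G V0 \<tau> j;
          W = W_rho \<Gamma> G V0 \<psi> j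
      in (\<forall>m\<in>V. R m = 0 \<longrightarrow> trivial_on (cov_verts \<Gamma> G V0) (cov_placement \<tau> p) m) \<and>
         (\<forall>B C. cvec.independent B \<and> cvec.span B = V \<and> cfun.independent C \<and> cfun.span C = W \<longrightarrow>
            no_row_dependence R B C))"

end

theory Submission
  imports Defs
begin

text \<open>
  By symmetry a motion in \<open>V\<^sup>j\<close> is determined by its values on \<open>V(G)\<close>, and \<open>R\<close> restricted to \<open>V\<^sup>j\<close>
  becomes a matrix with one row per edge of \<open>G\<close>. With \<open>\<alpha>\<^sub>e\<close> the signed and \<open>\<beta>\<^sub>e\<close> the ordinary
  incidence functional of \<open>e\<close>, the row of \<open>e\<close> at the placement \<open>(x, y)\<close> sends \<open>(a, b)\<close> to
  \<open>\<alpha>\<^sub>e(x) \<alpha>\<^sub>e(a) + \<beta>\<^sub>e(y) \<beta>\<^sub>e(b)\<close> for \<open>j = 0\<close> and to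
  \<open>\<alpha>\<^sub>e(x) \<beta>\<^sub>e(a) + \<beta>\<^sub>e(y) \<alpha>\<^sub>e(b)\<close> for \<open>j = 1\<close>.
  It suffices to find one symmetric placement with independent rows: the rank of \<open>R\<close> is the sum of the ranks
  of its two blocks, and on the line from a generic placement to this one all but finitely many placements
  have independent rows in block \<open>j\<close> and at least the rank of the generic placement in the other block.
  The trivial motions then exhaust the kernel by a dimension count.

  For \<open>j = 0\<close> the placement is built by Henneberg moves: a sparse graph has a fixed vertex of degree one or a free
  vertex of degree at most three, and deleting a free vertex of degree three can be compensated by an edge between
  two of its neighbours. For \<open>j = 1\<close> a vertex with three fixed neighbours has no such edge. Instead one uses
  that the row of \<open>e\<close> spans the vectors of \<open>\<langle>\<alpha>\<^sub>e, \<beta>\<^sub>e\<rangle>\<close> annihilated by the placement (up to signs), so that, as in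
  Lovasz's theorem on generic hyperplanes, it is enough to choose generic vectors in these planes and to take the
  placement from their common kernel; that generic vectors are independent again follows by Henneberg moves,
  for a weaker count.
\<close>

section \<open>Sparse sets of signed edges\<close>

text \<open>For balanced H the bound 2|V(H)| - 3 equals weight + nfix - 3, since a fixed vertex has
  weight 1 but counts 2 there. Both counts thus read weight minus a corank, and Henneberg moves
  become an uncrossing problem: an edge that cannot be added is blocked by a saturated set, and if
  all bypasses at a vertex of degree three are blocked, the union of the blocking sets together with
  this vertex violates sparsity. The obstacle is that the corank depends on balance, and a union of
  two balanced sets may be unbalanced. There are two remedies: the shared free vertices then split
  into two classes, each of which pays separately; or the potentials are normalised to the gains at
  the removed vertex, so that they glue. For \<open>k = 3\<close>, sets that share no edge need the
  second remedy. The weaker count for generic vectors arises by doubling one edge: this lowers the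
  slacks 3 and 2 of the anti-symmetric count to 2 and 1, and the extra row provides a common kernel
  vector that is not killed by both functionals of that edge, so that no anti-symmetric row
  degenerates to zero.\<close>

text \<open>
  For a group of order two only the set of edges with identity gain matters; the tag allows parallel edges.
\<close>

datatype 'v gedge = GEdge (src: 'v) (tgt: 'v) (idgain: bool) (tag: nat)

definition ends :: "'v gedge \<Rightarrow> 'v set" where
  "ends e = {src e, tgt e}"

definition vset :: "'v gedge set \<Rightarrow> 'v set" where
  "vset F = (\<Union>e\<in>F. ends e)"

lemma vset_empty [simp]: "vset {} = {}"
  and vset_insert [simp]: "vset (insert e F) = ends e \<union> vset F"
  and vset_Un [simp]: "vset (F \<union> H) = vset F \<union> vset H"
  by (auto simp: vset_def)

lemma finite_ends [simp]: "finite (ends e)"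
  by (simp add: ends_def)

lemma finite_vset [simp]: "finite F \<Longrightarrow> finite (vset F)"
  by (simp add: vset_def)

lemma vset_mono: "F \<subseteq> H \<Longrightarrow> vset F \<subseteq> vset H"
  by (auto simp: vset_def)

lemma ends_subset_vset: "e \<in> F \<Longrightarrow> ends e \<subseteq> vset F"
  by (auto simp: vset_def)

locale mirror =
  fixes V0 :: "'v set"
begin

definition weight :: "'v set \<Rightarrow> int" where
  "weight S = (\<Sum>v\<in>S. if v \<in> V0 then 1 else 2)"

text \<open>Balance as a coboundary: a two-colouring \<open>s\<close> of the vertices that changes
  exactly along the edges of non-identity gain. Edges with a fixed end are unconstrained, which
  corresponds to deleting the fixed vertices.\<close>

definition potential :: "('v \<Rightarrow> bool) \<Rightarrow> 'v gedge set \<Rightarrow> bool" where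
  "potential s F \<longleftrightarrow>
     (\<forall>e\<in>F. src e \<notin> V0 \<and> tgt e \<notin> V0 \<longrightarrow> (s (src e) = s (tgt e)) = idgain e)"

definition bal :: "'v gedge set \<Rightarrow> bool" where
  "bal F \<longleftrightarrow> (\<exists>s. potential s F)"

definition nfix :: "'v gedge set \<Rightarrow> nat" where
  "nfix F = card (vset F \<inter> V0)"

text \<open>
  For \<open>k = 3\<close> the number \<open>weight (vset F) - corank k F\<close> is the minimum of the two bounds of
  \<open>(2, 1, 3, 1)\<close>-gain-sparsity that apply to \<open>F\<close>; for \<open>k = 2\<close> and connected \<open>F\<close> it is the dimension of the span of all
  \<open>\<alpha>\<^sub>e\<close> and \<open>\<beta>\<^sub>e\<close>.
\<close>

definition corank :: "int \<Rightarrow> 'v gedge set \<Rightarrow> int" where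
  "corank k F = (if bal F then max 1 (k - int (nfix F)) else 1)"

definition sparse :: "int \<Rightarrow> 'v gedge set \<Rightarrow> bool" where
  "sparse k F \<longleftrightarrow> finite F \<and>
     (\<forall>H\<subseteq>F. H \<noteq> {} \<longrightarrow> int (card H) \<le> weight (vset H) - corank k H)"

text \<open>A blocking set. Edges of \<open>A\<close> outside \<open>I\<close> enter through the
  vertex set and the balance but not through the count, so \<open>A\<close> can carry the very edge
  that it excludes from \<open>I\<close>.\<close>

definition saturated :: "int \<Rightarrow> 'v gedge set \<Rightarrow> 'v gedge set \<Rightarrow> bool" where
  "saturated k I A \<longleftrightarrow> finite A \<and> weight (vset A) - corank k A \<le> int (card (A \<inter> I))"

lemma weight_empty [simp]: "weight {} = 0"
  by (simp add: weight_def)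

lemma weight_insert:
  "finite S \<Longrightarrow> weight (insert v S) = (if v \<in> S then 0 else if v \<in> V0 then 1 else 2) + weight S"
  by (simp add: weight_def insert_absorb)

lemma weight_mono: "finite T \<Longrightarrow> S \<subseteq> T \<Longrightarrow> weight S \<le> weight T"
  unfolding weight_def by (rule sum_mono2) auto

lemma weight_Un_Int:
  "finite S \<Longrightarrow> finite T \<Longrightarrow> weight (S \<union> T) + weight (S \<inter> T) = weight S + weight T"
  unfolding weight_def by (rule sum.union_inter)

lemma weight_ge_card: "finite S \<Longrightarrow> int (card S) \<le> weight S"
  unfolding weight_def using sum_mono[of S "\<lambda>_. 1" "\<lambda>v. if v \<in> V0 then 1 else (2::int)"] by simp

lemma weight_free: "S \<inter> V0 = {} \<Longrightarrow> weight S = 2 * int (card S)"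
proof -
  assume "S \<inter> V0 = {}"
  then have "weight S = (\<Sum>v\<in>S. 2)"
    unfolding weight_def by (intro sum.cong) auto
  then show ?thesis by simp
qed

lemma weight_fixed: "S \<subseteq> V0 \<Longrightarrow> weight S = int (card S)"
proof -
  assume "S \<subseteq> V0"
  then have "weight S = (\<Sum>v\<in>S. 1)"
    unfolding weight_def by (intro sum.cong) auto
  then show ?thesis by simp
qed

lemma weight_split:
  assumes "finite S"
  shows "weight S = 2 * int (card (S - V0)) + int (card (S \<inter> V0))"
proof -
  have "(S - V0) \<union> (S \<inter> V0) = S" "(S - V0) \<inter> (S \<inter> V0) = {}"
    by auto
  then have "weight S = weight (S - V0) + weight (S \<inter> V0)"
    using weight_Un_Int[of "S - V0" "S \<inter> V0"] assms by simp
  moreover have "(S - V0) \<inter> V0 = {}"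
    by auto
  ultimately show ?thesis
    by (simp add: weight_free weight_fixed)
qed

lemma weight_eq_imp:
  assumes "finite S" "T \<subseteq> S" "weight S \<le> weight T"
  shows "S = T"
proof (rule ccontr)
  assume "S \<noteq> T"
  then obtain v where "v \<in> S" "v \<notin> T"
    using assms(2) by blast
  moreover have "finite T"
    using assms finite_subset by blast
  ultimately have "weight T < weight (insert v T)"
    by (simp add: weight_insert)
  also have "\<dots> \<le> weight S"
    using \<open>v \<in> S\<close> assms by (intro weight_mono) auto
  finally show False
    using assms by simp
qed

lemma potential_subset: "potential s F \<Longrightarrow> H \<subseteq> F \<Longrightarrow> potential s H"
  by (auto simp: potential_def)

lemma bal_subset: "bal F \<Longrightarrow> H \<subseteq> F \<Longrightarrow> bal H"
  using potential_subset unfolding bal_def by blast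

text \<open>\<open>b\<close> chooses between \<open>s\<close> and its negation: the freedom of one
  global change of sign.\<close>

lemma potential_flip: "potential (\<lambda>v. s v = b) F = potential s F"
  by (auto simp: potential_def)

lemma nfix_mono: "finite F \<Longrightarrow> H \<subseteq> F \<Longrightarrow> nfix H \<le> nfix F"
  unfolding nfix_def using vset_mono by (intro card_mono) auto

lemma corank_mono: "finite F \<Longrightarrow> H \<subseteq> F \<Longrightarrow> corank k F \<le> corank k H"
  using nfix_mono[of F H] bal_subset[of F H] by (auto simp: corank_def)

lemma corank_ge_1: "1 \<le> corank k F"
  by (simp add: corank_def)

lemma corank_le: "1 < corank k F \<Longrightarrow> bal F \<and> corank k F = k - int (nfix F)"
  by (auto simp: corank_def split: if_splits)

lemma sparse_subset: "sparse k F \<Longrightarrow> H \<subseteq> F \<Longrightarrow> sparse k H"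
  unfolding sparse_def using finite_subset by (metis subset_trans)

lemma sparse_finite: "sparse k F \<Longrightarrow> finite F"
  by (simp add: sparse_def)

lemma sparseD:
  "sparse k F \<Longrightarrow> H \<subseteq> F \<Longrightarrow> H \<noteq> {} \<Longrightarrow> int (card H) \<le> weight (vset H) - corank k H"
  by (simp add: sparse_def)

section \<open>Uncrossing of saturated sets\<close>

lemma potential_glue:
  assumes "potential s A" "potential t B" "\<forall>v \<in> vset A \<inter> vset B - V0. s v = t v"
  shows "potential (\<lambda>v. if v \<in> vset A then s v else t v) (A \<union> B)"
  unfolding potential_def
proof (intro ballI impI)
  fix e assume e: "e \<in> A \<union> B" "src e \<notin> V0 \<and> tgt e \<notin> V0"
  let ?r = "\<lambda>v. if v \<in> vset A then s v else t v"
  show "(?r (src e) = ?r (tgt e)) = idgain e"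
  proof (cases "e \<in> A")
    case True
    then have "src e \<in> vset A" "tgt e \<in> vset A"
      by (auto simp: vset_def ends_def)
    then show ?thesis
      using assms(1) True e by (auto simp: potential_def)
  next
    case False
    then have "e \<in> B" "src e \<in> vset B" "tgt e \<in> vset B"
      using e by (auto simp: vset_def ends_def)
    then have "?r (src e) = t (src e)" "?r (tgt e) = t (tgt e)"
      using e assms(3) by auto
    then show ?thesis
      using assms(2) \<open>e \<in> B\<close> e by (auto simp: potential_def)
  qed
qed

text \<open>\<open>weight\<close> and the cardinality are modular, so they cancel up to their values
  on the overlap, and only the coranks remain to be compared with the surplus of the
  overlap.\<close>

lemma saturated_Un_arith:
  assumes "saturated k I A" "saturated k I B"
    and "corank k A + corank k B \<le>
      weight (vset A \<inter> vset B) - int (card (A \<inter> B \<inter> I)) + corank k (A \<union> B)"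
  shows "saturated k I (A \<union> B)"
proof -
  have fin: "finite A" "finite B"
    using assms by (auto simp: saturated_def)
  have "card (A \<inter> I) + card (B \<inter> I) = card ((A \<union> B) \<inter> I) + card (A \<inter> B \<inter> I)"
  proof -
    have "(A \<union> B) \<inter> I = (A \<inter> I) \<union> (B \<inter> I)" "A \<inter> B \<inter> I = (A \<inter> I) \<inter> (B \<inter> I)"
      by auto
    then show ?thesis
      using card_Un_Int[of "A \<inter> I" "B \<inter> I"] fin by simp
  qed
  moreover have "weight (vset A \<union> vset B) + weight (vset A \<inter> vset B) = weight (vset A) + weight (vset B)"
    using fin by (intro weight_Un_Int) auto
  ultimately show ?thesis
    using assms fin unfolding saturated_def by simp
qed

text \<open>\<open>S1\<close> and \<open>S2\<close> consist of the shared free vertices where the two potentials agree and disagree.\<close>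

lemma unbalanced_Un_split:
  assumes "finite A" "finite B" "bal A" "bal B" "\<not> bal (A \<union> B)" "D \<subseteq> A \<inter> B"
  obtains S1 S2 where "S1 \<noteq> {}" "S2 \<noteq> {}" "S1 \<inter> S2 = {}"
    "S1 \<union> S2 = vset A \<inter> vset B - V0"
    "\<And>e. e \<in> D \<Longrightarrow> ends e \<subseteq> S1 \<union> V0 \<or> ends e \<subseteq> S2 \<union> V0"
proof -
  obtain s t where st: "potential s A" "potential t B"
    using assms by (auto simp: bal_def)
  define S1 where "S1 = {v \<in> vset A \<inter> vset B - V0. s v = t v}"
  define S2 where "S2 = {v \<in> vset A \<inter> vset B - V0. s v \<noteq> t v}"
  have "S1 \<noteq> {}"
  proof
    assume "S1 = {}"
    \<comment> \<open>Potentials that disagree on every shared free vertex agree after negating one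
      of them, and then they glue.\<close>
    moreover have "potential (\<lambda>v. t v = False) B"
      using st potential_flip[of t False B] by simp
    ultimately have "bal (A \<union> B)"
      unfolding bal_def using potential_glue[OF st(1), of "\<lambda>v. t v = False" B]
      by (fastforce simp: S1_def)
    then show False using assms by simp
  qed
  moreover have "S2 \<noteq> {}"
  proof
    assume "S2 = {}"
    then have "bal (A \<union> B)"
      unfolding bal_def using potential_glue[OF st] by (fastforce simp: S2_def)
    then show False using assms by simp
  qed
  moreover have "S1 \<inter> S2 = {}" "S1 \<union> S2 = vset A \<inter> vset B - V0"
    by (auto simp: S1_def S2_def)
  moreover have "ends e \<subseteq> S1 \<union> V0 \<or> ends e \<subseteq> S2 \<union> V0" if "e \<in> D" for e
  proof -
    have e: "e \<in> A" "e \<in> B" using that assms by auto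
    then have "ends e \<subseteq> vset A \<inter> vset B"
      by (auto simp: vset_def)
    \<comment> \<open>Along a common edge either both potentials change or neither does, so
      agreement is constant on its ends.\<close>
    moreover have "src e \<notin> V0 \<and> tgt e \<notin> V0 \<Longrightarrow> (s (src e) = t (src e)) = (s (tgt e) = t (tgt e))"
      using st e by (auto simp: potential_def)
    ultimately show ?thesis
      by (auto simp: S1_def S2_def ends_def)
  qed
  ultimately show thesis
    using that by blast
qed

text \<open>Bounds the shared edges inside one class of \<open>unbalanced_Un_split\<close>. If
  \<open>D\<close> is nonempty, each vertex of \<open>T\<close> counts once in the weight and once
  against the corank, hence the factor 2. If \<open>D\<close> is empty, one free vertex in
  \<open>S\<close> already has weight 2.\<close>

lemma card_touching_le:
  assumes I: "sparse k I" "D \<subseteq> I" and S: "finite S" "S \<noteq> {}" "S \<inter> V0 = {}" and T: "T \<subseteq> V0" "finite T"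
    and D: "\<And>e. e \<in> D \<Longrightarrow> ends e \<subseteq> S \<union> T" and "bal D" and kk: "2 \<le> k"
  shows "int (card D) \<le> weight S - 2 + (if D = {} then 0 else 2 * int (card T) - k + 2)"
proof (cases "D = {}")
  case True
  have "1 \<le> card S"
    using S by (simp add: Suc_leI card_gt_0_iff)
  then show ?thesis
    using S True by (simp add: weight_free)
next
  case False
  have fin: "finite D"
    using I sparse_finite finite_subset by blast
  have "int (card D) \<le> weight (vset D) - corank k D"
    using sparseD I False by blast
  moreover have "k - int (nfix D) \<le> corank k D"
    using \<open>bal D\<close> by (simp add: corank_def)
  moreover have "weight (vset D) = weight (vset D - V0) + int (nfix D)"
    using weight_split[of "vset D"] weight_free[of "vset D - V0"] fin
    by (auto simp: nfix_def Diff_Int_distrib2)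
  moreover have "weight (vset D - V0) \<le> weight S"
    using D S T by (intro weight_mono) (auto simp: vset_def)
  moreover have "nfix D \<le> card T"
    unfolding nfix_def using D S T by (intro card_mono) (auto simp: vset_def)
  ultimately show ?thesis
    using False by simp
qed

text \<open>A shared vertex suffices because a corank above 1 forces balance without fixed vertices.
  Then either the union is balanced and keeps corank 2, or the shared vertices split into two
  classes whose surplus over the shared edges pays for both coranks.\<close>

lemma saturated_Un_2:
  assumes I: "sparse 2 I" and A: "saturated 2 I A" and B: "saturated 2 I B"
    and ne: "vset A \<inter> vset B \<noteq> {}"
  shows "saturated 2 I (A \<union> B)"
proof (rule saturated_Un_arith[OF A B])
  let ?S = "vset A \<inter> vset B" and ?D = "A \<inter> B \<inter> I" and ?c = "corank 2"
  have fin: "finite A" "finite B"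
    using A B by (auto simp: saturated_def)
  have c2: "?c X \<le> 2" for X
    by (simp add: corank_def)
  have free: "bal X \<and> vset X \<inter> V0 = {} \<and> ?c X = 2" if "finite X" "?c X \<noteq> 1" for X
  proof -
    have "bal X" "?c X = 2 - int (nfix X)"
      using corank_le[of 2 X] corank_ge_1[of 2 X] that by auto
    moreover from this have "nfix X = 0"
      using that corank_ge_1[of 2 X] by auto
    ultimately show ?thesis
      using that by (simp add: nfix_def)
  qed
  \<comment> \<open>The overlap alone pays for either corank: by the weight of a shared vertex if no
    edge of \<open>I\<close> is shared, and otherwise by sparsity of the shared edges and
    monotonicity of the corank.\<close>
  have h: "?c X \<le> weight ?S - int (card ?D)" if X: "X = A \<or> X = B" for X
  proof (cases "?D = {}")
    case True
    have "1 \<le> card ?S"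
      using ne fin by (simp add: Suc_leI card_gt_0_iff)
    have "?c X \<le> weight ?S"
    proof (cases "?c X = 1")
      case True
      then show ?thesis
        using weight_ge_card[of ?S] fin \<open>1 \<le> card ?S\<close> by simp
    next
      case False
      then have "vset X \<inter> V0 = {}"
        using free[of X] fin X by blast
      then have "?S \<inter> V0 = {}"
        using X by blast
      then show ?thesis
        using weight_free[of ?S] c2[of X] \<open>1 \<le> card ?S\<close> by linarith
    qed
    then show ?thesis
      by (metis True card.empty diff_zero of_nat_0)
  next
    case False
    have "int (card ?D) \<le> weight (vset ?D) - ?c ?D"
      using sparseD[OF I, of ?D] False by blast
    moreover have "weight (vset ?D) \<le> weight ?S"
      using fin vset_mono[of ?D A] vset_mono[of ?D B] by (intro weight_mono) auto
    moreover have "?c X \<le> ?c ?D"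
      using fin X by (intro corank_mono) auto
    ultimately show ?thesis by linarith
  qed
  show "?c A + ?c B \<le> weight ?S - int (card ?D) + ?c (A \<union> B)"
  proof (cases "?c A = 1 \<or> ?c B = 1")
    case True
    then show ?thesis
      using h[OF disjI1[OF refl]] h[OF disjI2[OF refl]] corank_ge_1[of 2 "A \<union> B"] by linarith
  next
    case False
    then have fr: "bal A" "vset A \<inter> V0 = {}" "?c A = 2" "bal B" "vset B \<inter> V0 = {}" "?c B = 2"
      using free fin by auto
    show ?thesis
    proof (cases "bal (A \<union> B)")
      case True
      then have "?c (A \<union> B) = 2"
        using fr by (simp add: corank_def nfix_def Int_Un_distrib2)
      then show ?thesis
        using h[OF disjI1[OF refl]] fr by linarith
    next
      case nb: False
      obtain S1 S2 where S: "S1 \<noteq> {}" "S2 \<noteq> {}" "S1 \<inter> S2 = {}" "S1 \<union> S2 = ?S - V0"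
        "\<And>e. e \<in> ?D \<Longrightarrow> ends e \<subseteq> S1 \<union> V0 \<or> ends e \<subseteq> S2 \<union> V0"
        using unbalanced_Un_split[OF fin fr(1,4) nb, of ?D] by blast
      define D1 where "D1 = {e \<in> ?D. ends e \<subseteq> S1}"
      define D2 where "D2 = {e \<in> ?D. ends e \<subseteq> S2}"
      have fS: "finite S1" "finite S2" "S1 \<inter> V0 = {}" "S2 \<inter> V0 = {}"
        using S(4) fin finite_subset[of S1 ?S] finite_subset[of S2 ?S] by auto
      have "ends e \<inter> V0 = {}" if "e \<in> ?D" for e
        using that fr(2) by (auto simp: vset_def)
      then have D12: "?D = D1 \<union> D2"
        using S(5) by (fastforce simp: D1_def D2_def)
      have D12': "D1 \<subseteq> I" "bal D1" "D2 \<subseteq> I" "bal D2"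
        using bal_subset[OF fr(1), of D1] bal_subset[OF fr(1), of D2] by (auto simp: D1_def D2_def)
      \<comment> \<open>Without fixed vertices each class keeps a surplus of at least 2 over its
        edges; together this is the sum of the two coranks.\<close>
      have "int (card D1) \<le> weight S1 - 2"
        using card_touching_le[OF I D12'(1) fS(1) S(1) fS(3), of "{}"] D12'(2) by (auto simp: D1_def split: if_splits)
      moreover have "int (card D2) \<le> weight S2 - 2"
        using card_touching_le[OF I D12'(3) fS(2) S(2) fS(4), of "{}"] D12'(4) by (auto simp: D2_def split: if_splits)
      moreover have "card ?D \<le> card D1 + card D2"
        unfolding D12 by (rule card_Un_le)
      moreover have "weight ?S = weight S1 + weight S2"
      proof -
        have "?S - V0 = ?S"
          using fr(2) by auto
        then show ?thesis
          using weight_Un_Int[OF fS(1,2)] S(3,4) by simp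
      qed
      ultimately show ?thesis
        using fr corank_ge_1[of 2 "A \<union> B"] by linarith
    qed
  qed
qed

lemma corank_3_cases:
  assumes "corank 3 A \<noteq> 1"
  shows "bal A" "corank 3 A = 3 - int (nfix A)" "nfix A \<le> 1"
  using corank_le[of 3 A] corank_ge_1[of 3 A] assms by auto

text \<open>Two sets of corank 3 with unbalanced union need a surplus of 5 on the overlap; the two
  classes of shared vertices give 2 each, and the shared edge supplies the missing unit. If the
  union is balanced, \<open>nfix\<close> is modular and sparsity of the shared edges pays for the
  rest.\<close>

lemma saturated_Un_3:
  assumes I: "sparse 3 I" and A: "saturated 3 I A" and B: "saturated 3 I B"
    and ne: "A \<inter> B \<inter> I \<noteq> {}"
  shows "saturated 3 I (A \<union> B)"
proof (rule saturated_Un_arith[OF A B])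
  let ?S = "vset A \<inter> vset B" and ?D = "A \<inter> B \<inter> I" and ?c = "corank 3"
  have fin: "finite A" "finite B"
    using A B by (auto simp: saturated_def)
  have cD: "int (card ?D) \<le> weight (vset ?D) - ?c ?D"
    using sparseD[OF I, of ?D] ne by blast
  have wD: "weight (vset ?D) \<le> weight ?S"
    using fin vset_mono[of ?D A] vset_mono[of ?D B] by (intro weight_mono) auto
  have h: "?c X \<le> weight ?S - int (card ?D)" if X: "X = A \<or> X = B" for X
  proof -
    have "?c X \<le> ?c ?D"
      using fin X by (intro corank_mono) auto
    then show ?thesis
      using cD wD by linarith
  qed
  show "?c A + ?c B \<le> weight ?S - int (card ?D) + ?c (A \<union> B)"
  proof (cases "?c A = 1 \<or> ?c B = 1")
    case True
    then show ?thesis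
      using h[OF disjI1[OF refl]] h[OF disjI2[OF refl]] corank_ge_1[of 3 "A \<union> B"] by linarith
  next
    case False
    then have cA: "bal A" "?c A = 3 - int (nfix A)" "nfix A \<le> 1"
      and cB: "bal B" "?c B = 3 - int (nfix B)" "nfix B \<le> 1"
      using corank_3_cases by blast+
    define n where "n = card (?S \<inter> V0)"
    have n: "n \<le> nfix A" "n \<le> nfix B"
      unfolding n_def nfix_def using fin by (auto intro!: card_mono)
    have nD: "nfix ?D \<le> n"
      unfolding n_def nfix_def using fin by (intro card_mono) (auto simp: vset_def)
    show ?thesis
    proof (cases "bal (A \<union> B)")
      case True
      have "(vset A \<union> vset B) \<inter> V0 = (vset A \<inter> V0) \<union> (vset B \<inter> V0)"
        "?S \<inter> V0 = (vset A \<inter> V0) \<inter> (vset B \<inter> V0)"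
        by auto
      then have "nfix A + nfix B = nfix (A \<union> B) + n"
        using card_Un_Int[of "vset A \<inter> V0" "vset B \<inter> V0"] fin by (simp add: nfix_def n_def)
      moreover have "3 - int (nfix (A \<union> B)) \<le> ?c (A \<union> B)"
        using True by (simp add: corank_def)
      moreover have "3 - int (nfix ?D) \<le> ?c ?D"
        using bal_subset[OF cA(1), of ?D] by (auto simp: corank_def)
      ultimately show ?thesis
        using cA(2) cB(2) cD wD nD by linarith
    next
      case nb: False
      obtain S1 S2 where S: "S1 \<noteq> {}" "S2 \<noteq> {}" "S1 \<inter> S2 = {}" "S1 \<union> S2 = ?S - V0"
        "\<And>e. e \<in> ?D \<Longrightarrow> ends e \<subseteq> S1 \<union> V0 \<or> ends e \<subseteq> S2 \<union> V0"
        using unbalanced_Un_split[OF fin cA(1) cB(1) nb, of ?D] by blast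
      define T where "T = ?S \<inter> V0"
      have T: "T \<subseteq> V0" "finite T" "card T = n" "finite ?S"
        using fin by (auto simp: T_def n_def)
      define D1 where "D1 = {e \<in> ?D. ends e \<subseteq> S1 \<union> T}"
      define D2 where "D2 = {e \<in> ?D. ends e \<subseteq> S2 \<union> T}"
      have fS: "finite S1" "finite S2" "S1 \<inter> V0 = {}" "S2 \<inter> V0 = {}"
        using S(4) fin finite_subset[of S1 ?S] finite_subset[of S2 ?S] by auto
      have endsD: "ends e \<subseteq> ?S" if "e \<in> ?D" for e
        using that ends_subset_vset[of e A] ends_subset_vset[of e B] by auto
      have "ends e \<subseteq> S1 \<union> T \<or> ends e \<subseteq> S2 \<union> T" if "e \<in> ?D" for e
        using S(5)[OF that] endsD[OF that] by (auto simp: T_def)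
      then have D12: "?D = D1 \<union> D2"
        by (auto simp: D1_def D2_def)
      have D12': "D1 \<subseteq> I" "bal D1" "D2 \<subseteq> I" "bal D2"
        using bal_subset[OF cA(1), of D1] bal_subset[OF cA(1), of D2] by (auto simp: D1_def D2_def)
      have eD: "\<And>e. e \<in> D1 \<Longrightarrow> ends e \<subseteq> S1 \<union> T" "\<And>e. e \<in> D2 \<Longrightarrow> ends e \<subseteq> S2 \<union> T"
        by (auto simp: D1_def D2_def)
      have "int (card D1) \<le> weight S1 - 2 + (if D1 = {} then 0 else 2 * int n - 3 + 2)"
        using card_touching_le[OF I D12'(1) fS(1) S(1) fS(3) T(1,2) eD(1) D12'(2)] unfolding T(3) by auto
      moreover have "int (card D2) \<le> weight S2 - 2 + (if D2 = {} then 0 else 2 * int n - 3 + 2)"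
        using card_touching_le[OF I D12'(3) fS(2) S(2) fS(4) T(1,2) eD(2) D12'(4)] unfolding T(3) by auto
      moreover have "card ?D \<le> card D1 + card D2"
        unfolding D12 by (rule card_Un_le)
      moreover have "weight ?S = weight S1 + weight S2 + int n"
      proof -
        have "(?S - V0) \<inter> V0 = {}"
          by auto
        then have "weight ?S = weight (?S - V0) + int n"
          using weight_split[OF T(4)] weight_free[of "?S - V0"] by (simp add: n_def)
        moreover have "weight (?S - V0) = weight S1 + weight S2"
          using weight_Un_Int[OF fS(1,2)] S(3,4) by simp
        ultimately show ?thesis by simp
      qed
      moreover have "D1 \<noteq> {} \<or> D2 \<noteq> {}"
        using ne D12 by auto
      \<comment> \<open>Here \<open>n\<close> is at most 1. For \<open>n = 0\<close> the surplus is
        at least 2 + 3, enough for coranks 3 and 3; for \<open>n = 1\<close> it is at least 1 + 1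
        plus the weight 1 of the shared fixed vertex, enough for coranks 2 and 2.\<close>
      ultimately show ?thesis
        using cA cB n corank_ge_1[of 3 "A \<union> B"] by (cases "D1 = {}"; cases "D2 = {}"; cases "n = 0"; simp)
    qed
  qed
qed

section \<open>Saturated sets that block edges between three neighbours\<close>

lemma bool_trichotomy: "(a :: bool) \<noteq> b \<Longrightarrow> a \<noteq> c \<Longrightarrow> b \<noteq> c \<Longrightarrow> False"
  "(b :: bool) \<noteq> c \<Longrightarrow> (a = b) = (a = c) \<Longrightarrow> False"
  "((a :: bool) = b) = (a = c) \<Longrightarrow> b = c"
  by (cases a; cases b; cases c; simp)+

lemma card_Un_Int_restrict:
  assumes "finite S" "finite T"
  shows "card ((S \<union> T) \<inter> V) + card (S \<inter> T \<inter> V) = card (S \<inter> V) + card (T \<inter> V)"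
proof -
  have "(S \<union> T) \<inter> V = (S \<inter> V) \<union> (T \<inter> V)" "S \<inter> T \<inter> V = (S \<inter> V) \<inter> (T \<inter> V)"
    by auto
  then show ?thesis
    using card_Un_Int[of "S \<inter> V" "T \<inter> V"] assms by simp
qed

lemma balI: "potential s F \<Longrightarrow> bal F"
  by (auto simp: bal_def)

lemma potential_ends:
  assumes "potential s A" "e \<in> A" "ends e = {u, v}" "u \<notin> V0" "v \<notin> V0"
  shows "(s u = s v) = idgain e"
  using assms by (auto simp: potential_def ends_def doubleton_eq_iff)

text \<open>The one global negation is spent on a free end; the gain of the edge then settles the
  other end.\<close>

lemma bal_normalise:
  assumes "bal A" "e \<in> A" "ends e = {u, v}" "idgain e = (gu = gv)"
  obtains s where "potential s A" "u \<notin> V0 \<Longrightarrow> s u = gu" "v \<notin> V0 \<Longrightarrow> s v = gv"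
proof -
  obtain s where s: "potential s A"
    using assms by (auto simp: bal_def)
  define b where "b = (if u \<in> V0 then s v = gv else s u = gu)"
  have "potential (\<lambda>x. s x = b) A"
    using s by (simp add: potential_flip)
  moreover have "u \<notin> V0 \<Longrightarrow> (s u = b) = gu"
    by (auto simp: b_def)
  moreover have "v \<notin> V0 \<Longrightarrow> (s v = b) = gv"
    using potential_ends[OF s assms(2,3)] assms(4) by (auto simp: b_def)
  ultimately show thesis
    using that by blast
qed

lemma nfix_ge:
  assumes "finite A" "{u, v} \<subseteq> vset A"
  shows "card ({u, v} \<inter> V0) \<le> nfix A"
  unfolding nfix_def using assms by (intro card_mono) auto

lemma corank_3_bound:
  assumes "finite A" "{u, v} \<subseteq> vset A"
  shows "corank 3 A \<le> 3" "u \<in> V0 \<or> v \<in> V0 \<Longrightarrow> corank 3 A \<le> 2"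
    "u \<in> V0 \<Longrightarrow> v \<in> V0 \<Longrightarrow> u \<noteq> v \<Longrightarrow> corank 3 A = 1"
proof -
  have n: "card ({u, v} \<inter> V0) \<le> nfix A"
    by (rule nfix_ge[OF assms])
  show "corank 3 A \<le> 3"
    by (simp add: corank_def)
  show "u \<in> V0 \<or> v \<in> V0 \<Longrightarrow> corank 3 A \<le> 2"
    using n by (cases "u = v") (auto simp: corank_def Int_insert_left split: if_splits)
  show "u \<in> V0 \<Longrightarrow> v \<in> V0 \<Longrightarrow> u \<noteq> v \<Longrightarrow> corank 3 A = 1"
    using n by (auto simp: corank_def)
qed

lemma weight_pair: "u \<noteq> v \<Longrightarrow> weight {u, v} = (if u \<in> V0 then 1 else 2) + (if v \<in> V0 then 1 else 2)"
  by (simp add: weight_insert)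

lemma unbalanced_loop:
  assumes "e \<in> A" "ends e = {u}" "u \<notin> V0" "\<not> idgain e"
  shows "\<not> bal A"
  using assms potential_ends[of _ A e u u] by (auto simp: bal_def)

lemma corank_unbalanced: "\<not> bal A \<Longrightarrow> corank k A = 1"
  by (simp add: corank_def)

text \<open>
  In the next lemmas \<open>(o1, g1)\<close>, \<open>(o2, g2)\<close>, \<open>(o3, g3)\<close> are the other ends and the gains of the
  three edges at a vertex to be removed, and \<open>f\<close> joins two of these ends with the quotient gain.
\<close>

lemma saturated_Un_two_of_three:
  assumes I: "sparse 3 I" and A: "saturated 3 I A" and B: "saturated 3 I B"
    and f: "f12 \<in> A" "f13 \<in> A" "f23 \<in> B"
    and e: "ends f12 = {o1, o2}" "ends f13 = {o1, o3}" "ends f23 = {o2, o3}"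
    and g: "idgain f12 = ((g1 :: bool) = g2)" "idgain f13 = (g1 = g3)" "idgain f23 = (g2 = g3)"
    and lifts: "o1 = o2 \<Longrightarrow> o1 \<notin> V0 \<and> g1 \<noteq> g2" "o1 = o3 \<Longrightarrow> o1 \<notin> V0 \<and> g1 \<noteq> g3"
      "o2 = o3 \<Longrightarrow> o2 \<notin> V0 \<and> g2 \<noteq> g3"
  shows "saturated 3 I (A \<union> B)"
proof (cases "A \<inter> B \<inter> I = {}")
  case False
  then show ?thesis using saturated_Un_3 I A B by blast
next
  case True
  let ?S = "vset A \<inter> vset B" and ?c = "corank 3"
  have fin: "finite A" "finite B"
    using A B by (auto simp: saturated_def)
  have in_A: "{o1, o2} \<subseteq> vset A" "{o1, o3} \<subseteq> vset A" "{o2, o3} \<subseteq> vset A" and in_B: "{o2, o3} \<subseteq> vset B"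
    using f e ends_subset_vset[of f12 A] ends_subset_vset[of f13 A] ends_subset_vset[of f23 B] by auto
  have wS: "weight {o2, o3} \<le> weight ?S"
    using in_A in_B fin by (intro weight_mono) auto
  note c1 = corank_ge_1[of 3 "A \<union> B"]
  note bA = corank_3_bound[OF fin(1) in_A(1)] corank_3_bound[OF fin(1) in_A(3)]
  note bB = corank_3_bound[OF fin(2) in_B]
  \<comment> \<open>No edge of \<open>I\<close> is shared, so the coranks must be paid by the shared
    vertices \<open>o2\<close> and \<open>o3\<close> alone.\<close>
  have "?c A + ?c B \<le> weight ?S + ?c (A \<union> B)"
  proof (cases "o2 = o3")
    case eq: True
    then have fr: "o2 \<notin> V0" "g2 \<noteq> g3"
      using lifts by auto
    have "?c B = 1"
      using unbalanced_loop[of f23 B o2] eq f e g fr by (intro corank_unbalanced) auto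
    moreover have "2 \<le> weight ?S"
      using wS fr eq by (simp add: weight_insert)
    \<comment> \<open>For a free \<open>o1\<close> the edges \<open>f12\<close> and
      \<open>f13\<close> are parallel with different gains, so \<open>A\<close> is unbalanced; a
      fixed \<open>o1\<close> by itself lowers the corank to 2.\<close>
    moreover have "?c A \<le> 2"
    proof (cases "o1 \<in> V0")
      case True
      then show ?thesis using bA by blast
    next
      case False
      have "\<not> potential s A" for s
      proof
        assume s: "potential s A"
        have o3: "o3 \<notin> V0"
          using fr(1) eq by simp
        have "(g1 = g2) = (g1 = g3)"
          using trans[OF potential_ends[OF s f(1) e(1) False fr(1)] g(1), symmetric]
            trans[OF potential_ends[OF s f(2) e(2) False o3] g(2)]
          unfolding eq by (rule trans)
        then show False
          by (rule bool_trichotomy(2)[OF fr(2)])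
      qed
      then have "\<not> bal A"
        by (simp add: bal_def)
      then show ?thesis by (simp add: corank_unbalanced)
    qed
    ultimately show ?thesis using c1 by linarith
  next
    case neq: False
    consider "o2 \<in> V0" "o3 \<in> V0" | "o2 \<in> V0 \<or> o3 \<in> V0" "3 \<le> weight {o2, o3}"
      | "o2 \<notin> V0" "o3 \<notin> V0" "weight {o2, o3} = 4"
      using weight_pair[OF neq] by - (cases "o2 \<in> V0"; cases "o3 \<in> V0"; simp)
    then show ?thesis
    proof cases
      case 1
      then have "?c A = 1" "?c B = 1" "weight {o2, o3} = 2"
        using bA bB neq weight_pair[OF neq] by auto
      then show ?thesis using wS c1 by linarith
    next
      case 2
      then have "?c A \<le> 2" "?c B \<le> 2"
        using bA bB by auto
      then show ?thesis using wS c1 2 by linarith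
    next
      case 3
      show ?thesis
      proof (cases "?c A + ?c B \<le> 5 \<or> 5 \<le> weight ?S")
        case True
        then show ?thesis using bA bB c1 wS 3 by linarith
      next
        case False
        \<comment> \<open>The tight case: no vertex is fixed and the overlap is exactly
          \<open>{o2, o3}\<close>. Potentials normalised to \<open>g2\<close> and \<open>g3\<close>
          agree there, so the union is balanced and keeps corank 3.\<close>
        then have c3: "?c A = 3" "?c B = 3"
          using bA bB by linarith+
        then have bal: "bal A" "vset A \<inter> V0 = {}" "bal B" "vset B \<inter> V0 = {}"
          using corank_3_cases[of A] corank_3_cases[of B] fin by (auto simp: nfix_def)
        have S: "?S = {o2, o3}"
          using weight_eq_imp[of ?S "{o2, o3}"] False in_A in_B fin 3 by auto
        have o1: "o1 \<notin> V0"
          using bal in_A by auto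
        obtain s where s: "potential s A" "o1 \<notin> V0 \<Longrightarrow> s o1 = g1" "o2 \<notin> V0 \<Longrightarrow> s o2 = g2"
          using bal_normalise[OF bal(1) f(1) e(1) g(1)] by metis
        have s3: "s o3 = g3"
          using trans[OF potential_ends[OF s(1) f(2) e(2) o1 3(2)] g(2)]
          unfolding s(2)[OF o1] by (rule bool_trichotomy(3))
        obtain t where t: "potential t B" "o2 \<notin> V0 \<Longrightarrow> t o2 = g2" "o3 \<notin> V0 \<Longrightarrow> t o3 = g3"
          using bal_normalise[OF bal(3) f(3) e(3) g(3)] by metis
        have agree: "s v = t v" if "v \<in> ?S - V0" for v
        proof -
          have "v = o2 \<or> v = o3"
            using that S by blast
          then show ?thesis
            by (elim disjE) (simp_all only: s(3)[OF 3(1)] s3 t(2)[OF 3(1)] t(3)[OF 3(2)])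
        qed
        then have "bal (A \<union> B)"
          by (intro balI[OF potential_glue[OF s(1) t(1)]] ballI)
        then have "?c (A \<union> B) = 3"
          using bal by (simp add: corank_def nfix_def Int_Un_distrib2)
        then show ?thesis using c3 wS 3 by linarith
      qed
    qed
  qed
  then show ?thesis
    using saturated_Un_arith[OF A B] True by simp
qed

text \<open>Two of the sets may share only one vertex, which is too little to join them for
  \<open>k = 3\<close>; hence all three are joined in a single count. In the tight case they overlap
  exactly in the three neighbours, where the potentials normalised to the gains agree, so the union
  is balanced.\<close>

lemma saturated_Un_three:
  assumes A: "saturated 3 I A" and B: "saturated 3 I B" and C: "saturated 3 I C"
    and disj: "A \<inter> B \<inter> I = {}" "(A \<union> B) \<inter> C \<inter> I = {}"
    and f: "f12 \<in> A" "f13 \<in> B" "f23 \<in> C"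
    and e: "ends f12 = {o1, o2}" "ends f13 = {o1, o3}" "ends f23 = {o2, o3}"
    and g: "idgain f12 = ((g1 :: bool) = g2)" "idgain f13 = (g1 = g3)" "idgain f23 = (g2 = g3)"
    and lifts: "o1 = o2 \<Longrightarrow> o1 \<notin> V0 \<and> g1 \<noteq> g2" "o1 = o3 \<Longrightarrow> o1 \<notin> V0 \<and> g1 \<noteq> g3"
      "o2 = o3 \<Longrightarrow> o2 \<notin> V0 \<and> g2 \<noteq> g3"
  shows "saturated 3 I (A \<union> B \<union> C)"
proof -
  let ?S = "vset A \<inter> vset B" and ?T = "(vset A \<union> vset B) \<inter> vset C" and ?c = "corank 3"
  let ?Z = "A \<union> B \<union> C"
  have fin: "finite A" "finite B" "finite C"
    using A B C by (auto simp: saturated_def)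
  have in_vset: "{o1, o2} \<subseteq> vset A" "{o1, o3} \<subseteq> vset B" "{o2, o3} \<subseteq> vset C"
    using f e ends_subset_vset[of f12 A] ends_subset_vset[of f13 B] ends_subset_vset[of f23 C] by auto
  have wS: "weight {o1} \<le> weight ?S" and wT: "weight {o2, o3} \<le> weight ?T"
    using in_vset fin by (auto intro!: weight_mono)
  note c1 = corank_ge_1[of 3 ?Z]
  note b = corank_3_bound[OF fin(1) in_vset(1)] corank_3_bound[OF fin(2) in_vset(2)]
    corank_3_bound[OF fin(3) in_vset(3)]
  have "?c A + ?c B + ?c C \<le> weight ?S + weight ?T + ?c ?Z"
  proof (cases "o1 \<noteq> o2 \<and> o1 \<noteq> o3 \<and> o2 \<noteq> o3")
    case False
    have loop: "?c X = 1" if "f' \<in> X" "ends f' = {u}" "u \<notin> V0" "\<not> idgain f'" for X f' u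
      using unbalanced_loop that by (intro corank_unbalanced) auto
    have two: "weight {u, v} = 4 \<or> weight {u, v} = 3 \<and> (u \<in> V0 \<or> v \<in> V0)"
      if "u \<noteq> v" "u \<notin> V0 \<or> v \<notin> V0" for u v
      using that weight_pair by auto
    have one: "weight {u} = 2" if "u \<notin> V0" for u
      using that by (simp add: weight_insert)
    \<comment> \<open>Otherwise the three gains would be pairwise different elements of a group of
      order two.\<close>
    have "\<not> (o1 = o2 \<and> o1 = o3)"
    proof
      assume "o1 = o2 \<and> o1 = o3"
      then have "o1 = o2" "o1 = o3" "o2 = o3"
        by blast+
      then show False
        using bool_trichotomy(1)[OF conjunct2[OF lifts(1)] conjunct2[OF lifts(2)] conjunct2[OF lifts(3)]]
        by blast
    qed
    then consider "o1 = o2" "o1 \<noteq> o3" | "o1 = o3" "o1 \<noteq> o2" | "o2 = o3" "o1 \<noteq> o2"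
      using False by blast
    then show ?thesis
    proof cases
      case 1
      then have "?c A = 1" "weight {o1} = 2"
        using loop[OF f(1)] lifts e g one by auto
      then show ?thesis
        using two[of o2 o3] 1 lifts b wS wT c1 by (smt (verit))
    next
      case 2
      then have "?c B = 1" "weight {o1} = 2"
        using loop[OF f(2)] lifts e g one by auto
      then show ?thesis
        using two[of o2 o3] 2 lifts b wS wT c1 by (smt (verit))
    next
      case 3
      then have "?c C = 1" "weight {o2, o3} = 2"
        using loop[OF f(3)] lifts e g one by auto
      moreover have "weight {o1, o2} \<le> weight ?S"
        using in_vset fin 3 by (intro weight_mono) auto
      ultimately show ?thesis
        using two[of o1 o2] 3 lifts b wT c1 by (smt (verit))
    qed
  next
    case distinct: True
    have w: "weight {o1} = (if o1 \<in> V0 then 1 else 2)"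
      "weight {o2, o3} = (if o2 \<in> V0 then 1 else 2) + (if o3 \<in> V0 then 1 else 2)"
      using distinct by (auto simp: weight_pair) (simp_all add: weight_insert)
    show ?thesis
    proof (rule ccontr)
      assume contr: "\<not> ?thesis"
      have nonone: "?c A \<noteq> 1" "?c B \<noteq> 1" "?c C \<noteq> 1"
        using contr distinct b wS wT c1 w by (smt (verit))+
      note cA = corank_3_cases[OF nonone(1)] and cB = corank_3_cases[OF nonone(2)]
        and cC = corank_3_cases[OF nonone(3)]
      define F where "F = card ({o1, o2, o3} \<inter> V0)"
      have one_fixed: "\<not> (o1 \<in> V0 \<and> o2 \<in> V0)" "\<not> (o1 \<in> V0 \<and> o3 \<in> V0)" "\<not> (o2 \<in> V0 \<and> o3 \<in> V0)"
        using b nonone distinct by blast+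
      have nfree: "v \<notin> V0" if "v \<in> vset X" "nfix X = 0" "finite X" for v X
        using that by (auto simp: nfix_def)
      \<comment> \<open>If the inequality fails, the overlaps have no room beyond the prescribed
        neighbours.\<close>
      have exact: "weight ?S = weight {o1} \<and> weight ?T = weight {o2, o3}"
      proof (cases "o1 \<in> V0 \<or> o2 \<in> V0 \<or> o3 \<in> V0")
        case True
        then show ?thesis
          using contr b wS wT c1 w one_fixed by (smt (verit))
      next
        case False
        then have "weight ?S + weight ?T \<le> 7"
          using contr b c1 by linarith
        \<comment> \<open>At most one of the three sets meets \<open>V0\<close>, so both overlaps
          are free and have even weight. This improves the bound 7 to 6, which the neighbours
          already use up.\<close>
        have "nfix A + nfix B + nfix C \<le> 1"
          using contr wS wT c1 w False cA(2) cB(2) cC(2) by (smt (verit) of_nat_add of_nat_le_iff of_nat_1)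
        then have "nfix A = 0 \<or> nfix B = 0" "nfix A = 0 \<and> nfix B = 0 \<or> nfix C = 0"
          by linarith+
        then have "?S \<inter> V0 = {}" "?T \<inter> V0 = {}"
          using nfree fin by blast+
        then have "weight ?S = 2 * int (card ?S)" "weight ?T = 2 * int (card ?T)"
          by (simp_all only: weight_free)
        then show ?thesis
          using \<open>weight ?S + weight ?T \<le> 7\<close> wS wT w False by presburger
      qed
      have S: "?S = {o1}" and T: "?T = {o2, o3}"
        using weight_eq_imp[of ?S "{o1}"] weight_eq_imp[of ?T "{o2, o3}"] exact in_vset fin by auto
      obtain s where s: "potential s A" "o1 \<notin> V0 \<Longrightarrow> s o1 = g1" "o2 \<notin> V0 \<Longrightarrow> s o2 = g2"
        using bal_normalise[OF cA(1) f(1) e(1) g(1)] by metis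
      obtain t where t: "potential t B" "o1 \<notin> V0 \<Longrightarrow> t o1 = g1" "o3 \<notin> V0 \<Longrightarrow> t o3 = g3"
        using bal_normalise[OF cB(1) f(2) e(2) g(2)] by metis
      obtain r where r: "potential r C" "o2 \<notin> V0 \<Longrightarrow> r o2 = g2" "o3 \<notin> V0 \<Longrightarrow> r o3 = g3"
        using bal_normalise[OF cC(1) f(3) e(3) g(3)] by metis
      have agree: "s v = t v" if "v \<in> ?S - V0" for v
      proof -
        have v: "v = o1" "o1 \<notin> V0"
          using that unfolding S by auto
        show ?thesis
          unfolding v(1) using s(2)[OF v(2)] t(2)[OF v(2)] by (rule trans[OF _ sym])
      qed
      have st: "potential (\<lambda>v. if v \<in> vset A then s v else t v) (A \<union> B)"
        by (intro potential_glue[OF s(1) t(1)] ballI agree)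
      have o23: "o3 \<notin> vset A" "o2 \<in> vset A"
        using S distinct in_vset by auto
      have agree': "(if v \<in> vset A then s v else t v) = r v" if "v \<in> vset (A \<union> B) \<inter> vset C - V0" for v
      proof -
        have "v = o2 \<or> v = o3" and v: "v \<notin> V0"
          using that T by auto
        then show ?thesis
        proof (elim disjE)
          assume "v = o2"
          then show ?thesis
            using o23(2) trans[OF s(3) r(2)[symmetric]] v by simp
        next
          assume "v = o3"
          then show ?thesis
            using o23(1) trans[OF t(3) r(3)[symmetric]] v by simp
        qed
      qed
      then have "bal ?Z"
        by (intro balI[OF potential_glue[OF st r(1)]] ballI)
      moreover have "int (nfix ?Z) \<le> 3 - (?c A + ?c B + ?c C - weight ?S - weight ?T)"
      proof -
        have "int (card ((vset A \<union> vset B) \<inter> V0)) + int (card (?S \<inter> V0)) = int (nfix A) + int (nfix B)"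
          using card_Un_Int_restrict[of "vset A" "vset B" V0] fin by (simp add: nfix_def)
        moreover have "int (nfix ?Z) + int (card (?T \<inter> V0)) = int (card ((vset A \<union> vset B) \<inter> V0)) + int (nfix C)"
          using card_Un_Int_restrict[of "vset A \<union> vset B" "vset C" V0] fin by (simp add: nfix_def)
        \<comment> \<open>Free vertices weigh 2 and fixed ones 1, so the number of fixed vertices in
          a set is twice its size minus its weight.\<close>
        moreover have "int (card (?S \<inter> V0)) = 2 - weight ?S" "int (card (?T \<inter> V0)) = 4 - weight ?T"
          unfolding S T using distinct w by auto
        ultimately show ?thesis
          using cA(2) cB(2) cC(2) by linarith
      qed
      ultimately show False
        using contr by (auto simp: corank_def)
    qed
  qed
  moreover have "weight (vset A \<union> vset B) + weight ?S = weight (vset A) + weight (vset B)"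
    "weight (vset ?Z) + weight ?T = weight (vset A \<union> vset B) + weight (vset C)"
    using fin by (auto intro!: weight_Un_Int)
  moreover have "card (?Z \<inter> I) = card (A \<inter> I) + card (B \<inter> I) + card (C \<inter> I)"
  proof -
    have "?Z \<inter> I = ((A \<inter> I) \<union> (B \<inter> I)) \<union> (C \<inter> I)"
      by auto
    moreover have "card ((A \<inter> I) \<union> (B \<inter> I)) = card (A \<inter> I) + card (B \<inter> I)"
      using fin disj by (intro card_Un_disjoint) auto
    moreover have "card ((A \<inter> I \<union> B \<inter> I) \<union> (C \<inter> I)) = card (A \<inter> I \<union> B \<inter> I) + card (C \<inter> I)"
      using fin disj by (intro card_Un_disjoint) auto
    ultimately show ?thesis by simp
  qed
  ultimately show ?thesis
    using A B C fin unfolding saturated_def by simp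
qed

end

section \<open>Henneberg reductions\<close>

definition other_end :: "'v gedge \<Rightarrow> 'v \<Rightarrow> 'v" where
  "other_end e v = (if src e = v then tgt e else src e)"

lemma ends_other: "v \<in> ends e \<Longrightarrow> ends e = {v, other_end e v}"
  by (auto simp: ends_def other_end_def)

text \<open>The shortcut for the path from one neighbour through \<open>v\<close> to the other; in a
  group of order two its gain is the identity iff the two gains agree.\<close>

definition bypass :: "nat \<Rightarrow> 'v \<Rightarrow> 'v gedge \<Rightarrow> 'v gedge \<Rightarrow> 'v gedge" where
  "bypass n v e f = GEdge (other_end e v) (other_end f v) (idgain e = idgain f) n"

lemma ends_bypass: "ends (bypass n v e f) = {other_end e v, other_end f v}"
  by (simp add: bypass_def ends_def)

context mirror
begin

definition degree :: "'v gedge set \<Rightarrow> 'v \<Rightarrow> nat" where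
  "degree F v = (\<Sum>e\<in>F. of_bool (src e = v) + of_bool (tgt e = v))"

definition edges_at :: "'v gedge set \<Rightarrow> 'v \<Rightarrow> 'v gedge set" where
  "edges_at F v = {e \<in> F. v \<in> ends e}"

lemma degree_eq:
  assumes "finite F"
  shows "degree F v = card (edges_at F v) + card {e \<in> F. ends e = {v}}"
proof -
  have "degree F v = (\<Sum>e\<in>F. of_bool (v \<in> ends e) + of_bool (ends e = {v}))"
    unfolding degree_def by (intro sum.cong) (auto simp: ends_def)
  also have "\<dots> = card (edges_at F v) + card {e \<in> F. ends e = {v}}"
    using assms by (simp add: sum.distrib edges_at_def of_bool_def sum.If_cases Int_def)
  finally show ?thesis .
qed

text \<open>Handshake: the degrees sum to twice the number of edges, which is less than twice the
  total weight, so some vertex has degree below twice its own weight.\<close>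

lemma exists_low_degree:
  assumes "sparse k F" "F \<noteq> {}"
  obtains v where "v \<in> vset F" "int (degree F v) < 2 * (if v \<in> V0 then 1 else 2)"
proof -
  have fin: "finite F"
    using assms sparse_finite by blast
  have "(\<Sum>v\<in>vset F. degree F v) = (\<Sum>e\<in>F. \<Sum>v\<in>vset F. of_bool (src e = v) + of_bool (tgt e = v))"
    unfolding degree_def by (rule sum.swap)
  also have "\<dots> = (\<Sum>e\<in>F. 2)"
  proof (rule sum.cong)
    fix e assume "e \<in> F"
    then have "src e \<in> vset F" "tgt e \<in> vset F"
      by (auto simp: vset_def ends_def)
    then show "(\<Sum>v\<in>vset F. of_bool (src e = v) + of_bool (tgt e = v)) = (2::nat)"
      using fin by (simp add: sum.distrib of_bool_def)
  qed simp
  finally have "(\<Sum>v\<in>vset F. int (degree F v)) = 2 * int (card F)"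
    by (simp flip: of_nat_sum)
  also have "\<dots> < 2 * weight (vset F)"
    using sparseD[OF assms(1) subset_refl assms(2)] corank_ge_1[of k F] by linarith
  also have "\<dots> = (\<Sum>v\<in>vset F. 2 * (if v \<in> V0 then 1 else 2))"
    unfolding weight_def by (rule sum_distrib_left)
  finally have "\<not> (\<forall>v\<in>vset F. 2 * (if v \<in> V0 then 1 else 2) \<le> int (degree F v))"
    using sum_mono[of "vset F" "\<lambda>v. 2 * (if v \<in> V0 then 1 else 2)" "\<lambda>v. int (degree F v)"] by force
  then show thesis
    using that by force
qed

lemma vset_removed:
  "v \<notin> vset (F - edges_at F v)"
  by (auto simp: vset_def edges_at_def)

lemma fresh_tag:
  assumes "finite (F :: 'v gedge set)"
  obtains n where "\<And>e. e \<in> F \<Longrightarrow> tag e \<noteq> n"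
proof -
  obtain n where "n \<notin> tag ` F"
    using assms ex_new_if_finite[of "tag ` F"] by auto
  then show thesis
    by (intro that[of n]) auto
qed

text \<open>A violating set must contain \<open>e\<close>, and it exceeds its bound by at least one;
  not counting \<open>e\<close> still leaves the bound attained.\<close>

lemma saturated_of_not_sparse:
  assumes I: "sparse k I" and e: "e \<notin> I" and ns: "\<not> sparse k (insert e I)"
  obtains A where "saturated k I A" "e \<in> A" "A \<subseteq> insert e I"
proof -
  obtain A where A: "A \<subseteq> insert e I" "A \<noteq> {}" "int (card A) > weight (vset A) - corank k A"
    using ns sparse_finite[OF I] by (auto simp: sparse_def not_le)
  have "e \<in> A"
  proof (rule ccontr)
    assume "e \<notin> A"
    then have "A \<subseteq> I"
      using A by auto
    then show False
      using sparseD[OF I _ A(2)] A(3) by auto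
  qed
  have "finite A"
    using A sparse_finite[OF I] finite_subset by blast
  moreover have "A \<inter> I = A - {e}"
    using A e by auto
  ultimately have "saturated k I A"
    using A \<open>e \<in> A\<close> by (simp add: saturated_def)
  then show thesis
    using that A \<open>e \<in> A\<close> by blast
qed

text \<open>Otherwise the pair is balanced, with weight 4 and corank 3 if \<open>u\<close> is free
  and weight 3 and corank 2 if \<open>u\<close> is fixed; either way only one edge is
  allowed.\<close>

lemma sparse_parallel:
  assumes F: "sparse 3 F" and e: "e \<in> F" "f \<in> F" "e \<noteq> f" "ends e = {v, u}" "ends f = {v, u}" "v \<noteq> u" "v \<notin> V0"
  shows "u \<notin> V0 \<and> idgain e \<noteq> idgain f"
proof (rule ccontr)
  assume "\<not> ?thesis"
  then have "potential (\<lambda>x. if x = v then idgain e else True) {e, f}"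
    using e by (auto simp: potential_def ends_def doubleton_eq_iff)
  then have "bal {e, f}"
    by (auto simp: bal_def)
  moreover have vs: "vset {e, f} = {v, u}"
    using e by auto
  ultimately have "corank 3 {e, f} = (if u \<in> V0 then 2 else 3)"
    using e by (simp add: corank_def nfix_def)
  moreover have "weight {v, u} = (if u \<in> V0 then 3 else 4)"
    using e weight_pair[of v u] by auto
  moreover have "int (card {e, f}) \<le> weight (vset {e, f}) - corank 3 {e, f}"
    using sparseD[OF F, of "{e, f}"] e by blast
  ultimately show False
    unfolding vs using e by (simp split: if_splits)
qed

text \<open>If every bypass is blocked, the union of the blocking sets is saturated. Adding
  \<open>v\<close> raises the weight by 2 and the number of edges by 3, and the corank does not
  drop, because a potential of the bypasses extends to \<open>v\<close>. This contradicts sparsity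
  of \<open>F\<close>.\<close>

lemma degree_three_reduction:
  assumes k: "k = 2 \<or> k = 3" and F: "sparse k F" and v: "v \<notin> V0"
    and N: "edges_at F v = {e1, e2, e3}" "card {e1, e2, e3} = 3"
    and nl: "\<And>e. e \<in> {e1, e2, e3} \<Longrightarrow> ends e \<noteq> {v}"
    and n: "\<And>e. e \<in> F \<Longrightarrow> tag e \<noteq> n"
    and ns: "\<And>e f. {e, f} \<subseteq> {e1, e2, e3} \<Longrightarrow> e \<noteq> f \<Longrightarrow>
      \<not> sparse k (insert (bypass n v e f) (F - edges_at F v))"
  shows False
proof -
  define I where "I = F - edges_at F v"
  define o1 o2 o3 where o: "o1 = other_end e1 v" "o2 = other_end e2 v" "o3 = other_end e3 v"
  define g1 g2 g3 where g: "g1 = idgain e1" "g2 = idgain e2" "g3 = idgain e3"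
  define f12 f13 f23 where f: "f12 = bypass n v e1 e2" "f13 = bypass n v e1 e3" "f23 = bypass n v e2 e3"
  have I: "sparse k I"
    using F sparse_subset by (auto simp: I_def)
  have fin: "finite I" "finite F"
    using I F sparse_finite by auto
  have eF: "{e1, e2, e3} \<subseteq> F" and ev: "v \<in> ends e1" "v \<in> ends e2" "v \<in> ends e3"
    using N by (auto simp: edges_at_def)
  have ne: "e1 \<noteq> e2" "e1 \<noteq> e3" "e2 \<noteq> e3"
    using N(2) by (auto simp: card_insert_if split: if_splits)
  have ends_e: "ends e1 = {v, o1}" "ends e2 = {v, o2}" "ends e3 = {v, o3}"
    using ev[THEN ends_other] by (simp_all only: o)
  then have vo: "v \<noteq> o1" "v \<noteq> o2" "v \<noteq> o3"
    using nl by auto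
  have e: "ends f12 = {o1, o2}" "ends f13 = {o1, o3}" "ends f23 = {o2, o3}"
    by (simp_all add: f ends_bypass o)
  have ig: "idgain f12 = (g1 = g2)" "idgain f13 = (g1 = g3)" "idgain f23 = (g2 = g3)"
    by (simp_all add: f bypass_def g)
  have fI: "f12 \<notin> I" "f13 \<notin> I" "f23 \<notin> I"
    using n[of f12] n[of f13] n[of f23] by (auto simp: I_def) (auto simp: f bypass_def)
  have nsI: "\<not> sparse k (insert f12 I)" "\<not> sparse k (insert f13 I)" "\<not> sparse k (insert f23 I)"
    using ns ne by (auto simp: f I_def)
  obtain A where A: "saturated k I A" "f12 \<in> A" "A \<subseteq> insert f12 I"
    using saturated_of_not_sparse[OF I fI(1) nsI(1)] by blast
  obtain B where B: "saturated k I B" "f13 \<in> B" "B \<subseteq> insert f13 I"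
    using saturated_of_not_sparse[OF I fI(2) nsI(2)] by blast
  obtain C where C: "saturated k I C" "f23 \<in> C" "C \<subseteq> insert f23 I"
    using saturated_of_not_sparse[OF I fI(3) nsI(3)] by blast
  let ?Z = "A \<union> B \<union> C"
  have Z: "saturated k I ?Z"
  proof (cases "k = 2")
    case True
    \<comment> \<open>For \<open>k = 2\<close> a shared vertex suffices, and any two blocking sets
      share a neighbour of \<open>v\<close>.\<close>
    have "o1 \<in> vset A" "o2 \<in> vset A" "o1 \<in> vset B" "o2 \<in> vset C"
      using e A(2) B(2) C(2) by (auto simp: vset_def)
    then have "vset A \<inter> vset B \<noteq> {}" "vset (A \<union> B) \<inter> vset C \<noteq> {}"
      by auto
    then show ?thesis
      using saturated_Un_2[of I] A B C I True by blast
  next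
    case False
    then have k3: "k = 3"
      using k by simp
    note I3 = I[unfolded k3] and A3 = A(1)[unfolded k3] and B3 = B(1)[unfolded k3] and C3 = C(1)[unfolded k3]
    have lifts: "o1 = o2 \<Longrightarrow> o1 \<notin> V0 \<and> g1 \<noteq> g2" "o1 = o3 \<Longrightarrow> o1 \<notin> V0 \<and> g1 \<noteq> g3"
      "o2 = o3 \<Longrightarrow> o2 \<notin> V0 \<and> g2 \<noteq> g3"
      using sparse_parallel[OF F[unfolded k3]] eF ne ends_e vo v unfolding g by auto
    \<comment> \<open>Reading the bypasses backwards lets any pair of sets that shares an edge take
      the role of the first set.\<close>
    have sym: "ends f12 = {o2, o1}" "ends f13 = {o3, o1}" "ends f23 = {o3, o2}"
      "idgain f12 = (g2 = g1)" "idgain f13 = (g3 = g1)" "idgain f23 = (g3 = g2)"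
      using e ig by auto
    have "saturated 3 I ?Z"
    proof (cases "A \<inter> B \<inter> I = {}")
      case False
      then have "saturated 3 I (A \<union> B)"
        using saturated_Un_3[OF I3 A3 B3] by blast
      then show ?thesis
        using saturated_Un_two_of_three[OF I3 _ C3 _ _ C(2) e ig lifts] A(2) B(2) by blast
    next
      case AB: True
      show ?thesis
      proof (cases "A \<inter> C \<inter> I = {}")
        case False
        then have "saturated 3 I (A \<union> C)"
          using saturated_Un_3[OF I3 A3 C3] by blast
        then have "saturated 3 I ((A \<union> C) \<union> B)"
          using saturated_Un_two_of_three[OF I3 _ B3 _ _ B(2) sym(1) e(3,2) sym(4) ig(3,2)] A(2) C(2) lifts
          by blast
        then show ?thesis
          by (simp add: Un_ac)
      next
        case AC: True
        show ?thesis
        proof (cases "B \<inter> C \<inter> I = {}")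
          case False
          then have "saturated 3 I (B \<union> C)"
            using saturated_Un_3[OF I3 B3 C3] by blast
          then have "saturated 3 I ((B \<union> C) \<union> A)"
            using saturated_Un_two_of_three[OF I3 _ A3 _ _ A(2) sym(2,3) e(1) sym(5,6) ig(1)] B(2) C(2) lifts
            by blast
          then show ?thesis
            by (simp add: Un_ac)
        next
          case True
          then have "(A \<union> B) \<inter> C \<inter> I = {}"
            using AC by blast
          then show ?thesis
            using saturated_Un_three[OF A3 B3 C3 AB _ A(2) B(2) C(2) e ig lifts] by blast
        qed
      qed
    qed
    then show ?thesis
      by (simp add: k3)
  qed
  then have finZ: "finite ?Z"
    by (simp add: saturated_def)
  \<comment> \<open>The bypasses are traded for the three edges at \<open>v\<close>: three more
    counted edges for two more units of weight.\<close>
  define Y where "Y = (?Z \<inter> I) \<union> {e1, e2, e3}"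
  have YF: "Y \<subseteq> F" "Y \<noteq> {}"
    using eF by (auto simp: Y_def I_def)
  have "(?Z \<inter> I) \<inter> {e1, e2, e3} = {}"
    using N by (auto simp: I_def)
  then have cardY: "card Y = card (?Z \<inter> I) + 3"
    unfolding Y_def using N(2) fin by (subst card_Un_disjoint) auto
  have o_in: "{o1, o2, o3} \<subseteq> vset ?Z"
    using A(2) B(2) C(2) e by (auto simp: vset_def)
  have vsY: "vset Y \<subseteq> insert v (vset ?Z)"
    using o_in vset_mono[of "?Z \<inter> I" ?Z] ends_e unfolding Y_def by auto
  have "vset ?Z \<subseteq> vset (insert f12 (insert f13 (insert f23 I)))"
    using A(3) B(3) C(3) by (intro vset_mono) auto
  also have "\<dots> = {o1, o2, o3} \<union> vset I"
    using e by auto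
  finally have vZ: "v \<notin> vset ?Z"
    using vset_removed[of v F] vo by (auto simp: I_def)
  have "weight (vset Y) \<le> weight (insert v (vset ?Z))"
    using vsY finZ by (intro weight_mono) auto
  also have "\<dots> = weight (vset ?Z) + 2"
    using vZ v finZ by (simp add: weight_insert del: vset_Un)
  finally have wY: "weight (vset Y) \<le> weight (vset ?Z) + 2" .
  have "nfix Y \<le> nfix ?Z"
    unfolding nfix_def using vsY finZ v by (intro card_mono) auto
  moreover have "bal Y" if bal_Z: "bal ?Z"
  proof -
    obtain s where s: "potential s ?Z"
      using bal_Z unfolding bal_def by blast
    \<comment> \<open>The value at \<open>v\<close> forced by the first free neighbour; the bypasses
      make all free neighbours force the same value, and fixed ones impose nothing.\<close>
    define b where "b = (if o1 \<notin> V0 then s o1 = g1 else if o2 \<notin> V0 then s o2 = g2 else s o3 = g3)"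
    have "o1 \<notin> V0 \<Longrightarrow> o2 \<notin> V0 \<Longrightarrow> (s o1 = s o2) = (g1 = g2)" "o1 \<notin> V0 \<Longrightarrow> o3 \<notin> V0 \<Longrightarrow> (s o1 = s o3) = (g1 = g3)"
      "o2 \<notin> V0 \<Longrightarrow> o3 \<notin> V0 \<Longrightarrow> (s o2 = s o3) = (g2 = g3)"
      using potential_ends[OF s] A(2) B(2) C(2) e ig by (metis UnCI)+
    then have b: "o1 \<notin> V0 \<Longrightarrow> (b = s o1) = g1" "o2 \<notin> V0 \<Longrightarrow> (b = s o2) = g2" "o3 \<notin> V0 \<Longrightarrow> (b = s o3) = g3"
      by (auto simp: b_def)
    have "potential (s(v := b)) Y"
      unfolding potential_def
    proof (intro ballI impI)
      fix x assume x: "x \<in> Y" "src x \<notin> V0 \<and> tgt x \<notin> V0"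
      show "((s(v := b)) (src x) = (s(v := b)) (tgt x)) = idgain x"
      proof (cases "x \<in> {e1, e2, e3}")
        case True
        then show ?thesis
          using x b ends_e vo unfolding g by (auto simp: ends_def doubleton_eq_iff)
      next
        case False
        then have "x \<in> ?Z"
          using x by (auto simp: Y_def)
        then have "src x \<noteq> v" "tgt x \<noteq> v"
          using vZ by (auto simp: vset_def ends_def)
        then show ?thesis
          using s x \<open>x \<in> ?Z\<close> by (auto simp: potential_def)
      qed
    qed
    then show ?thesis
      by (auto simp: bal_def)
  qed
  ultimately have "corank k ?Z \<le> corank k Y"
    by (auto simp: corank_def)
  moreover have "int (card Y) \<le> weight (vset Y) - corank k Y"
    by (rule sparseD[OF F YF])
  ultimately show False
    using wY cardY Z by (simp add: saturated_def)
qed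

text \<open>Induction on the number of edges at a vertex of low degree. A loop counts twice in the
  degree, so a fixed vertex carries none, a free vertex carries at most one, and a free vertex with
  three edges carries none.\<close>

lemma sparse_induct [consumes 2, case_names empty fixed_leaf two one three]:
  assumes k: "k = 2 \<or> k = 3" and "sparse k F"
    and empty: "P {}"
    and fixed_leaf: "\<And>F e v. sparse k (insert e F) \<Longrightarrow> v \<in> V0 \<Longrightarrow> v \<in> ends e \<Longrightarrow> ends e \<noteq> {v} \<Longrightarrow>
      v \<notin> vset F \<Longrightarrow> P F \<Longrightarrow> P (insert e F)"
    and two: "\<And>F e1 e2 v. sparse k (insert e1 (insert e2 F)) \<Longrightarrow> v \<notin> V0 \<Longrightarrow> v \<in> ends e1 \<Longrightarrow> v \<in> ends e2 \<Longrightarrow>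
      e1 \<noteq> e2 \<Longrightarrow> ends e2 \<noteq> {v} \<Longrightarrow> v \<notin> vset F \<Longrightarrow> P F \<Longrightarrow> P (insert e1 (insert e2 F))"
    and one: "\<And>F e v. sparse k (insert e F) \<Longrightarrow> v \<notin> V0 \<Longrightarrow> v \<in> ends e \<Longrightarrow>
      v \<notin> vset F \<Longrightarrow> P F \<Longrightarrow> P (insert e F)"
    and three: "\<And>F e1 e2 e3 v n. sparse k (insert e1 (insert e2 (insert e3 F))) \<Longrightarrow> v \<notin> V0 \<Longrightarrow>
      v \<in> ends e1 \<Longrightarrow> v \<in> ends e2 \<Longrightarrow> v \<in> ends e3 \<Longrightarrow> e1 \<noteq> e2 \<Longrightarrow> e1 \<noteq> e3 \<Longrightarrow> e2 \<noteq> e3 \<Longrightarrow>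
      ends e1 \<noteq> {v} \<Longrightarrow> ends e2 \<noteq> {v} \<Longrightarrow> ends e3 \<noteq> {v} \<Longrightarrow> v \<notin> vset F \<Longrightarrow>
      bypass n v e1 e2 \<notin> F \<Longrightarrow> P (insert (bypass n v e1 e2) F) \<Longrightarrow>
      P (insert e1 (insert e2 (insert e3 F)))"
  shows "P F"
  using assms(2)
proof (induction "card F" arbitrary: F rule: less_induct)
  case less
  show ?case
  proof (cases "F = {}")
    case True
    then show ?thesis using empty by simp
  next
    case False
    have fin: "finite F"
      using less.prems sparse_finite by blast
    obtain v where v: "v \<in> vset F" "int (degree F v) < 2 * (if v \<in> V0 then 1 else 2)"
      using exists_low_degree[OF less.prems False] by blast
    define N where "N = edges_at F v"
    define I where "I = F - N"
    have finN: "finite N" and NF: "N \<subseteq> F" and vI: "v \<notin> vset I" and vN: "\<And>e. e \<in> N \<Longrightarrow> v \<in> ends e"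
      using fin vset_removed[of v F] by (auto simp: N_def I_def edges_at_def)
    have N0: "N \<noteq> {}"
      using v(1) by (auto simp: N_def edges_at_def vset_def)
    have cards: "card N + card {e \<in> F. ends e = {v}} = degree F v"
      using degree_eq[OF fin] by (simp add: N_def)
    have loopN: "card {e \<in> F. ends e = {v}} \<ge> card L" if "L \<subseteq> {e \<in> F. ends e = {v}}" for L
      using that fin by (intro card_mono) auto
    have sI: "sparse k I"
      using less.prems sparse_subset by (auto simp: I_def)
    have "I \<subset> F"
      using N0 NF by (auto simp: I_def)
    then have PI: "P I"
      using less.hyps[OF _ sI] fin psubset_card_mono by blast
    show ?thesis
    proof (cases "v \<in> V0")
      case True
      then have "card N = 1" "card {e \<in> F. ends e = {v}} = 0"
        using v cards N0 finN card_gt_0_iff[of N] by (auto simp del: card_eq_0_iff)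
      then obtain e where e: "N = {e}" and nl: "ends e \<noteq> {v}"
        using fin NF by (auto simp: card_1_singleton_iff)
      then have "F = insert e I"
        using NF by (auto simp: I_def)
      then show ?thesis
        using fixed_leaf[of e I v] less.prems True nl vI PI vN e by auto
    next
      case free: False
      then have deg: "card N + card {e \<in> F. ends e = {v}} \<le> 3"
        using v cards by simp
      have "1 \<le> card N"
        using N0 finN by (simp add: Suc_leI card_gt_0_iff)
      then consider "card N = 1" | "card N = 2" | "card N = 3"
        using deg by linarith
      then show ?thesis
      proof cases
        case 1
        then obtain e where e: "N = {e}"
          by (auto simp: card_1_singleton_iff)
        then have "F = insert e I"
          using NF by (auto simp: I_def)
        then show ?thesis
          using one[of e I v] less.prems free vI PI vN e by auto
      next
        case 2
        then obtain a b where ab: "N = {a, b}" "a \<noteq> b"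
          by (auto simp: card_2_iff)
        have "\<not> (ends a = {v} \<and> ends b = {v})"
          using loopN[of "{a, b}"] ab NF deg 2 by auto
        then obtain e1 e2 where e: "N = {e1, e2}" "e1 \<noteq> e2" "ends e2 \<noteq> {v}"
          using ab by (metis insert_commute)
        then have "F = insert e1 (insert e2 I)"
          using NF by (auto simp: I_def)
        then show ?thesis
          using two[of e1 e2 I v] less.prems free vI PI vN e by auto
      next
        case 3
        then have noloop: "\<And>e. e \<in> F \<Longrightarrow> ends e \<noteq> {v}"
          using deg fin by auto
        obtain a b c where abc: "N = {a, b, c}"
          using 3 by (metis card_3_iff)
        obtain n where n: "\<And>e. e \<in> F \<Longrightarrow> tag e \<noteq> n"
          using fresh_tag[OF fin] by metis
        have "\<exists>e f. {e, f} \<subseteq> N \<and> e \<noteq> f \<and> sparse k (insert (bypass n v e f) I)"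
        proof (rule ccontr)
          assume "\<not> ?thesis"
          then show False
            using degree_three_reduction[OF k less.prems free, of a b c n] abc 3 n noloop NF
            unfolding N_def I_def by (metis in_mono)
        qed
        then obtain e1 e2 where e12: "{e1, e2} \<subseteq> N" "e1 \<noteq> e2" and sp: "sparse k (insert (bypass n v e1 e2) I)"
          by blast
        obtain e3 where e3: "N = {e1, e2, e3}" "e3 \<noteq> e1" "e3 \<noteq> e2"
        proof -
          have "card (N - {e1, e2}) = 1"
            using e12 3 finN by (simp add: card_Diff_subset)
          then obtain e3 where "N - {e1, e2} = {e3}"
            by (auto simp: card_1_singleton_iff)
          then show thesis
            using that[of e3] e12 by blast
        qed
        then have F: "F = insert e1 (insert e2 (insert e3 I))"
          using NF by (auto simp: I_def)
        have nI: "bypass n v e1 e2 \<notin> I"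
          using n[of "bypass n v e1 e2"] by (auto simp: I_def) (auto simp: bypass_def)
        have finI: "finite I"
          using fin by (simp add: I_def)
        have "card F = card I + 3"
          using 3 card_Diff_subset[OF finN NF] card_mono[OF fin NF] by (simp add: I_def)
        then have "card (insert (bypass n v e1 e2) I) < card F"
          using nI finI by simp
        then have "P (insert (bypass n v e1 e2) I)"
          using less.hyps sp by blast
        then have "P (insert e1 (insert e2 (insert e3 I)))"
          using three[of e1 e2 e3 I v n] less.prems free vI vN e3 e12 noloop nI F NF by blast
        then show ?thesis
          using F by simp
      qed
    qed
  qed
qed

end

section \<open>Independent families of functionals\<close>

text \<open>Independence of an indexed family tested only on the points of \<open>I\<close>. No
  linear structure is imposed, so the notion serves both for functionals on motions and for
  functions on the edges of the covering.\<close>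

definition indep_on :: "'j set \<Rightarrow> 'i set \<Rightarrow> ('j \<Rightarrow> 'i \<Rightarrow> 'a::field) \<Rightarrow> bool" where
  "indep_on J I A \<longleftrightarrow> (\<forall>\<omega>. (\<forall>i\<in>I. (\<Sum>j\<in>J. \<omega> j * A j i) = 0) \<longrightarrow> (\<forall>j\<in>J. \<omega> j = 0))"

lemma indep_onI:
  assumes "\<And>\<omega> j. (\<And>i. i \<in> I \<Longrightarrow> (\<Sum>j\<in>J. \<omega> j * A j i) = 0) \<Longrightarrow> j \<in> J \<Longrightarrow> \<omega> j = 0"
  shows "indep_on J I A"
  using assms unfolding indep_on_def by blast

lemma indep_onD:
  assumes "indep_on J I A" "\<And>i. i \<in> I \<Longrightarrow> (\<Sum>j\<in>J. \<omega> j * A j i) = 0" "j \<in> J"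
  shows "\<omega> j = 0"
  using assms unfolding indep_on_def by blast

lemma indep_on_cong:
  assumes "\<And>j i. j \<in> J \<Longrightarrow> i \<in> I \<Longrightarrow> A j i = B j i"
  shows "indep_on J I A = indep_on J I B"
  unfolding indep_on_def using assms by (simp cong: sum.cong)

lemma indep_on_empty [simp]: "indep_on {} I A"
  by (simp add: indep_on_def)

lemma indep_on_nonzero:
  assumes "finite J" "indep_on J I A" "j \<in> J"
  shows "\<exists>i\<in>I. A j i \<noteq> 0"
proof (rule ccontr)
  assume "\<not> ?thesis"
  then have "(\<Sum>k\<in>J. of_bool (k = j) * A k i) = 0" if "i \<in> I" for i
    using that assms by (intro sum.neutral) auto
  then have "of_bool (j = j) = (0 :: 'c)"
    using indep_onD[OF assms(2) _ assms(3), of "\<lambda>k. of_bool (k = j)"] by blast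
  then show False by simp
qed

text \<open>
  Gaussian elimination over the polynomials: one pivot makes only finitely many further parameters bad.
\<close>

lemma finite_dependent_parameters:
  fixes f :: "'j \<Rightarrow> 'i \<Rightarrow> 'a::field poly"
  assumes "finite J" "indep_on J I (\<lambda>j i. poly (f j i) t0)"
  shows "finite {t. \<not> indep_on J I (\<lambda>j i. poly (f j i) t)}"
  using assms
proof (induction J arbitrary: f rule: finite_induct)
  case empty
  then show ?case by simp
next
  case (insert p J)
  obtain k where k: "k \<in> I" "poly (f p k) t0 \<noteq> 0"
    using indep_on_nonzero[OF _ insert.prems, of p] insert.hyps by auto
  \<comment> \<open>Fraction-free elimination of column \<open>k\<close>, so that the reduced
    entries are polynomials again.\<close>
  define g where "g j i = f p k * f j i - f j k * f p i" for j i
  have g: "(\<Sum>j\<in>J. \<omega> j * poly (g j i) t)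
      = poly (f p k) t * (\<Sum>j\<in>J. \<omega> j * poly (f j i) t) - (\<Sum>j\<in>J. \<omega> j * poly (f j k) t) * poly (f p i) t"
    for \<omega> t i
    by (simp add: g_def sum_distrib_left sum_distrib_right algebra_simps sum_subtractf)
  have "indep_on J I (\<lambda>j i. poly (g j i) t0)"
  proof (rule indep_onI)
    fix \<omega> j assume \<omega>: "\<And>i. i \<in> I \<Longrightarrow> (\<Sum>j\<in>J. \<omega> j * poly (g j i) t0) = 0" and j: "j \<in> J"
    \<comment> \<open>Undoes the elimination: with these coefficients the rows \<open>f\<close>
      combine to what the rows \<open>g\<close> give with \<open>\<omega>\<close>.\<close>
    define \<omega>' where "\<omega>' j = (if j = p then - (\<Sum>j\<in>J. \<omega> j * poly (f j k) t0) else poly (f p k) t0 * \<omega> j)" for j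
    have "(\<Sum>j\<in>insert p J. \<omega>' j * poly (f j i) t0) = (\<Sum>j\<in>J. \<omega> j * poly (g j i) t0)" for i
    proof -
      have "(\<Sum>j\<in>J. \<omega>' j * poly (f j i) t0) = (\<Sum>j\<in>J. poly (f p k) t0 * (\<omega> j * poly (f j i) t0))"
        using insert.hyps by (intro sum.cong) (auto simp: \<omega>'_def)
      then show ?thesis
        unfolding g using insert.hyps by (simp add: \<omega>'_def sum_distrib_left)
    qed
    then have "\<omega>' j = 0"
      using indep_onD[OF insert.prems, of \<omega>' j] \<omega> j by simp
    then show "\<omega> j = 0"
      using j insert.hyps k by (auto simp: \<omega>'_def split: if_splits)
  qed
  then have "finite ({t. \<not> indep_on J I (\<lambda>j i. poly (g j i) t)} \<union> {t. poly (f p k) t = 0})"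
    using insert.IH k(2) by (auto intro: poly_roots_finite)
  moreover have "indep_on (insert p J) I (\<lambda>j i. poly (f j i) t)"
    if t: "indep_on J I (\<lambda>j i. poly (g j i) t)" "poly (f p k) t \<noteq> 0" for t
  proof (rule indep_onI)
    fix \<omega> j assume \<omega>: "\<And>i. i \<in> I \<Longrightarrow> (\<Sum>j\<in>insert p J. \<omega> j * poly (f j i) t) = 0" and j: "j \<in> insert p J"
    have s: "(\<Sum>j\<in>J. \<omega> j * poly (f j i) t) = - (\<omega> p * poly (f p i) t)" if "i \<in> I" for i
      using \<omega>[OF that] insert.hyps by (simp add: eq_neg_iff_add_eq_0 add.commute)
    have "(\<Sum>j\<in>J. \<omega> j * poly (g j i) t) = 0" if "i \<in> I" for i
      unfolding g s[OF that] s[OF k(1)] by simp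
    then have z: "\<omega> j = 0" if "j \<in> J" for j
      using indep_onD[OF t(1)] that by blast
    then have "\<omega> p * poly (f p k) t = 0"
      using s[OF k(1)] by simp
    then show "\<omega> j = 0"
      using z j t(2) by auto
  qed
  ultimately show ?case
    by (elim finite_subset[rotated]) auto
qed

text \<open>\<open>lc z c z'\<close> stands for z + c z', and \<open>M\<close> is assumed closed
  under it. The induction drops one functional \<open>A p\<close> at a time and passes to its kernel
  in \<open>M\<close>.\<close>

lemma indep_on_dual:
  fixes A :: "'j \<Rightarrow> 'm \<Rightarrow> 'a::field"
  assumes "finite J" "indep_on J M A" "j \<in> J"
    and "\<And>z z' c. z \<in> M \<Longrightarrow> z' \<in> M \<Longrightarrow> lc z c z' \<in> M"
    and "\<And>z z' c k. k \<in> J \<Longrightarrow> z \<in> M \<Longrightarrow> z' \<in> M \<Longrightarrow> A k (lc z c z') = A k z + c * A k z'"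
  obtains z where "z \<in> M" "A j z = 1" "\<And>k. k \<in> J \<Longrightarrow> k \<noteq> j \<Longrightarrow> A k z = 0"
proof -
  have "\<exists>z\<in>M. A j z \<noteq> 0 \<and> (\<forall>k\<in>J. k \<noteq> j \<longrightarrow> A k z = 0)"
    using assms
  proof (induction "card J" arbitrary: J M rule: less_induct)
    case (less J M)
    show ?case
    proof (cases "J = {j}")
      case True
      then show ?thesis
        using indep_on_nonzero[OF less.prems(1-3)] by blast
    next
      case False
      then obtain p where p: "p \<in> J" "p \<noteq> j"
        using less.prems by blast
      obtain z1 where z1: "z1 \<in> M" "A p z1 \<noteq> 0"
        using indep_on_nonzero[OF less.prems(1,2) p(1)] by blast
      define M' where "M' = {z \<in> M. A p z = 0}"
      have "indep_on (J - {p}) M' A"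
      proof (rule indep_onI)
        fix \<omega> k assume \<omega>: "\<And>z. z \<in> M' \<Longrightarrow> (\<Sum>k\<in>J - {p}. \<omega> k * A k z) = 0" and k: "k \<in> J - {p}"
        \<comment> \<open>The coefficient at \<open>p\<close> makes the combination vanish at
          \<open>z1\<close>; subtracting a multiple of \<open>z1\<close> then reduces every test
          vector to the kernel of \<open>A p\<close>.\<close>
        define \<omega>' where "\<omega>' k = (if k = p then - (\<Sum>k\<in>J - {p}. \<omega> k * A k z1) / A p z1 else \<omega> k)" for k
        have "(\<Sum>k\<in>J. \<omega>' k * A k z) = 0" if "z \<in> M" for z
        proof -
          let ?c = "- A p z / A p z1"
          have "lc z ?c z1 \<in> M'"
            using less.prems(4)[OF that z1(1)] less.prems(5)[OF p(1) that z1(1)] z1(2)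
            by (simp add: M'_def)
          then have "0 = (\<Sum>k\<in>J - {p}. \<omega> k * A k (lc z ?c z1))"
            using \<omega> by simp
          also have "\<dots> = (\<Sum>k\<in>J - {p}. \<omega> k * A k z) + ?c * (\<Sum>k\<in>J - {p}. \<omega> k * A k z1)"
            using less.prems(5)[OF _ that z1(1)]
            by (simp add: sum_distrib_left algebra_simps sum_subtractf sum_negf)
          also have "(\<Sum>k\<in>J - {p}. \<omega> k * A k z) = (\<Sum>k\<in>J - {p}. \<omega>' k * A k z)"
            by (intro sum.cong) (auto simp: \<omega>'_def)
          also have "?c * (\<Sum>k\<in>J - {p}. \<omega> k * A k z1) = \<omega>' p * A p z"
            by (simp add: \<omega>'_def)
          finally show ?thesis
            using sum.remove[OF less.prems(1) p(1), of "\<lambda>k. \<omega>' k * A k z"] by (simp add: add.commute)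
        qed
        then have "\<omega>' k = 0"
          using indep_onD[OF less.prems(2)] k by blast
        then show "\<omega> k = 0"
          using k by (simp add: \<omega>'_def)
      qed
      then have "\<exists>z\<in>M'. A j z \<noteq> 0 \<and> (\<forall>k\<in>J - {p}. k \<noteq> j \<longrightarrow> A k z = 0)"
      proof (intro less.hyps)
        show "card (J - {p}) < card J" "finite (J - {p})" "j \<in> J - {p}"
          using p less.prems card_Diff1_less[of J p] by auto
      next
        fix z z' c assume "z \<in> M'" "z' \<in> M'"
        then show "lc z c z' \<in> M'"
          using less.prems(4) less.prems(5)[OF p(1)] by (auto simp: M'_def)
      next
        fix z z' c k assume "k \<in> J - {p}" "z \<in> M'" "z' \<in> M'"
        then show "A k (lc z c z') = A k z + c * A k z'"
          using less.prems(5) by (auto simp: M'_def)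
      qed
      then show ?thesis
        by (auto simp: M'_def)
    qed
  qed
  then obtain z where z: "z \<in> M" "A j z \<noteq> 0" "\<And>k. k \<in> J \<Longrightarrow> k \<noteq> j \<Longrightarrow> A k z = 0"
    by blast
  \<comment> \<open>This is z divided by \<open>A j z\<close>, expressed with the only operation
    available.\<close>
  let ?z = "lc z (1 / A j z - 1) z"
  have "A k ?z = A k z / A j z" if "k \<in> J" for k
    using assms(5)[OF that z(1) z(1)] z(2) by (simp add: field_simps)
  then show thesis
    using that[of ?z] assms(3) assms(4)[OF z(1) z(1)] z by simp
qed

text \<open>Block triangular form: on \<open>M'\<close> the functionals of \<open>F\<close> vanish,
  so \<open>N\<close> is handled first and \<open>F\<close> afterwards.\<close>

lemma indep_on_Un:
  assumes "finite N" "finite F" "N \<inter> F = {}" "M' \<subseteq> M"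
    and "\<And>f m. f \<in> F \<Longrightarrow> m \<in> M' \<Longrightarrow> A f m = 0"
    and "indep_on N M' A" "indep_on F M A"
  shows "indep_on (N \<union> F) M A"
proof (rule indep_onI)
  fix \<omega> j assume \<omega>: "\<And>m. m \<in> M \<Longrightarrow> (\<Sum>j\<in>N \<union> F. \<omega> j * A j m) = 0" and j: "j \<in> N \<union> F"
  have s: "(\<Sum>j\<in>N \<union> F. \<omega> j * A j m) = (\<Sum>j\<in>N. \<omega> j * A j m) + (\<Sum>j\<in>F. \<omega> j * A j m)" for m
    using assms by (intro sum.union_disjoint) auto
  have "(\<Sum>j\<in>N. \<omega> j * A j m) = 0" if "m \<in> M'" for m
    using \<omega>[of m] s[of m] assms(4,5) that by (simp add: subset_iff)
  then have N: "\<omega> j = 0" if "j \<in> N" for j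
    using indep_onD[OF assms(6)] that by blast
  have "(\<Sum>j\<in>F. \<omega> j * A j m) = 0" if "m \<in> M" for m
    using \<omega>[OF that] s[of m] N by simp
  then have "\<omega> j = 0" if "j \<in> F" for j
    using indep_onD[OF assms(7)] that by blast
  then show "\<omega> j = 0"
    using N j by blast
qed

text \<open>
  The algebra of a 1-extension: \<open>N\<close> consists of the edges at the new vertex, \<open>M'\<close> of the motions supported there,
  and \<open>f\<close> is the edge that is given up.
\<close>

lemma indep_on_exchange:
  assumes "finite N" "finite F" "N \<inter> F = {}" "f \<notin> F" "M' \<subseteq> M"
    and zero: "\<And>g m. g \<in> F \<Longrightarrow> m \<in> M' \<Longrightarrow> A g m = 0"
    and dep: "\<And>\<omega>. (\<And>m. m \<in> M' \<Longrightarrow> (\<Sum>j\<in>N. \<omega> j * A j m) = 0) \<Longrightarrow> \<exists>r. \<forall>j\<in>N. \<omega> j = r * \<kappa> j"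
    and lift: "\<And>m. m \<in> M \<Longrightarrow> \<exists>m'\<in>M. (\<forall>g\<in>F. A g m' = A g m) \<and> (\<Sum>j\<in>N. \<kappa> j * A j m') = c * B m"
    and c: "c \<noteq> 0"
    and ind: "indep_on (insert f F) M (\<lambda>g m. if g = f then B m else A g m)"
  shows "indep_on (N \<union> F) M A"
proof (rule indep_onI)
  fix \<omega> j assume \<omega>: "\<And>m. m \<in> M \<Longrightarrow> (\<Sum>j\<in>N \<union> F. \<omega> j * A j m) = 0" and j: "j \<in> N \<union> F"
  have s: "(\<Sum>j\<in>N \<union> F. \<omega> j * A j m) = (\<Sum>j\<in>N. \<omega> j * A j m) + (\<Sum>j\<in>F. \<omega> j * A j m)" for m
    using assms by (intro sum.union_disjoint) auto
  have "(\<Sum>j\<in>N. \<omega> j * A j m) = 0" if "m \<in> M'" for m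
    using \<omega>[of m] s[of m] zero assms(5) that by (simp add: subset_iff)
  then obtain r where r: "\<And>j. j \<in> N \<Longrightarrow> \<omega> j = r * \<kappa> j"
    using dep by metis
  \<comment> \<open>On a lifted motion the edges of \<open>N\<close> contribute \<open>r\<close>
    times their \<open>\<kappa>\<close>-combination, which is \<open>r * c\<close> times the value
    of \<open>B\<close>; hence the coefficient of \<open>f\<close>.\<close>
  define \<omega>' where "\<omega>' g = (if g = f then r * c else \<omega> g)" for g
  have "(\<Sum>g\<in>insert f F. \<omega>' g * (if g = f then B m else A g m)) = 0" if m: "m \<in> M" for m
  proof -
    obtain m' where m': "m' \<in> M" "\<And>g. g \<in> F \<Longrightarrow> A g m' = A g m" "(\<Sum>j\<in>N. \<kappa> j * A j m') = c * B m"
      using lift[OF m] by blast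
    have "(\<Sum>j\<in>N. \<omega> j * A j m') = r * (\<Sum>j\<in>N. \<kappa> j * A j m')"
      using r by (simp add: sum_distrib_left mult.assoc)
    moreover have "(\<Sum>g\<in>F. \<omega>' g * (if g = f then B m else A g m)) = (\<Sum>g\<in>F. \<omega> g * A g m')"
      using m' \<open>f \<notin> F\<close> by (intro sum.cong) (auto simp: \<omega>'_def)
    ultimately show ?thesis
      using \<omega>[OF m'(1)] s[of m'] m'(3) \<open>f \<notin> F\<close> \<open>finite F\<close>
      by (simp add: \<omega>'_def mult.assoc)
  qed
  then have z: "\<omega>' g = 0" if "g \<in> insert f F" for g
    using indep_onD[OF ind] that by blast
  then have "r = 0"
    using c by (force simp: \<omega>'_def)
  moreover have "\<omega> g = 0" if "g \<in> F" for g
    using z[of g] that \<open>f \<notin> F\<close> by (auto simp: \<omega>'_def split: if_splits)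
  ultimately show "\<omega> j = 0"
    using r j by auto
qed

section \<open>Generic parameters\<close>

definition segment_pt :: "('a \<Rightarrow> real) \<Rightarrow> ('a \<Rightarrow> real) \<Rightarrow> real \<Rightarrow> 'a \<Rightarrow> real" where
  "segment_pt x x' t = (\<lambda>v. x v + t * (x' v - x v))"

text \<open>A substitute for Zariski openness: on every line through a point of \<open>P\<close>
  only finitely many parameters violate \<open>P\<close>.\<close>

definition line_open :: "(('a \<Rightarrow> real) \<Rightarrow> ('b \<Rightarrow> real) \<Rightarrow> bool) \<Rightarrow> bool" where
  "line_open P \<longleftrightarrow> (\<forall>x y x' y'. P x y \<longrightarrow> finite {t. \<not> P (segment_pt x x' t) (segment_pt y y' t)})"

lemma segment_pt_reverse: "segment_pt x' x (1 - t) = segment_pt x x' t"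
  by (auto simp: segment_pt_def algebra_simps)

text \<open>Induction over \<open>S\<close>: the point found so far and a point good for the new
  condition span a line inside \<open>K\<close>, on which every condition fails only finitely
  often.\<close>

lemma line_open_common:
  assumes "finite S" "\<And>i. i \<in> S \<Longrightarrow> line_open (P i)"
    and "\<And>i. i \<in> S \<Longrightarrow> \<exists>x y. (x, y) \<in> K \<and> P i x y" and "K \<noteq> {}"
    and "\<And>x y x' y' t. (x, y) \<in> K \<Longrightarrow> (x', y') \<in> K \<Longrightarrow> (segment_pt x x' t, segment_pt y y' t) \<in> K"
  shows "\<exists>x y. (x, y) \<in> K \<and> (\<forall>i\<in>S. P i x y)"
  using assms(1-3)
proof (induction S rule: finite_induct)
  case empty
  then show ?case
    using assms(4) by auto
next
  case (insert i S)
  obtain x y where xy: "(x, y) \<in> K" "\<And>j. j \<in> S \<Longrightarrow> P j x y"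
    using insert by blast
  obtain x' y' where xy': "(x', y') \<in> K" "P i x' y'"
    using insert.prems by blast
  let ?T = "\<Union>j\<in>S. {t. \<not> P j (segment_pt x x' t) (segment_pt y y' t)}"
  let ?U = "{t. \<not> P i (segment_pt x x' t) (segment_pt y y' t)}"
  have "finite ?T"
    using insert xy by (auto simp: line_open_def)
  moreover have "finite ?U"
  proof -
    \<comment> \<open>\<open>line_open\<close> speaks of lines starting at a good point. Condition
      \<open>i\<close> is good at the other end, so the line is run backwards.\<close>
    have "finite {t. \<not> P i (segment_pt x' x t) (segment_pt y' y t)}"
      using insert.prems xy' by (auto simp: line_open_def)
    then have "finite ((\<lambda>t. 1 - t) ` {t. \<not> P i (segment_pt x' x t) (segment_pt y' y t)})"
      by (rule finite_imageI)
    moreover have "?U \<subseteq> (\<lambda>t. 1 - t) ` {t. \<not> P i (segment_pt x' x t) (segment_pt y' y t)}"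
    proof
      fix t assume "t \<in> ?U"
      then have "1 - t \<in> {t. \<not> P i (segment_pt x' x t) (segment_pt y' y t)}"
        by (simp add: segment_pt_reverse)
      then show "t \<in> (\<lambda>t. 1 - t) ` {t. \<not> P i (segment_pt x' x t) (segment_pt y' y t)}"
        by (rule rev_image_eqI) simp
    qed
    ultimately show ?thesis
      by (rule finite_subset[rotated])
  qed
  ultimately obtain t where "t \<notin> ?T \<union> ?U"
    using ex_new_if_finite[OF infinite_UNIV_char_0, of "?T \<union> ?U"] by blast
  then have "\<forall>j\<in>insert i S. P j (segment_pt x x' t) (segment_pt y y' t)"
    by simp
  then show ?case
    using assms(5)[OF xy(1) xy'(1), of t] by blast
qed

lemma line_open_poly:
  assumes "\<And>x y x' y'. \<exists>q. \<forall>t. f (segment_pt x x' t) (segment_pt y y' t) = poly q t"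
  shows "line_open (\<lambda>x y. f x y \<noteq> 0)"
  unfolding line_open_def
proof (intro allI impI)
  fix x y x' y'
  assume nz: "f x y \<noteq> 0"
  obtain q where q: "\<And>t. f (segment_pt x x' t) (segment_pt y y' t) = poly q t"
    using assms by blast
  have "poly q 0 \<noteq> 0"
    using q[of 0] nz by (simp add: segment_pt_def)
  then have "finite {t. poly q t = 0}"
    by (intro poly_roots_finite) auto
  then show "finite {t. \<not> f (segment_pt x x' t) (segment_pt y y' t) \<noteq> 0}"
    using q by simp
qed

lemma line_open_indep_on:
  assumes "finite J"
    and affine: "\<And>x y x' y' t j i. A (segment_pt x x' t) (segment_pt y y' t) j i = A x y j i + t * (A x' y' j i - A x y j i)"
  shows "line_open (\<lambda>x y. indep_on J I (A x y))"
  unfolding line_open_def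
proof (intro allI impI)
  fix x y x' y'
  assume ind: "indep_on J I (A x y)"
  define f where "f j i = [:A x y j i, A x' y' j i - A x y j i:]" for j i
  have f: "(\<lambda>j i. poly (f j i) t) = A (segment_pt x x' t) (segment_pt y y' t)" for t
    by (simp add: f_def affine fun_eq_iff)
  have "(\<lambda>j i. poly (f j i) 0) = A x y"
    by (simp add: f_def fun_eq_iff)
  then show "finite {t. \<not> indep_on J I (A (segment_pt x x' t) (segment_pt y y' t))}"
    using finite_dependent_parameters[OF assms(1), of I f 0] ind f by simp
qed

definition polynomial_along :: "(('a \<Rightarrow> real) \<Rightarrow> ('b \<Rightarrow> real) \<Rightarrow> real) \<Rightarrow> bool" where
  "polynomial_along f \<longleftrightarrow> (\<forall>x y x' y'. \<exists>q. \<forall>t. f (segment_pt x x' t) (segment_pt y y' t) = poly q t)"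

lemma polynomial_alongI:
  assumes "\<And>x y x' y'. \<exists>q. \<forall>t. f (segment_pt x x' t) (segment_pt y y' t) = poly q t"
  shows "polynomial_along f"
  using assms by (auto simp: polynomial_along_def)

lemma polynomial_along_fst: "polynomial_along (\<lambda>x y. x v)"
proof (rule polynomial_alongI)
  fix x x' :: "'a \<Rightarrow> real" and y y' :: "'b \<Rightarrow> real"
  show "\<exists>q. \<forall>t. segment_pt x x' t v = poly q t"
    by (intro exI[of _ "[:x v, x' v - x v:]"]) (simp add: segment_pt_def)
qed

lemma polynomial_along_snd: "polynomial_along (\<lambda>x y. y v)"
proof (rule polynomial_alongI)
  fix x x' :: "'a \<Rightarrow> real" and y y' :: "'b \<Rightarrow> real"
  show "\<exists>q. \<forall>t. segment_pt y y' t v = poly q t"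
    by (intro exI[of _ "[:y v, y' v - y v:]"]) (simp add: segment_pt_def)
qed

lemma polynomial_along_const: "polynomial_along (\<lambda>x y. c)"
  by (intro polynomial_alongI exI[of _ "[:c:]"]) simp

lemma polynomial_along_binop:
  assumes "polynomial_along f" "polynomial_along g" and "\<And>p q t. h (poly p t) (poly q t) = poly (H p q) t"
  shows "polynomial_along (\<lambda>x y. h (f x y) (g x y))"
proof (rule polynomial_alongI)
  fix x y x' y'
  obtain p q where "\<And>t. f (segment_pt x x' t) (segment_pt y y' t) = poly p t"
    "\<And>t. g (segment_pt x x' t) (segment_pt y y' t) = poly q t"
    using assms(1,2) unfolding polynomial_along_def by meson
  then show "\<exists>r. \<forall>t. h (f (segment_pt x x' t) (segment_pt y y' t)) (g (segment_pt x x' t) (segment_pt y y' t)) = poly r t"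
    using assms(3) by (intro exI[of _ "H p q"]) simp
qed

lemma polynomial_along_add: "polynomial_along f \<Longrightarrow> polynomial_along g \<Longrightarrow> polynomial_along (\<lambda>x y. f x y + g x y)"
  and polynomial_along_diff: "polynomial_along f \<Longrightarrow> polynomial_along g \<Longrightarrow> polynomial_along (\<lambda>x y. f x y - g x y)"
  and polynomial_along_mult: "polynomial_along f \<Longrightarrow> polynomial_along g \<Longrightarrow> polynomial_along (\<lambda>x y. f x y * g x y)"
  using polynomial_along_binop[of f g "(+)" "(+)"] polynomial_along_binop[of f g "(-)" "(-)"]
    polynomial_along_binop[of f g "(*)" "(*)"] by simp_all

lemmas polynomial_along_intros = polynomial_along_fst polynomial_along_snd polynomial_along_const
  polynomial_along_add polynomial_along_diff polynomial_along_mult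

section \<open>Edge functionals\<close>

definition gsign :: "'v gedge \<Rightarrow> 'a::field" where
  "gsign e = (if idgain e then 1 else - 1)"

definition alp :: "'v gedge \<Rightarrow> ('v \<Rightarrow> 'a::field) \<Rightarrow> 'a" where
  "alp e x = x (src e) - gsign e * x (tgt e)"

definition bet :: "'v gedge \<Rightarrow> ('v \<Rightarrow> 'a::field) \<Rightarrow> 'a" where
  "bet e y = y (src e) - y (tgt e)"

lemma gsign_square [simp]: "gsign e * gsign e = 1" "gsign e * (gsign e * c) = c"
  by (auto simp: gsign_def)

lemma alp_upd: "v \<notin> ends e \<Longrightarrow> alp e (x(v := c)) = alp e x"
  and bet_upd: "v \<notin> ends e \<Longrightarrow> bet e (x(v := c)) = bet e x"
  by (auto simp: alp_def bet_def ends_def)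

lemma const_upd_same [simp]: "(\<lambda>_. c)(v := c) = (\<lambda>_. c)"
  by auto

lemma alp_zero [simp]: "alp e (\<lambda>v. 0) = 0" and bet_zero [simp]: "bet e (\<lambda>v. 0) = 0"
  by (simp_all add: alp_def bet_def)

lemma alp_segment: "alp e (segment_pt x x' t) = alp e x + t * (alp e x' - alp e x)"
  and bet_segment: "bet e (segment_pt x x' t) = bet e x + t * (bet e x' - bet e x)"
  by (simp_all add: alp_def bet_def segment_pt_def algebra_simps)

definition symm_row :: "('v \<Rightarrow> 'a) \<Rightarrow> ('v \<Rightarrow> 'a) \<Rightarrow> 'v gedge \<Rightarrow> ('v \<Rightarrow> 'a) \<times> ('v \<Rightarrow> 'a) \<Rightarrow> 'a::field" where
  "symm_row x y e m = alp e x * alp e (fst m) + bet e y * bet e (snd m)"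

definition anti_row :: "('v \<Rightarrow> 'a) \<Rightarrow> ('v \<Rightarrow> 'a) \<Rightarrow> 'v gedge \<Rightarrow> ('v \<Rightarrow> 'a) \<times> ('v \<Rightarrow> 'a) \<Rightarrow> 'a::field" where
  "anti_row x y e m = alp e x * bet e (fst m) + bet e y * alp e (snd m)"

text \<open>An arbitrary vector of the plane spanned by the two functionals of \<open>e\<close>;
  \<open>symm_row\<close> is the case in which the coefficients come from a placement.\<close>

definition slope_row :: "('v gedge \<Rightarrow> 'a) \<Rightarrow> ('v gedge \<Rightarrow> 'a) \<Rightarrow> 'v gedge \<Rightarrow> ('v \<Rightarrow> 'a) \<times> ('v \<Rightarrow> 'a) \<Rightarrow> 'a::field" where
  "slope_row s t e m = s e * alp e (fst m) + t e * bet e (snd m)"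

lemma symm_row_upd:
  "v \<notin> ends e \<Longrightarrow> symm_row (x(v := c)) (y(v := d)) e m = symm_row x y e m"
  "v \<notin> ends e \<Longrightarrow> symm_row x y e (a(v := c), b(v := d)) = symm_row x y e (a, b)"
  by (simp_all add: symm_row_def alp_upd bet_upd)

lemma symm_row_at:
  assumes "v \<in> ends e"
  shows "symm_row x y e (a, b) =
    (x v - gsign e * x (other_end e v)) * (a v - gsign e * a (other_end e v)) +
    (y v - y (other_end e v)) * (b v - b (other_end e v))"
  using assms by (auto simp: symm_row_def alp_def bet_def ends_def other_end_def algebra_simps)

text \<open>The signs in \<open>s e\<close> and \<open>t e\<close> undo the orientation of
  \<open>e\<close>, so that \<open>p\<close> and \<open>q\<close> are its coefficients as seen from
  \<open>v\<close>.\<close>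

lemma slope_row_at:
  assumes "v \<in> ends e" "ends e \<noteq> {v}"
    and "s e = (if src e = v then p else - gsign e * p)" "t e = (if src e = v then q else - q)"
  shows "slope_row s t e (a, b) =
    p * (a v - gsign e * a (other_end e v)) + q * (b v - b (other_end e v))"
  using assms by (auto simp: slope_row_def alp_def bet_def ends_def other_end_def algebra_simps)

context mirror
begin

text \<open>Horizontal and vertical components; a fully symmetric motion moves fixed vertices only
  along the mirror.\<close>

definition motions :: "(('v \<Rightarrow> 'a::field) \<times> ('v \<Rightarrow> 'a)) set" where
  "motions = {(a, b). \<forall>v\<in>V0. a v = 0}"

definition motions_at :: "'v \<Rightarrow> (('v \<Rightarrow> 'a::field) \<times> ('v \<Rightarrow> 'a)) set" where
  "motions_at v = {((\<lambda>_. 0)(v := a), (\<lambda>_. 0)(v := b)) | a b. v \<in> V0 \<longrightarrow> a = 0}"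

lemma motions_at_subset: "motions_at v \<subseteq> motions"
  by (auto simp: motions_def motions_at_def)

lemma motions_atI: "v \<notin> V0 \<or> a = 0 \<Longrightarrow> ((\<lambda>_. 0)(v := a), (\<lambda>_. 0)(v := b)) \<in> motions_at v"
  by (auto simp: motions_at_def)

lemma symm_row_motions_at: "v \<notin> ends e \<Longrightarrow> m \<in> motions_at v \<Longrightarrow> symm_row x y e m = 0"
  by (auto simp: motions_at_def symm_row_def alp_upd bet_upd)

lemma slope_row_motions_at: "v \<notin> ends e \<Longrightarrow> m \<in> motions_at v \<Longrightarrow> slope_row s t e m = 0"
  by (auto simp: motions_at_def slope_row_def alp_upd bet_upd)

lemma sparse_no_trivial_loop:
  assumes "sparse k F" "e \<in> F" "ends e = {v}" "v \<notin> V0" "2 \<le> k"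
  shows "\<not> idgain e"
proof
  assume "idgain e"
  then have "potential (\<lambda>_. True) {e}"
    by (simp add: potential_def)
  then have "bal {e}"
    by (rule balI)
  then have "corank k {e} = k"
    using assms by (simp add: corank_def nfix_def)
  then show False
    using sparseD[OF assms(1), of "{e}"] assms by (simp add: weight_insert)
qed

lemma loop_at: "ends e = {v} \<Longrightarrow> other_end e v = v"
  by (auto simp: ends_def other_end_def)

lemma other_end_neq: "v \<in> ends e \<Longrightarrow> ends e \<noteq> {v} \<Longrightarrow> other_end e v \<noteq> v"
  by (auto simp: ends_def other_end_def)

lemma slope_attach:
  fixes s t s' t' :: "'v gedge \<Rightarrow> 'a::field"
  assumes N: "finite N" "finite F" "\<And>e. e \<in> N \<Longrightarrow> v \<in> ends e" "v \<notin> vset F"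
    and F: "indep_on F motions (slope_row s t)" and NN: "indep_on N (motions_at v) (slope_row s' t')"
  shows "\<exists>s t :: 'v gedge \<Rightarrow> 'a. indep_on (N \<union> F) motions (slope_row s t)"
proof -
  let ?s = "\<lambda>e. if e \<in> N then s' e else s e" and ?t = "\<lambda>e. if e \<in> N then t' e else t e"
  have nv: "v \<notin> ends e" if "e \<in> F" for e
    using that N(4) by (auto simp: vset_def)
  then have disj: "N \<inter> F = {}"
    using N by auto
  have "indep_on F motions (slope_row ?s ?t) = indep_on F motions (slope_row s t)"
    using disj by (intro indep_on_cong) (auto simp: slope_row_def)
  moreover have "indep_on N (motions_at v) (slope_row ?s ?t) = indep_on N (motions_at v) (slope_row s' t')"
    by (intro indep_on_cong) (auto simp: slope_row_def)
  ultimately have "indep_on (N \<union> F) motions (slope_row ?s ?t)"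
    using NN disj nv motions_at_subset slope_row_motions_at N(1,2) F
    by (intro indep_on_Un[where M' = "motions_at v"]) blast+
  then show ?thesis by blast
qed

lemma symm_attach:
  fixes x y :: "'v \<Rightarrow> 'a::field"
  assumes N: "finite N" "finite F" "\<And>e. e \<in> N \<Longrightarrow> v \<in> ends e" "v \<notin> vset F"
    and x: "\<forall>u\<in>V0. x u = 0" "v \<in> V0 \<longrightarrow> X = 0"
    and F: "indep_on F motions (symm_row x y)"
    and NN: "indep_on N (motions_at v) (symm_row (x(v := X)) (y(v := Y)))"
  shows "\<exists>x y :: 'v \<Rightarrow> 'a. (\<forall>u\<in>V0. x u = 0) \<and> indep_on (N \<union> F) motions (symm_row x y)"
proof -
  have nv: "v \<notin> ends e" if "e \<in> F" for e
    using that N(4) by (auto simp: vset_def)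
  then have disj: "N \<inter> F = {}"
    using N by auto
  have "indep_on F motions (symm_row (x(v := X)) (y(v := Y))) = indep_on F motions (symm_row x y)"
    using nv by (intro indep_on_cong) (auto simp: symm_row_upd)
  then have "indep_on (N \<union> F) motions (symm_row (x(v := X)) (y(v := Y)))"
    using NN disj nv motions_at_subset symm_row_motions_at N(1,2) F
    by (intro indep_on_Un[where M' = "motions_at v"]) blast+
  then show ?thesis
    using x by (intro exI[of _ "x(v := X)"] exI[of _ "y(v := Y)"]) auto
qed

subsection \<open>Generic slopes\<close>

text \<open>Slopes are free for each edge, with no placement behind them. At a vertex of degree
  three, \<open>e1\<close> and \<open>e2\<close> get the same vector as seen from \<open>v\<close>,
  so that the only dependence there is their difference, which is the bypass row up to sign.\<close>

lemma sparse_2_slopes: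
  assumes "sparse 2 F"
  shows "\<exists>s t. indep_on F motions (slope_row s t :: _ \<Rightarrow> _ \<Rightarrow> real)"
proof -
  have "(2::int) = 2 \<or> (2::int) = 3" by simp
  from this assms show ?thesis
  proof (induction F rule: sparse_induct)
    case empty
    show ?case by simp
  next
    case (fixed_leaf F e v)
    obtain s t where st: "indep_on F motions (slope_row s t :: _ \<Rightarrow> _ \<Rightarrow> real)"
      using fixed_leaf by blast
    have "indep_on {e} (motions_at v) (slope_row (\<lambda>_. 0) (\<lambda>_. 1) :: _ \<Rightarrow> _ \<Rightarrow> real)"
    proof (rule indep_onI)
      fix \<omega> :: "_ \<Rightarrow> real" and j
      assume "\<And>i. i \<in> motions_at v \<Longrightarrow> (\<Sum>j\<in>{e}. \<omega> j * slope_row (\<lambda>_. 0) (\<lambda>_. 1) j i) = 0" "j \<in> {e}"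
      from this(1)[OF motions_atI[of v 0 1]] this(2) show "\<omega> j = 0"
        using fixed_leaf(3,4) by (auto simp: slope_row_def bet_def ends_def split: if_splits)
    qed
    from slope_attach[OF _ _ _ fixed_leaf(5) st this] show ?case
      using fixed_leaf sparse_finite[OF fixed_leaf(1)] by auto
  next
    case (two F e1 e2 v)
    obtain s t where st: "indep_on F motions (slope_row s t :: _ \<Rightarrow> _ \<Rightarrow> real)"
      using two by blast
    \<comment> \<open>\<open>e1\<close> may be a loop, on which \<open>bet\<close> vanishes but
      \<open>alp\<close> does not, because its gain is not the identity; so \<open>e1\<close> takes
      the \<open>alp\<close> direction.\<close>
    let ?s = "\<lambda>e. of_bool (e = e1) :: real" and ?t = "\<lambda>e. of_bool (e = e2) :: real"
    have loop: "ends e1 = {v} \<Longrightarrow> \<not> idgain e1"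
      using sparse_no_trivial_loop[OF two(1)] two(2) by auto
    have "indep_on {e1, e2} (motions_at v) (slope_row ?s ?t)"
    proof (rule indep_onI)
      fix \<omega> :: "_ \<Rightarrow> real" and j
      assume \<omega>: "\<And>i. i \<in> motions_at v \<Longrightarrow> (\<Sum>j\<in>{e1, e2}. \<omega> j * slope_row ?s ?t j i) = 0" and j: "j \<in> {e1, e2}"
      have "\<omega> e1 * alp e1 ((\<lambda>_. 0)(v := 1)) = 0" "\<omega> e2 * bet e2 ((\<lambda>_. 0)(v := 1)) = 0"
        using \<omega>[OF motions_atI[of v 1 0]] \<omega>[OF motions_atI[of v 0 1]] two(2,5) by (auto simp: slope_row_def)
      moreover have "alp e1 ((\<lambda>_. 0)(v := 1)) \<noteq> (0::real)" "bet e2 ((\<lambda>_. 0)(v := 1)) \<noteq> (0::real)"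
        using two(3,4,6) loop by (auto simp: alp_def bet_def gsign_def ends_def)
      ultimately show "\<omega> j = 0"
        using j by auto
    qed
    from slope_attach[OF _ _ _ two(7) st this] show ?case
      using two sparse_finite[OF two(1)] by auto
  next
    case (one F e v)
    obtain s t where st: "indep_on F motions (slope_row s t :: _ \<Rightarrow> _ \<Rightarrow> real)"
      using one by blast
    have loop: "ends e = {v} \<Longrightarrow> \<not> idgain e"
      using sparse_no_trivial_loop[OF one(1)] one(2) by auto
    have "indep_on {e} (motions_at v) (slope_row (\<lambda>_. 1) (\<lambda>_. 0) :: _ \<Rightarrow> _ \<Rightarrow> real)"
    proof (rule indep_onI)
      fix \<omega> :: "_ \<Rightarrow> real" and j
      assume "\<And>i. i \<in> motions_at v \<Longrightarrow> (\<Sum>j\<in>{e}. \<omega> j * slope_row (\<lambda>_. 1) (\<lambda>_. 0) j i) = 0" "j \<in> {e}"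
      from this(1)[OF motions_atI[of v 1 0]] this(2) show "\<omega> j = 0"
        using one(2,3) loop by (auto simp: slope_row_def alp_def gsign_def ends_def split: if_splits)
    qed
    from slope_attach[OF _ _ _ one(4) st this] show ?case
      using one sparse_finite[OF one(1)] by auto
  next
    case (three F e1 e2 e3 v n)
    let ?f = "bypass n v e1 e2" and ?N = "{e1, e2, e3}"
    let ?o1 = "other_end e1 v" and ?o2 = "other_end e2 v"
    obtain s t where st: "indep_on (insert ?f F) motions (slope_row s t :: _ \<Rightarrow> _ \<Rightarrow> real)"
      using three by blast
    have fin: "finite F"
      using sparse_finite[OF three(1)] by auto
    define S T where ST: "S = s ?f" "T = t ?f"
    \<comment> \<open>The factor \<open>gsign e1\<close> transports the first slope of the bypass
      from the neighbour along \<open>e1\<close> to \<open>v\<close>.\<close>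
    define p q where pq: "p = gsign e1 * S" "q = T"
    have pq0: "p\<^sup>2 + q\<^sup>2 \<noteq> 0"
    proof
      assume "p\<^sup>2 + q\<^sup>2 = 0"
      then have "s ?f = 0" "t ?f = 0"
        by (auto simp: pq ST gsign_def sum_power2_eq_zero_iff split: if_splits)
      then show False
        using indep_on_nonzero[OF _ st, of ?f] fin by (auto simp: slope_row_def)
    qed
    \<comment> \<open>As seen from \<open>v\<close>, \<open>e1\<close> and \<open>e2\<close> get (p,
      q) and \<open>e3\<close> gets the orthogonal vector (-q, p). As (p, q) is nonzero over the
      reals, the two directions are independent.\<close>
    define s' where "s' e = (if e \<in> ?N then let p = if e = e3 then - q else p in
      if src e = v then p else - gsign e * p else s e)" for e
    define t' where "t' e = (if e \<in> ?N then let q = if e = e3 then p else q in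
      if src e = v then q else - q else t e)" for e
    have r1: "slope_row s' t' e1 (a, b) = p * (a v - gsign e1 * a ?o1) + q * (b v - b ?o1)" for a b
      using three(3,6,7,9) by (intro slope_row_at) (auto simp: s'_def t'_def)
    have r2: "slope_row s' t' e2 (a, b) = p * (a v - gsign e2 * a ?o2) + q * (b v - b ?o2)" for a b
      using three(4,8,10) by (intro slope_row_at) (auto simp: s'_def t'_def)
    have r3: "slope_row s' t' e3 (a, b) = - q * (a v - gsign e3 * a (other_end e3 v)) + p * (b v - b (other_end e3 v))" for a b
      using three(5,11) by (intro slope_row_at) (auto simp: s'_def t'_def)
    have o: "?o1 \<noteq> v" "?o2 \<noteq> v" "other_end e3 v \<noteq> v"
      using other_end_neq[OF three(3,9)] other_end_neq[OF three(4,10)] other_end_neq[OF three(5,11)] by blast+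
    have nv: "v \<notin> ends e" if "e \<in> F" for e
      using that three(12) by (auto simp: vset_def)
    then have disj: "?N \<inter> F = {}"
      using three by auto
    have ind: "indep_on (insert ?f F) motions (\<lambda>g m. if g = ?f then slope_row s t ?f m else slope_row s' t' g m)"
    proof -
      have "indep_on (insert ?f F) motions (\<lambda>g m. if g = ?f then slope_row s t ?f m else slope_row s' t' g m)
        = indep_on (insert ?f F) motions (slope_row s t)"
        using disj by (intro indep_on_cong) (auto simp: slope_row_def s'_def t'_def)
      then show ?thesis
        using st by simp
    qed
    define \<kappa> where "\<kappa> e = (if e = e1 then 1 else if e = e2 then - 1 else (0::real))" for e
    have "indep_on (?N \<union> F) motions (slope_row s' t')"
    proof (rule indep_on_exchange[where M' = "motions_at v" and f = ?f and \<kappa> = \<kappa> and c = "-1" and B = "slope_row s t ?f"])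
      show "finite ?N" "finite F" "?N \<inter> F = {}" "?f \<notin> F" "motions_at v \<subseteq> (motions :: ((_ \<Rightarrow> real) \<times> _) set)"
        using fin disj three(13) motions_at_subset by auto
      show "slope_row s' t' g m = 0" if "g \<in> F" "m \<in> motions_at v" for g m
        using slope_row_motions_at[OF nv[OF that(1)] that(2)] .
    next
      fix \<omega> :: "_ \<Rightarrow> real" assume \<omega>: "\<And>m. m \<in> motions_at v \<Longrightarrow> (\<Sum>j\<in>?N. \<omega> j * slope_row s' t' j m) = 0"
      have "\<omega> e1 * p + \<omega> e2 * p - \<omega> e3 * q = 0" "\<omega> e1 * q + \<omega> e2 * q + \<omega> e3 * p = 0"
        using \<omega>[OF motions_atI[of v 1 0]] \<omega>[OF motions_atI[of v 0 1]] three(2,6-8) o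
        by (simp_all add: r1 r2 r3)
      then have "(\<omega> e1 + \<omega> e2) * (p\<^sup>2 + q\<^sup>2) = 0" "\<omega> e3 * (p\<^sup>2 + q\<^sup>2) = 0"
        by algebra+
      then have "\<omega> e2 = - \<omega> e1" "\<omega> e3 = 0"
        using pq0 by auto
      then show "\<exists>r. \<forall>j\<in>?N. \<omega> j = r * \<kappa> j"
        using three(6-8) by (intro exI[of _ "\<omega> e1"]) (auto simp: \<kappa>_def)
    next
      fix m :: "(_ \<Rightarrow> real) \<times> _" assume m: "m \<in> motions"
      obtain a b where ab: "m = (a, b)"
        by (cases m)
      have "(\<Sum>j\<in>?N. \<kappa> j * slope_row s' t' j m) = slope_row s' t' e1 m - slope_row s' t' e2 m"
        using three(6-8) by (simp add: \<kappa>_def)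
      also have "\<dots> = - 1 * slope_row s t ?f m"
      proof -
        have "slope_row s t ?f (a, b) = S * (a ?o1 - gsign e1 * gsign e2 * a ?o2) + T * (b ?o1 - b ?o2)"
          unfolding slope_row_def ST[symmetric] by (simp add: alp_def bet_def gsign_def bypass_def)
        then show ?thesis
          unfolding ab r1 r2 pq by (simp add: algebra_simps)
      qed
      finally show "\<exists>m'\<in>motions. (\<forall>g\<in>F. slope_row s' t' g m' = slope_row s' t' g m) \<and>
          (\<Sum>j\<in>?N. \<kappa> j * slope_row s' t' j m') = - 1 * slope_row s t ?f m"
        using m by blast
    qed (use ind in auto)
    then show ?case
      by auto
  qed
qed

subsection \<open>Symmetric placements\<close>

text \<open>Both requirements are open along lines among the placements with fixed vertices on the
  axis. The polynomial \<open>f\<close> will be a non-degeneracy condition on the neighbours of a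
  new vertex.\<close>

lemma placement_avoiding:
  fixes f :: "('v \<Rightarrow> real) \<Rightarrow> ('v \<Rightarrow> real) \<Rightarrow> real"
  assumes "finite F" "\<exists>x y :: 'v \<Rightarrow> real. (\<forall>u\<in>V0. x u = 0) \<and> indep_on F motions (symm_row x y)"
    and "polynomial_along f" "\<exists>x y. (\<forall>u\<in>V0. x u = 0) \<and> f x y \<noteq> 0"
  obtains x y :: "'v \<Rightarrow> real" where "\<forall>u\<in>V0. x u = 0" "indep_on F motions (symm_row x y)" "f x y \<noteq> 0"
proof -
  let ?P = "\<lambda>b x y. if b then indep_on F motions (symm_row x y :: _ \<Rightarrow> _ \<Rightarrow> real) else f x y \<noteq> 0"
  let ?K = "{(x, y). \<forall>u\<in>V0. x u = (0 :: real)} :: (('v \<Rightarrow> real) \<times> ('v \<Rightarrow> real)) set"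
  have "\<exists>x y. (x, y) \<in> ?K \<and> (\<forall>b\<in>UNIV. ?P b x y)"
  proof (rule line_open_common)
    fix b
    have "line_open (\<lambda>x y. indep_on F motions (symm_row x y :: _ \<Rightarrow> _ \<Rightarrow> real))"
      using assms(1) by (rule line_open_indep_on) (simp add: symm_row_def alp_segment bet_segment algebra_simps)
    moreover have "line_open (\<lambda>x y. f x y \<noteq> 0)"
      using assms(3) unfolding polynomial_along_def by (intro line_open_poly) blast
    ultimately show "line_open (?P b)"
      by (cases b) simp_all
    show "\<exists>x y. (x, y) \<in> ?K \<and> ?P b x y"
      using assms(2,4) by (cases b) auto
  next
    show "?K \<noteq> {}"
      using assms(2) by auto
  qed (auto simp: segment_pt_def)
  then obtain x y where xy: "(x, y) \<in> ?K" "\<And>b. ?P b x y"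
    by blast
  then show thesis
    using that[of x y] xy(2)[of True] xy(2)[of False] by simp
qed

text \<open>The determinant in \<open>d\<close> says that the points (p, y1), (q, y2), (r, y3) are
  not collinear. From the midpoint of the first two the third is in another direction, so only
  opposite pulls along the first two balance.\<close>

lemma midpoint_dependence:
  fixes p q r y1 y2 y3 w1 w2 w3 :: real
  assumes x: "w1 * ((p + q) / 2 - p) + w2 * ((p + q) / 2 - q) + w3 * ((p + q) / 2 - r) = 0"
    and y: "w1 * ((y1 + y2) / 2 - y1) + w2 * ((y1 + y2) / 2 - y2) + w3 * ((y1 + y2) / 2 - y3) = 0"
    and d: "(q - p) * (y1 - y3) - (y2 - y1) * (p - r) \<noteq> 0"
  shows "w3 = 0 \<and> w1 = w2"
proof -
  have x': "(w1 - w2) * (q - p) + w3 * (p + q - 2 * r) = 0"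
    using x by (simp add: field_simps)
  have y': "(w1 - w2) * (y2 - y1) + w3 * (y1 + y2 - 2 * y3) = 0"
    using y by (simp add: field_simps)
  have "w3 * ((q - p) * (y1 - y3) - (y2 - y1) * (p - r)) * 2
    = ((w1 - w2) * (y2 - y1) + w3 * (y1 + y2 - 2 * y3)) * (q - p)
      - ((w1 - w2) * (q - p) + w3 * (p + q - 2 * r)) * (y2 - y1)"
    by (simp add: algebra_simps)
  then have "w3 = 0"
    using x' y' d by simp
  moreover from this have "w1 = w2"
    using x' y' d by auto
  ultimately show ?thesis
    by simp
qed

text \<open>A neighbour \<open>o\<close> seen across an edge of sign \<open>\<sigma>\<close> is the
  point (\<sigma> x(o), y(o)). Equal neighbours have different signs and thus appear as two mirror
  images. If all three were fixed, they would lie on the axis.\<close>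

lemma exists_noncollinear:
  fixes \<sigma>1 \<sigma>2 \<sigma>3 :: real
  assumes "\<sigma>1 \<in> {1, -1}" "\<sigma>2 \<in> {1, -1}" "\<sigma>3 \<in> {1, -1}"
    and lifts: "o1 = o2 \<Longrightarrow> o1 \<notin> V0 \<and> \<sigma>1 \<noteq> \<sigma>2" "o1 = o3 \<Longrightarrow> o1 \<notin> V0 \<and> \<sigma>1 \<noteq> \<sigma>3"
      "o2 = o3 \<Longrightarrow> o2 \<notin> V0 \<and> \<sigma>2 \<noteq> \<sigma>3"
    and "\<not> {o1, o2, o3} \<subseteq> V0"
  shows "\<exists>x y :: 'v \<Rightarrow> real. (\<forall>u\<in>V0. x u = 0) \<and>
    (\<sigma>2 * x o2 - \<sigma>1 * x o1) * (y o1 - y o3) - (y o2 - y o1) * (\<sigma>1 * x o1 - \<sigma>3 * x o3) \<noteq> 0"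
proof -
  obtain w where w: "w \<in> {o1, o2, o3}" "w \<notin> V0"
    using assms(7) by blast
  define x where "x u = (if u = w then 1 else 0 :: real)" for u
  define y where "y u = (if u = o1 then 0 else if u = o2 then 1 else 2 :: real)" for u
  consider "o1 \<noteq> o2" "o1 \<noteq> o3" "o2 \<noteq> o3" | "o1 = o2" "o1 \<noteq> o3" | "o1 = o3" "o1 \<noteq> o2" | "o2 = o3" "o1 \<noteq> o2"
    using assms(1-6) by blast
  then show ?thesis
  proof cases
    case 1
    show ?thesis
      using 1 w assms(1-3) by (intro exI[of _ x] exI[of _ y]) (auto simp: x_def y_def)
  next
    case 2
    show ?thesis
      using 2 lifts assms(1-3)
      by (intro exI[of _ "\<lambda>u. if u = o1 then 1 else 0"] exI[of _ y]) (auto simp: y_def)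
  next
    case 3
    show ?thesis
      using 3 lifts assms(1-3)
      by (intro exI[of _ "\<lambda>u. if u = o1 then 1 else 0"] exI[of _ y]) (auto simp: y_def)
  next
    case 4
    show ?thesis
      using 4 lifts assms(1-3)
      by (intro exI[of _ "\<lambda>u. if u = o2 then 1 else 0"] exI[of _ y]) (auto simp: y_def)
  qed
qed

text \<open>The rows are tied to positions, so at each step only the position of the new vertex can
  be chosen; the placement of the other vertices is made non-degenerate beforehand.\<close>

lemma sparse_3_placement:
  assumes "sparse 3 F"
  shows "\<exists>x y :: 'v \<Rightarrow> real. (\<forall>u\<in>V0. x u = 0) \<and> indep_on F motions (symm_row x y)"
proof -
  have "(3::int) = 2 \<or> (3::int) = 3" by simp
  from this assms show ?thesis
  proof (induction F rule: sparse_induct)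
    case empty
    show ?case by (intro exI[of _ "\<lambda>_. 0"]) simp
  next
    case (fixed_leaf F e v)
    obtain x y :: "'v \<Rightarrow> real" where xy: "\<forall>u\<in>V0. x u = 0" "indep_on F motions (symm_row x y)"
      using fixed_leaf by blast
    let ?o = "other_end e v"
    have o: "?o \<noteq> v"
      using other_end_neq[OF fixed_leaf(3,4)] .
    have "indep_on {e} (motions_at v) (symm_row (x(v := 0)) (y(v := y ?o + 1)))"
    proof (rule indep_onI)
      fix \<omega> :: "_ \<Rightarrow> real" and j
      assume "\<And>i. i \<in> motions_at v \<Longrightarrow> (\<Sum>j\<in>{e}. \<omega> j * symm_row (x(v := 0)) (y(v := y ?o + 1)) j i) = 0" "j \<in> {e}"
      from this(1)[OF motions_atI[of v 0 1]] this(2) show "\<omega> j = 0"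
        using o by (simp add: symm_row_at[OF fixed_leaf(3)])
    qed
    from symm_attach[OF _ _ _ fixed_leaf(5) xy(1) _ xy(2) this] show ?case
      using fixed_leaf(3) sparse_finite[OF fixed_leaf(1)] by simp
  next
    case (one F e v)
    obtain x y :: "'v \<Rightarrow> real" where xy: "\<forall>u\<in>V0. x u = 0" "indep_on F motions (symm_row x y)"
      using one by blast
    let ?o = "other_end e v"
    have loop: "ends e = {v} \<Longrightarrow> \<not> idgain e"
      using sparse_no_trivial_loop[OF one(1)] one(2) by auto
    \<comment> \<open>The abscissa 1 serves a loop, which needs \<open>v\<close> off the axis; the
      ordinate serves an edge to another vertex.\<close>
    have "indep_on {e} (motions_at v) (symm_row (x(v := 1)) (y(v := y ?o + 1)))"
    proof (rule indep_onI)
      fix \<omega> :: "_ \<Rightarrow> real" and j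
      assume \<omega>: "\<And>i. i \<in> motions_at v \<Longrightarrow> (\<Sum>j\<in>{e}. \<omega> j * symm_row (x(v := 1)) (y(v := y ?o + 1)) j i) = 0"
        and j: "j \<in> {e}"
      show "\<omega> j = 0"
      proof (cases "?o = v")
        case True
        then have "\<not> idgain e"
          using loop other_end_neq[OF one(3)] by blast
        then show ?thesis
          using \<omega>[OF motions_atI[of v 1 0]] True one(2) j by (simp add: symm_row_at[OF one(3)] gsign_def)
      next
        case False
        then show ?thesis
          using \<omega>[OF motions_atI[of v 0 1]] j by (simp add: symm_row_at[OF one(3)])
      qed
    qed
    from symm_attach[OF _ _ _ one(4) xy(1) _ xy(2) this] show ?case
      using one(2,3) sparse_finite[OF one(1)] by simp
  next
    case (two F e1 e2 v)
    let ?o1 = "other_end e1 v" and ?o2 = "other_end e2 v"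
    have fin: "finite F"
      using sparse_finite[OF two(1)] by simp
    have o2: "?o2 \<noteq> v"
      using other_end_neq[OF two(4,6)] .
    have "\<exists>x y X Y. (\<forall>u\<in>V0. x u = 0) \<and> indep_on F motions (symm_row x y) \<and>
      indep_on {e1, e2} (motions_at v) (symm_row (x(v := X)) (y(v := Y)) :: _ \<Rightarrow> _ \<Rightarrow> real)"
    proof (cases "ends e1 = {v}")
      case True
      have loop: "\<not> idgain e1"
        using sparse_no_trivial_loop[OF two(1)] two(2) True by auto
      obtain x y :: "'v \<Rightarrow> real" where xy: "\<forall>u\<in>V0. x u = 0" "indep_on F motions (symm_row x y)"
        using two by blast
      \<comment> \<open>The loop sees only horizontal motion of \<open>v\<close>, while
        \<open>e2\<close> also sees vertical motion, because the heights differ.\<close>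
      have "indep_on {e1, e2} (motions_at v) (symm_row (x(v := 1)) (y(v := y ?o2 + 1)))"
      proof (rule indep_onI)
        fix \<omega> :: "_ \<Rightarrow> real" and j
        assume \<omega>: "\<And>i. i \<in> motions_at v \<Longrightarrow> (\<Sum>j\<in>{e1, e2}. \<omega> j * symm_row (x(v := 1)) (y(v := y ?o2 + 1)) j i) = 0"
          and j: "j \<in> {e1, e2}"
        have "\<omega> e2 = 0"
          using \<omega>[OF motions_atI[of v 0 1]] two(5) o2 True
          by (simp add: symm_row_at[OF two(3)] symm_row_at[OF two(4)] loop_at)
        moreover have "\<omega> e1 = 0"
          using \<omega>[OF motions_atI[of v 1 0]] two(2,5) loop True \<open>\<omega> e2 = 0\<close>
          by (simp add: symm_row_at[OF two(3)] loop_at gsign_def)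
        ultimately show "\<omega> j = 0"
          using j by auto
      qed
      then show ?thesis
        using xy by blast
    next
      case False
      have o1: "?o1 \<noteq> v"
        using other_end_neq[OF two(3) False] .
      let ?\<sigma>1 = "gsign e1 :: real" and ?\<sigma>2 = "gsign e2 :: real"
      have lifts: "?o1 = ?o2 \<Longrightarrow> ?o1 \<notin> V0 \<and> ?\<sigma>1 \<noteq> ?\<sigma>2"
        using sparse_parallel[OF two(1), of e1 e2 v ?o1] two(2,5) ends_other[OF two(3)] ends_other[OF two(4)] o1
        by (auto simp: gsign_def)
      let ?d = "\<lambda>x y. (?\<sigma>2 * x ?o2 - ?\<sigma>1 * x ?o1) * (?\<sigma>2 * x ?o2 - ?\<sigma>1 * x ?o1) + (y ?o2 - y ?o1) * (y ?o2 - y ?o1)"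
      have "\<exists>x y. (\<forall>u\<in>V0. x u = 0) \<and> ?d x y \<noteq> 0"
      proof (cases "?o1 = ?o2")
        case True
        then show ?thesis
          using lifts by (intro exI[of _ "\<lambda>u. if u = ?o1 then 1 else 0"] exI[of _ "\<lambda>u. 0"]) auto
      next
        case False
        then show ?thesis
          by (intro exI[of _ "\<lambda>u. 0"] exI[of _ "\<lambda>u. if u = ?o1 then 1 else 0"]) auto
      qed
      moreover have "polynomial_along ?d"
        by (intro polynomial_along_intros)
      ultimately obtain x y where xy: "\<forall>u\<in>V0. x u = 0" "indep_on F motions (symm_row x y)" "?d x y \<noteq> 0"
        using placement_avoiding[OF fin, of ?d] two by blast
      \<comment> \<open>With P1 and P2 the neighbours as seen from \<open>v\<close>, the new point
        is P1 plus P2 - P1 rotated by a right angle. Up to sign, the determinant of the two edge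
        directions is the squared length \<open>?d\<close>.\<close>
      define X where "X = ?\<sigma>1 * x ?o1 - (y ?o2 - y ?o1)"
      define Y where "Y = y ?o1 + (?\<sigma>2 * x ?o2 - ?\<sigma>1 * x ?o1)"
      have "indep_on {e1, e2} (motions_at v) (symm_row (x(v := X)) (y(v := Y)))"
      proof (rule indep_onI)
        fix \<omega> :: "_ \<Rightarrow> real" and j
        assume \<omega>: "\<And>i. i \<in> motions_at v \<Longrightarrow> (\<Sum>j\<in>{e1, e2}. \<omega> j * symm_row (x(v := X)) (y(v := Y)) j i) = 0"
          and j: "j \<in> {e1, e2}"
        have "\<omega> e1 * (X - ?\<sigma>1 * x ?o1) + \<omega> e2 * (X - ?\<sigma>2 * x ?o2) = 0"
          "\<omega> e1 * (Y - y ?o1) + \<omega> e2 * (Y - y ?o2) = 0"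
          using \<omega>[OF motions_atI[of v 1 0]] \<omega>[OF motions_atI[of v 0 1]] two(2,5) o1 o2
          by (simp_all add: symm_row_at[OF two(3)] symm_row_at[OF two(4)])
        then have "\<omega> e2 * ?d x y = 0" "\<omega> e1 * ?d x y = 0"
          unfolding X_def Y_def by algebra+
        then show "\<omega> j = 0"
          using xy(3) j by auto
      qed
      then show ?thesis
        using xy by blast
    qed
    then obtain x y X Y where xy: "\<forall>u\<in>V0. x u = 0" "indep_on F motions (symm_row x y)"
      "indep_on {e1, e2} (motions_at v) (symm_row (x(v := X)) (y(v := Y)) :: _ \<Rightarrow> _ \<Rightarrow> real)"
      by blast
    from symm_attach[OF _ fin _ two(7) xy(1) _ xy(2,3)] show ?case
      using two(2,3,4) by auto
  next
    case (three F e1 e2 e3 v n)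
    let ?f = "bypass n v e1 e2" and ?N = "{e1, e2, e3}"
    let ?\<sigma>1 = "gsign e1 :: real" and ?\<sigma>2 = "gsign e2 :: real" and ?\<sigma>3 = "gsign e3 :: real"
    define o1 o2 o3 where o_def: "o1 = other_end e1 v" "o2 = other_end e2 v" "o3 = other_end e3 v"
    have fin: "finite F" "finite (insert ?f F)"
      using sparse_finite[OF three(1)] by auto
    have o: "o1 \<noteq> v" "o2 \<noteq> v" "o3 \<noteq> v"
      using other_end_neq[OF three(3,9)] other_end_neq[OF three(4,10)] other_end_neq[OF three(5,11)]
      by (simp_all add: o_def)
    have ends: "ends e1 = {v, o1}" "ends e2 = {v, o2}" "ends e3 = {v, o3}"
      using three(3-5)[THEN ends_other] by (simp_all only: o_def)
    have \<sigma>: "?\<sigma>1 \<in> {1, -1}" "?\<sigma>2 \<in> {1, -1}" "?\<sigma>3 \<in> {1, -1}"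
      by (auto simp: gsign_def)
    have lifts: "o1 = o2 \<Longrightarrow> o1 \<notin> V0 \<and> ?\<sigma>1 \<noteq> ?\<sigma>2" "o1 = o3 \<Longrightarrow> o1 \<notin> V0 \<and> ?\<sigma>1 \<noteq> ?\<sigma>3"
      "o2 = o3 \<Longrightarrow> o2 \<notin> V0 \<and> ?\<sigma>2 \<noteq> ?\<sigma>3"
      using sparse_parallel[OF three(1), of e1 e2 v o1] sparse_parallel[OF three(1), of e1 e3 v o1]
        sparse_parallel[OF three(1), of e2 e3 v o2] three(2,6-8) ends o
      by (auto simp: gsign_def)
    have nv: "v \<notin> ends e" if "e \<in> F" for e
      using that three(12) by (auto simp: vset_def)
    then have disj: "?N \<inter> F = {}"
      using three(3-5) by auto
    have row: "symm_row x y e1 (a, b) = (x v - ?\<sigma>1 * x o1) * (a v - ?\<sigma>1 * a o1) + (y v - y o1) * (b v - b o1)"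
      "symm_row x y e2 (a, b) = (x v - ?\<sigma>2 * x o2) * (a v - ?\<sigma>2 * a o2) + (y v - y o2) * (b v - b o2)"
      "symm_row x y e3 (a, b) = (x v - ?\<sigma>3 * x o3) * (a v - ?\<sigma>3 * a o3) + (y v - y o3) * (b v - b o3)"
      for x y a b
      using three(3-5)[THEN symm_row_at] by (simp_all add: o_def)
    have rowf: "symm_row x y ?f (a, b) =
      (?\<sigma>1 * x o1 - ?\<sigma>2 * x o2) * (?\<sigma>1 * a o1 - ?\<sigma>2 * a o2) + (y o1 - y o2) * (b o1 - b o2)" for x y a b
      by (simp add: symm_row_def alp_def bet_def bypass_def gsign_def o_def algebra_simps)
    have dep: "\<omega> e1 * (X - ?\<sigma>1 * x o1) + \<omega> e2 * (X - ?\<sigma>2 * x o2) + \<omega> e3 * (X - ?\<sigma>3 * x o3) = 0"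
      "\<omega> e1 * (Y - y o1) + \<omega> e2 * (Y - y o2) + \<omega> e3 * (Y - y o3) = 0"
      if "\<And>m. m \<in> motions_at v \<Longrightarrow> (\<Sum>j\<in>?N. \<omega> j * symm_row (x(v := X)) (y(v := Y)) j m) = 0" for \<omega> x y X Y
      using that[OF motions_atI[of v 1 0]] that[OF motions_atI[of v 0 1]] three(2,6-8) o
      by (simp_all add: row)
    have sumN: "(\<Sum>j\<in>?N. h j) = h e1 + h e2 + h e3" for h :: "_ \<Rightarrow> real"
      using three(6-8) by simp
    show ?case
    proof (cases "{o1, o2, o3} \<subseteq> V0")
      case False
      let ?d = "\<lambda>x y. (?\<sigma>2 * x o2 - ?\<sigma>1 * x o1) * (y o1 - y o3) - (y o2 - y o1) * (?\<sigma>1 * x o1 - ?\<sigma>3 * x o3)"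
      have "polynomial_along ?d"
        by (intro polynomial_along_intros)
      then obtain x y where xy: "\<forall>u\<in>V0. x u = 0" "indep_on (insert ?f F) motions (symm_row x y)" "?d x y \<noteq> 0"
        using placement_avoiding[OF fin(2), of ?d] exists_noncollinear[OF \<sigma> lifts False] three(14) by blast
      \<comment> \<open>\<open>v\<close> is put on the segment between the neighbours as seen from
        it, so that \<open>e1\<close> and \<open>e2\<close> are parallel to the bypass.\<close>
      define X where "X = (?\<sigma>1 * x o1 + ?\<sigma>2 * x o2) / 2"
      define Y where "Y = (y o1 + y o2) / 2"
      let ?A = "symm_row (x(v := X)) (y(v := Y))"
      define \<kappa> where "\<kappa> e = (if e = e3 then 0 else 1 :: real)" for e
      have "indep_on (?N \<union> F) motions ?A"
      proof (rule indep_on_exchange[where M' = "motions_at v" and f = ?f and \<kappa> = \<kappa> and c = "1/2" and B = "symm_row x y ?f"])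
        show "finite ?N" "finite F" "?N \<inter> F = {}" "?f \<notin> F" "motions_at v \<subseteq> (motions :: ((_ \<Rightarrow> real) \<times> _) set)"
          using fin disj three(13) motions_at_subset by auto
        show "?A g m = 0" if "g \<in> F" "m \<in> motions_at v" for g m
          using symm_row_motions_at[OF nv[OF that(1)] that(2)] .
        have "indep_on (insert ?f F) motions (\<lambda>g m. if g = ?f then symm_row x y ?f m else ?A g m)
            = indep_on (insert ?f F) motions (symm_row x y)"
          using nv by (intro indep_on_cong) (auto simp: symm_row_upd)
        then show "indep_on (insert ?f F) motions (\<lambda>g m. if g = ?f then symm_row x y ?f m else ?A g m)"
          using xy by simp
      next
        fix \<omega> :: "_ \<Rightarrow> real" assume \<omega>: "\<And>m. m \<in> motions_at v \<Longrightarrow> (\<Sum>j\<in>?N. \<omega> j * ?A j m) = 0"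
        have "\<omega> e3 = 0 \<and> \<omega> e1 = \<omega> e2"
          using midpoint_dependence[OF dep[OF \<omega>, unfolded X_def Y_def] xy(3)] .
        then show "\<exists>r. \<forall>j\<in>?N. \<omega> j = r * \<kappa> j"
          by (intro exI[of _ "\<omega> e1"]) (auto simp: \<kappa>_def)
      next
        fix m :: "(_ \<Rightarrow> real) \<times> _" assume m: "m \<in> motions"
        obtain a b where ab: "m = (a, b)"
          by (cases m)
        \<comment> \<open>The edges of \<open>F\<close> do not see the motion of \<open>v\<close>,
          so it may be set to the mean of the neighbours; the rows of \<open>e1\<close> and
          \<open>e2\<close> then each contribute a quarter of the bypass row.\<close>
        let ?a = "a(v := (?\<sigma>1 * a o1 + ?\<sigma>2 * a o2) / 2)" and ?b = "b(v := (b o1 + b o2) / 2)"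
        have "(\<Sum>j\<in>?N. \<kappa> j * ?A j (?a, ?b)) = ?A e1 (?a, ?b) + ?A e2 (?a, ?b)"
          unfolding sumN using three(6-8) by (simp add: \<kappa>_def)
        also have "\<dots> = 1/2 * symm_row x y ?f m"
          unfolding ab row rowf using o by (simp add: X_def Y_def field_simps)
        finally have "(\<Sum>j\<in>?N. \<kappa> j * ?A j (?a, ?b)) = 1/2 * symm_row x y ?f m" .
        moreover have "(?a, ?b) \<in> motions"
          using m three(2) by (auto simp: motions_def ab)
        moreover have "?A g (?a, ?b) = ?A g m" if "g \<in> F" for g
          using symm_row_upd(2)[OF nv[OF that]] by (simp add: ab)
        ultimately show "\<exists>m'\<in>motions. (\<forall>g\<in>F. ?A g m' = ?A g m) \<and>
            (\<Sum>j\<in>?N. \<kappa> j * ?A j m') = 1/2 * symm_row x y ?f m"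
          by blast
      qed simp
      then show ?thesis
      proof -
        assume ind: "indep_on (?N \<union> F) motions ?A"
        have "\<forall>u\<in>V0. (x(v := X)) u = 0"
          using xy(1) three(2) by auto
        then show ?thesis
          using ind unfolding insert_is_Un[symmetric] Un_insert_left Un_empty_left by blast
      qed
    next
      case True
      then have distinct: "o1 \<noteq> o2" "o1 \<noteq> o3" "o2 \<noteq> o3"
        using lifts by auto
      let ?d = "\<lambda>x y :: 'v \<Rightarrow> real. (y o3 - y o2) * (y o3 - y o1) * (y o2 - y o1)"
      have "polynomial_along ?d"
        by (intro polynomial_along_intros)
      moreover have "\<exists>x y. (\<forall>u\<in>V0. x u = 0) \<and> ?d x y \<noteq> 0"
        using distinct
        by (intro exI[of _ "\<lambda>u. 0"] exI[of _ "\<lambda>u. if u = o1 then 0 else if u = o2 then 1 else 2"]) auto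
      ultimately obtain x y where xy: "\<forall>u\<in>V0. x u = 0" "indep_on (insert ?f F) motions (symm_row x y)" "?d x y \<noteq> 0"
        using placement_avoiding[OF fin(2), of ?d] three(14) by blast
      have x0: "x o1 = 0" "x o2 = 0" "x o3 = 0"
        using True xy(1) by auto
      \<comment> \<open>All neighbours lie on the axis, so the midpoint would be collinear with the
        third one. Instead \<open>v\<close> is moved off the axis at the height of
        \<open>o3\<close>; its three edges then span the plane.\<close>
      let ?A = "symm_row (x(v := 1)) (y(v := y o3))"
      define \<kappa> where "\<kappa> e = (if e = e1 then y o3 - y o2 else if e = e2 then y o1 - y o3 else y o2 - y o1)" for e
      \<comment> \<open>The combination \<open>\<kappa>\<close> of the rows leaves only the vertical
        relative motion of \<open>o1\<close> and \<open>o2\<close>, which is also what the bypass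
        sees along the axis; \<open>c\<close> is the ratio of the two factors.\<close>
      define c where "c = (y o3 - y o2) * (y o3 - y o1) / (y o2 - y o1)"
      have "indep_on (?N \<union> F) motions ?A"
      proof (rule indep_on_exchange[where M' = "motions_at v" and f = ?f and \<kappa> = \<kappa> and c = c and B = "symm_row x y ?f"])
        show "finite ?N" "finite F" "?N \<inter> F = {}" "?f \<notin> F" "motions_at v \<subseteq> (motions :: ((_ \<Rightarrow> real) \<times> _) set)"
          using fin disj three(13) motions_at_subset by auto
        show "?A g m = 0" if "g \<in> F" "m \<in> motions_at v" for g m
          using symm_row_motions_at[OF nv[OF that(1)] that(2)] .
        have "indep_on (insert ?f F) motions (\<lambda>g m. if g = ?f then symm_row x y ?f m else ?A g m)
            = indep_on (insert ?f F) motions (symm_row x y)"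
          using nv by (intro indep_on_cong) (auto simp: symm_row_upd)
        then show "indep_on (insert ?f F) motions (\<lambda>g m. if g = ?f then symm_row x y ?f m else ?A g m)"
          using xy by simp
        show "c \<noteq> 0"
          using xy(3) by (simp add: c_def)
      next
        fix \<omega> :: "_ \<Rightarrow> real" assume \<omega>: "\<And>m. m \<in> motions_at v \<Longrightarrow> (\<Sum>j\<in>?N. \<omega> j * ?A j m) = 0"
        have "\<omega> e1 + \<omega> e2 + \<omega> e3 = 0" "\<omega> e1 * (y o3 - y o1) + \<omega> e2 * (y o3 - y o2) = 0"
          using dep[OF \<omega>] x0 by simp_all
        then have \<omega>3: "\<omega> e3 = - \<omega> e1 - \<omega> e2" and \<omega>2: "\<omega> e2 * (y o3 - y o2) = - \<omega> e1 * (y o3 - y o1)"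
          by linarith+
        have nz: "y o3 - y o2 \<noteq> 0"
          using xy(3) by (metis mult_zero_left)
        define r where "r = \<omega> e1 / (y o3 - y o2)"
        have \<omega>1: "\<omega> e1 = r * (y o3 - y o2)"
          using nz by (simp add: r_def)
        moreover have "\<omega> e2 = r * (y o1 - y o3)"
        proof -
          have "(\<omega> e2 - r * (y o1 - y o3)) * (y o3 - y o2) = 0"
            using \<omega>2 unfolding \<omega>1 by (simp add: algebra_simps)
          then show ?thesis
            using nz by simp
        qed
        moreover from calculation have "\<omega> e3 = r * (y o2 - y o1)"
          using \<omega>3 by (simp add: algebra_simps)
        ultimately show "\<exists>r. \<forall>j\<in>?N. \<omega> j = r * \<kappa> j"
          using three(6-8) by (intro exI[of _ r]) (auto simp: \<kappa>_def)
      next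
        fix m :: "(_ \<Rightarrow> real) \<times> _" assume m: "m \<in> motions"
        obtain a b where ab: "m = (a, b)"
          by (cases m)
        have a0: "a o1 = 0" "a o2 = 0" "a o3 = 0"
          using True m by (auto simp: motions_def ab)
        have "(\<Sum>j\<in>?N. \<kappa> j * ?A j m) = (y o3 - y o2) * ?A e1 m + (y o1 - y o3) * ?A e2 m + (y o2 - y o1) * ?A e3 m"
          unfolding sumN using three(6-8) by (simp add: \<kappa>_def)
        also have "\<dots> = (y o3 - y o2) * (y o3 - y o1) * (b o2 - b o1)"
          unfolding ab row using o by (simp add: x0 a0 algebra_simps)
        also have "\<dots> = c * symm_row x y ?f m"
        proof -
          have "y o2 - y o1 \<noteq> 0"
            using xy(3) by (metis mult_zero_right)
          then have "(y o3 - y o2) * (y o3 - y o1) = c * (y o2 - y o1)"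
            by (simp add: c_def)
          then show ?thesis
            unfolding ab rowf by (simp add: x0 a0) (simp add: algebra_simps)
        qed
        finally show "\<exists>m'\<in>motions. (\<forall>g\<in>F. ?A g m' = ?A g m) \<and>
            (\<Sum>j\<in>?N. \<kappa> j * ?A j m') = c * symm_row x y ?f m"
          using m by blast
      qed
      then show ?thesis
      proof -
        assume ind: "indep_on (?N \<union> F) motions ?A"
        have "\<forall>u\<in>V0. (x(v := 1)) u = 0"
          using xy(1) three(2) by auto
        then show ?thesis
          using ind unfolding insert_is_Un[symmetric] Un_insert_left Un_empty_left by blast
      qed
    qed
  qed
qed

subsection \<open>Anti-symmetric placements\<close>

text \<open>Once 2 is subtracted for every set, the balanced bound weight + nfix - 3 is stronger
  only if there is no fixed vertex.\<close>

definition anti_sparse :: "'v gedge set \<Rightarrow> bool" where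
  "anti_sparse F \<longleftrightarrow> finite F \<and> (\<forall>H\<subseteq>F. H \<noteq> {} \<longrightarrow>
     int (card H) \<le> weight (vset H) - (if bal H \<and> nfix H = 0 then 3 else 2))"

text \<open>An anti-symmetric motion moves fixed vertices only perpendicularly to the
  mirror.\<close>

definition anti_motions :: "(('v \<Rightarrow> 'a::field) \<times> ('v \<Rightarrow> 'a)) set" where
  "anti_motions = {(a, b). \<forall>v\<in>V0. b v = 0}"

definition copy_edge :: "nat \<Rightarrow> 'v gedge \<Rightarrow> 'v gedge" where
  "copy_edge n e = GEdge (src e) (tgt e) (idgain e) n"

lemma copy_edge_simps [simp]:
  "ends (copy_edge n e) = ends e" "alp (copy_edge n e) = alp e" "bet (copy_edge n e) = bet e"
  by (auto simp: copy_edge_def ends_def alp_def bet_def gsign_def fun_eq_iff)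

text \<open>Replacing the copy by \<open>e\<close> changes neither the vertex set nor the potentials
  and loses at most one edge, so each bound weakens by exactly one.\<close>

lemma sparse_2_double_edge:
  assumes F: "anti_sparse F" and e: "e \<in> F" and n: "\<And>f. f \<in> F \<Longrightarrow> tag f \<noteq> n"
  shows "sparse 2 (insert (copy_edge n e) F)"
  unfolding sparse_def
proof (intro conjI allI impI)
  show "finite (insert (copy_edge n e) F)"
    using F by (simp add: anti_sparse_def)
next
  let ?e = "copy_edge n e"
  fix H assume H: "H \<subseteq> insert ?e F" "H \<noteq> {}"
  define H0 where "H0 = (if ?e \<in> H then insert e (H - {?e}) else H)"
  have finH: "finite H"
    using H F finite_subset[of H "insert ?e F"] by (auto simp: anti_sparse_def)
  have "H0 \<subseteq> F" "H0 \<noteq> {}"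
    using H e by (auto simp: H0_def)
  then have "int (card H0) \<le> weight (vset H0) - (if bal H0 \<and> nfix H0 = 0 then 3 else 2)"
    using F by (simp add: anti_sparse_def)
  moreover have vs: "vset H0 = vset H"
  proof (cases "?e \<in> H")
    case True
    then have "vset H = ends ?e \<union> vset (H - {?e})"
      by (metis insert_Diff vset_insert)
    then show ?thesis
      using True by (simp add: H0_def)
  qed (simp add: H0_def)
  moreover have "potential s H = potential s H0" for s
  proof -
    have ins: "potential s (insert f X) \<longleftrightarrow>
      (src f \<notin> V0 \<and> tgt f \<notin> V0 \<longrightarrow> (s (src f) = s (tgt f)) = idgain f) \<and> potential s X" for f X
      unfolding potential_def by blast
    show ?thesis
    proof (cases "?e \<in> H")
      case True
      then have "potential s H = potential s (insert ?e (H - {?e}))"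
        by (simp add: insert_absorb)
      also have "\<dots> = potential s (insert e (H - {?e}))"
        unfolding ins by (simp add: copy_edge_def)
      finally show ?thesis
        using True by (simp add: H0_def)
    qed (simp add: H0_def)
  qed
  then have "bal H0 = bal H"
    by (simp add: bal_def)
  moreover have "card H \<le> card H0 + 1"
  proof (cases "?e \<in> H")
    case True
    have "card (H - {?e}) \<le> card H0"
      using True finH by (intro card_mono) (auto simp: H0_def)
    then show ?thesis
      using card_Suc_Diff1[OF finH True] by linarith
  qed (simp add: H0_def)
  ultimately show "int (card H) \<le> weight (vset H) - corank 2 H"
    by (auto simp: corank_def nfix_def split: if_splits)
qed

text \<open>
  The rows for generic slopes remain independent if any edge is doubled, so their common kernel contains a placement
  that is not annihilated by both \<open>\<alpha>\<^sub>e\<close> and \<open>\<beta>\<^sub>e\<close> for any edge \<open>e\<close>; at such a placement the anti-symmetric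
  rigidity rows are nonzero multiples of the slope rows.
\<close>

lemma anti_sparse_placement:
  assumes F: "anti_sparse F"
  shows "\<exists>x y :: 'v \<Rightarrow> real. (\<forall>u\<in>V0. x u = 0) \<and> indep_on F anti_motions (anti_row x y)"
proof (cases "F = {}")
  case True
  then show ?thesis by (intro exI[of _ "\<lambda>_. 0"]) simp
next
  case False
  have fin: "finite F"
    using F by (simp add: anti_sparse_def)
  obtain n where n: "\<And>e. e \<in> F \<Longrightarrow> tag e \<noteq> n"
    using fresh_tag[OF fin] by metis
  have nF: "copy_edge n e \<notin> F" for e
    using n[of "copy_edge n e"] by (auto simp: copy_edge_def)
  \<comment> \<open>Only the slopes on \<open>F\<close> are common to all \<open>e\<close>; each
    copy may have slopes \<open>s0\<close>, \<open>t0\<close> of its own.\<close>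
  define P where "P e s t \<longleftrightarrow> (\<exists>s0 t0. indep_on (insert (copy_edge n e) F) motions
    (slope_row (s(copy_edge n e := s0)) (t(copy_edge n e := t0)) :: _ \<Rightarrow> _ \<Rightarrow> real))" for e s t
  have "\<exists>s t. (s, t) \<in> UNIV \<and> (\<forall>e\<in>F. P e s t)"
  proof (rule line_open_common[OF fin])
    fix e assume e: "e \<in> F"
    show "line_open (P e)"
      unfolding line_open_def
    proof (intro allI impI)
      fix s t s' t' assume "P e s t"
      then obtain s0 t0 where ind: "indep_on (insert (copy_edge n e) F) motions
        (slope_row (s(copy_edge n e := s0)) (t(copy_edge n e := t0)) :: _ \<Rightarrow> _ \<Rightarrow> real)"
        by (auto simp: P_def)
      have "line_open (\<lambda>s t. indep_on (insert (copy_edge n e) F) motions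
        (slope_row (s(copy_edge n e := s0)) (t(copy_edge n e := t0)) :: _ \<Rightarrow> _ \<Rightarrow> real))"
        using fin by (intro line_open_indep_on) (auto simp: slope_row_def segment_pt_def algebra_simps)
      then have "finite {r. \<not> indep_on (insert (copy_edge n e) F) motions
        (slope_row ((segment_pt s s' r)(copy_edge n e := s0)) ((segment_pt t t' r)(copy_edge n e := t0)) :: _ \<Rightarrow> _ \<Rightarrow> real)}"
        using ind unfolding line_open_def by blast
      then show "finite {r. \<not> P e (segment_pt s s' r) (segment_pt t t' r)}"
        by (rule finite_subset[rotated]) (auto simp: P_def)
    qed
    obtain s t where "indep_on (insert (copy_edge n e) F) motions (slope_row s t :: _ \<Rightarrow> _ \<Rightarrow> real)"
      using sparse_2_slopes[OF sparse_2_double_edge[OF F e n]] by blast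
    then have "P e s t"
      unfolding P_def by (intro exI[of _ "s (copy_edge n e)"] exI[of _ "t (copy_edge n e)"]) simp
    then show "\<exists>s t. (s, t) \<in> UNIV \<and> P e s t"
      by blast
  qed auto
  then obtain s t where P: "\<And>e. e \<in> F \<Longrightarrow> P e s t"
    by blast
  let ?K = "{(x, y). (\<forall>u\<in>V0. x u = 0) \<and> (\<forall>f\<in>F. slope_row s t f (x, y) = 0)} :: (('v \<Rightarrow> real) \<times> _) set"
  \<comment> \<open>Over the reals a single polynomial expresses that the two values are not both
    zero.\<close>
  let ?Q = "\<lambda>e x y. alp e x * alp e x + bet e y * bet e y \<noteq> (0 :: real)"
  have "\<exists>x y. (x, y) \<in> ?K \<and> (\<forall>e\<in>F. ?Q e x y)"
  proof (rule line_open_common[OF fin])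
    fix e assume e: "e \<in> F"
    have "polynomial_along (\<lambda>x y. alp e x * alp e x + bet e y * bet e y)"
      unfolding alp_def bet_def by (intro polynomial_along_intros)
    then show "line_open (?Q e)"
      unfolding polynomial_along_def by (intro line_open_poly) blast
    obtain s0 t0 where ind: "indep_on (insert (copy_edge n e) F) motions
        (slope_row (s(copy_edge n e := s0)) (t(copy_edge n e := t0)) :: _ \<Rightarrow> _ \<Rightarrow> real)"
      using P[OF e] by (auto simp: P_def)
    \<comment> \<open>The vector dual to the row of the copy is killed by all rows of
      \<open>F\<close>, and \<open>alp e\<close> and \<open>bet e\<close> cannot both vanish on
      it.\<close>
    obtain z where z: "z \<in> motions" "slope_row (s(copy_edge n e := s0)) (t(copy_edge n e := t0)) (copy_edge n e) z = (1 :: real)"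
      "\<And>k. k \<in> insert (copy_edge n e) F \<Longrightarrow> k \<noteq> copy_edge n e \<Longrightarrow>
        slope_row (s(copy_edge n e := s0)) (t(copy_edge n e := t0)) k z = 0"
    proof (rule indep_on_dual[OF _ ind insertI1,
          where lc = "\<lambda>z c z'. (\<lambda>v. fst z v + c * fst z' v, \<lambda>v. snd z v + c * snd z' v)"])
    qed (use fin in \<open>auto simp: motions_def slope_row_def alp_def bet_def algebra_simps\<close>)
    obtain x y where xy: "z = (x, y)"
      by (cases z)
    have "slope_row s t f (x, y) = 0" if "f \<in> F" for f
    proof -
      have "f \<noteq> copy_edge n e"
        using nF that by blast
      then show ?thesis
        using z(3)[of f] that by (simp add: slope_row_def xy)
    qed
    moreover have "?Q e x y"
    proof
      assume "alp e x * alp e x + bet e y * bet e y = 0"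
      then have "alp e x = 0" "bet e y = 0"
        by (simp_all add: sum_squares_eq_zero_iff)
      then show False
        using z(2) by (simp add: slope_row_def xy)
    qed
    ultimately show "\<exists>x y. (x, y) \<in> ?K \<and> ?Q e x y"
      using z(1) by (auto simp: motions_def xy)
  next
    show "?K \<noteq> {}"
      by (intro ex_in_conv[THEN iffD1] exI[of _ "(\<lambda>_. 0, \<lambda>_. 0)"]) (simp add: slope_row_def)
  next
    fix x y x' y' r assume "(x, y) \<in> ?K" "(x', y') \<in> ?K"
    show "(segment_pt x x' r, segment_pt y y' r) \<in> ?K"
    proof (intro CollectI case_prodI conjI ballI)
      fix u assume "u \<in> V0"
      then show "segment_pt x x' r u = 0"
        using \<open>(x, y) \<in> ?K\<close> \<open>(x', y') \<in> ?K\<close> by (simp add: segment_pt_def)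
    next
      fix f assume "f \<in> F"
      then have "slope_row s t f (x, y) = 0" "slope_row s t f (x', y') = 0"
        using \<open>(x, y) \<in> ?K\<close> \<open>(x', y') \<in> ?K\<close> by simp_all
      moreover have "slope_row s t f (segment_pt x x' r, segment_pt y y' r) =
        slope_row s t f (x, y) + r * (slope_row s t f (x', y') - slope_row s t f (x, y))"
        by (simp add: slope_row_def alp_segment bet_segment algebra_simps)
      ultimately show "slope_row s t f (segment_pt x x' r, segment_pt y y' r) = 0"
        by simp
    qed
  qed
  then obtain x y where K: "(x, y) \<in> ?K" and Q: "\<forall>e\<in>F. ?Q e x y"
    by (elim exE conjE)
  have xy: "u \<in> V0 \<Longrightarrow> x u = 0" "f \<in> F \<Longrightarrow> s f * alp f x + t f * bet f y = 0" "f \<in> F \<Longrightarrow> ?Q f x y" for u f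
    using K Q by (simp_all add: slope_row_def)
  obtain e0 where e0: "e0 \<in> F"
    using False by blast
  have ind: "indep_on F motions (slope_row s t :: _ \<Rightarrow> _ \<Rightarrow> real)"
  proof (rule indep_onI)
    obtain s0 t0 where ind: "indep_on (insert (copy_edge n e0) F) motions
        (slope_row (s(copy_edge n e0 := s0)) (t(copy_edge n e0 := t0)) :: _ \<Rightarrow> _ \<Rightarrow> real)"
      using P[OF e0] by (auto simp: P_def)
    fix \<omega> :: "_ \<Rightarrow> real" and j
    assume \<omega>: "\<And>m. m \<in> motions \<Longrightarrow> (\<Sum>j\<in>F. \<omega> j * slope_row s t j m) = 0" and j: "j \<in> F"
    define \<omega>' where "\<omega>' f = (if f = copy_edge n e0 then 0 else \<omega> f)" for f
    let ?R = "slope_row (s(copy_edge n e0 := s0)) (t(copy_edge n e0 := t0))"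
    have "\<omega>' j = 0"
    proof (rule indep_onD[OF ind, of \<omega>'])
      fix m :: "('v \<Rightarrow> real) \<times> _" assume "m \<in> motions"
      have "\<omega>' f * ?R f m = \<omega> f * slope_row s t f m" if "f \<in> F" for f
      proof -
        have "f \<noteq> copy_edge n e0"
          using nF[of e0] that by blast
        then show ?thesis
          by (simp add: slope_row_def \<omega>'_def)
      qed
      then have "(\<Sum>f\<in>F. \<omega>' f * ?R f m) = 0"
        using \<omega>[OF \<open>m \<in> motions\<close>] by (simp cong: sum.cong)
      then show "(\<Sum>f\<in>insert (copy_edge n e0) F. \<omega>' f * ?R f m) = 0"
        unfolding sum.insert[OF fin nF] by (simp add: \<omega>'_def)
    qed (use j in simp)
    then show "\<omega> j = 0"
      using j nF by (auto simp: \<omega>'_def split: if_splits)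
  qed
  \<comment> \<open>In the plane, the nonzero vector (s e, t e) is orthogonal to the nonzero vector
    (alp e x, bet e y), hence a nonzero multiple of the latter rotated by a right angle.\<close>
  have "\<exists>r. r \<noteq> 0 \<and> s e = r * bet e y \<and> t e = - r * alp e x" if e: "e \<in> F" for e
  proof -
    have st: "s e \<noteq> 0 \<or> t e \<noteq> 0"
      using indep_on_nonzero[OF fin ind e] by (auto simp: slope_row_def)
    show ?thesis
    proof (cases "bet e y = 0")
      case True
      then have "alp e x \<noteq> 0"
        using xy(3)[OF e] by auto
      then show ?thesis
        using xy(2)[OF e] st True by (intro exI[of _ "- t e / alp e x"]) auto
    next
      case False
      then have t: "t e = - s e * alp e x / bet e y"
        using xy(2)[OF e] by (simp add: field_simps eq_neg_iff_add_eq_0)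
      then have "s e \<noteq> 0"
        using st by auto
      then show ?thesis
        using False t by (intro exI[of _ "s e / bet e y"]) auto
    qed
  qed
  then obtain r where r: "\<And>e. e \<in> F \<Longrightarrow> r e \<noteq> 0 \<and> s e = r e * bet e y \<and> t e = - r e * alp e x"
    by metis
  \<comment> \<open>The rotation introduces one minus sign, absorbed by negating \<open>x\<close>,
    and pairs the functionals crosswise, absorbed by exchanging the components of the motion. The
    exchange also turns \<open>motions\<close> into \<open>anti_motions\<close>.\<close>
  have row: "anti_row (\<lambda>v. - x v) y e (a, b) = slope_row s t e (b, a) / r e" if "e \<in> F" for e a b
  proof -
    have "alp e (\<lambda>v. - x v) = - alp e x"
      by (simp add: alp_def)
    then show ?thesis
      using r[OF that] by (simp add: anti_row_def slope_row_def field_simps)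
  qed
  have "indep_on F anti_motions (anti_row (\<lambda>v. - x v) y)"
  proof (rule indep_onI)
    fix \<omega> :: "_ \<Rightarrow> real" and j
    assume \<omega>: "\<And>m. m \<in> anti_motions \<Longrightarrow> (\<Sum>j\<in>F. \<omega> j * anti_row (\<lambda>v. - x v) y j m) = 0" and j: "j \<in> F"
    have "\<omega> j / r j = 0"
    proof (rule indep_onD[OF ind _ j])
      fix m :: "('v \<Rightarrow> real) \<times> _" assume "m \<in> motions"
      then have "(snd m, fst m) \<in> anti_motions"
        by (auto simp: motions_def anti_motions_def)
      then have "0 = (\<Sum>j\<in>F. \<omega> j * anti_row (\<lambda>v. - x v) y j (snd m, fst m))"
        using \<omega> by simp
      also have "\<dots> = (\<Sum>j\<in>F. \<omega> j / r j * slope_row s t j m)"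
        using row by (intro sum.cong) auto
      finally show "(\<Sum>j\<in>F. \<omega> j / r j * slope_row s t j m) = 0"
        by simp
    qed
    then show "\<omega> j = 0"
      using r[OF j] by simp
  qed
  then show ?thesis
    using xy(1) by (intro exI[of _ "\<lambda>v. - x v"] exI[of _ y]) auto
qed

end

section \<open>From gain graphs to signed edges\<close>

definition gsg :: "('g, 'b) monoid_scheme \<Rightarrow> 'g \<Rightarrow> 'a::ring_1" where
  "gsg \<Gamma> g = (if g = \<one>\<^bsub>\<Gamma>\<^esub> then 1 else - 1)"

lemma of_real_gsg [simp]: "of_real (gsg \<Gamma> g) = gsg \<Gamma> g"
  by (simp add: gsg_def)

text \<open>\<open>\<gamma>\<close> names the reflecting element; \<open>label\<close> becomes the
  tag of an edge and makes \<open>arc_edge\<close> injective.\<close>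

locale reflection_gain_graph = group \<Gamma> + mirror V0
  for \<Gamma> :: "('g, 'b) monoid_scheme" (structure) and V0 :: "'v set" +
  fixes G :: "('v, 'e) pre_digraph" and \<psi> :: "'e \<Rightarrow> 'g" and \<tau> :: "'g \<Rightarrow> real^2^2"
    and \<gamma> :: 'g and label :: "'e \<Rightarrow> nat"
  assumes carrier_\<Gamma>: "carrier \<Gamma> = {\<one>\<^bsub>\<Gamma>\<^esub>, \<gamma>}" and \<gamma>: "\<gamma> \<noteq> \<one>\<^bsub>\<Gamma>\<^esub>"
    and \<tau>_one: "\<tau> \<one>\<^bsub>\<Gamma>\<^esub> = mat 1" and \<tau>_\<gamma>: "\<tau> \<gamma> = reflection_y"
    and fin_G: "fin_digraph G" and V0_subset: "V0 \<subseteq> verts G"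
    and \<psi>_carrier: "\<And>e. e \<in> arcs G \<Longrightarrow> \<psi> e \<in> carrier \<Gamma>"
    and inj_label: "inj_on label (arcs G)"
begin

lemma finite_G: "finite (verts G)" "finite (arcs G)"
  and in_verts: "e \<in> arcs G \<Longrightarrow> tail G e \<in> verts G" "e \<in> arcs G \<Longrightarrow> head G e \<in> verts G"
  using fin_G by (auto simp: fin_digraph.finite_verts fin_digraph.finite_arcs
      fin_digraph_def wf_digraph.tail_in_verts wf_digraph.head_in_verts)

lemma \<gamma>_square: "\<gamma> \<otimes> \<gamma> = \<one>"
proof -
  have "\<gamma> \<otimes> \<gamma> \<noteq> \<gamma>"
    using \<gamma> carrier_\<Gamma> by (metis insertCI r_cancel_one)
  moreover have "\<gamma> \<otimes> \<gamma> \<in> carrier \<Gamma>"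
    using carrier_\<Gamma> by (metis insertCI m_closed)
  ultimately show ?thesis
    using carrier_\<Gamma> by blast
qed

lemma gsg_mult: "g \<in> carrier \<Gamma> \<Longrightarrow> h \<in> carrier \<Gamma> \<Longrightarrow> gsg \<Gamma> (g \<otimes> h) = gsg \<Gamma> g * gsg \<Gamma> h"
  using carrier_\<Gamma> \<gamma> \<gamma>_square by (auto simp: gsg_def)

lemma gsg_square [simp]: "gsg \<Gamma> g * gsg \<Gamma> g = 1" "gsg \<Gamma> g * (gsg \<Gamma> g * c) = c"
  by (auto simp: gsg_def)

lemma gsg_one [simp]: "gsg \<Gamma> \<one> = 1"
  by (simp add: gsg_def)

lemma one_iff_mult: "g \<in> carrier \<Gamma> \<Longrightarrow> h \<in> carrier \<Gamma> \<Longrightarrow> (g \<otimes> h = \<one>) = ((g = \<one>) = (h = \<one>))"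
  using carrier_\<Gamma> \<gamma> \<gamma>_square by auto

lemma inv_carrier: "g \<in> carrier \<Gamma> \<Longrightarrow> inv g = g"
  using carrier_\<Gamma> \<gamma>_square inv_equality by auto

definition arc_edge :: "'e \<Rightarrow> 'v gedge" where
  "arc_edge e = GEdge (tail G e) (head G e) (\<psi> e = \<one>) (label e)"

lemma arc_edge_simps [simp]: "src (arc_edge e) = tail G e" "tgt (arc_edge e) = head G e"
  "idgain (arc_edge e) = (\<psi> e = \<one>)" "gsign (arc_edge e) = gsg \<Gamma> (\<psi> e)"
  by (simp_all add: arc_edge_def gsign_def gsg_def)

lemma inj_arc_edge: "inj_on arc_edge (arcs G)"
  using inj_label by (auto simp: inj_on_def arc_edge_def)

text \<open>Telescoping: the gain of a walk among free vertices is the change of the potential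
  between its ends. Elements of the group are their own inverses, so the direction of a step is
  irrelevant.\<close>

lemma potential_walk:
  assumes pot: "potential s (arc_edge ` A)" and A: "A \<subseteq> arcs G"
    and H: "tail H = tail G" "head H = head G" "arcs H = {e \<in> A. tail G e \<notin> V0 \<and> head G e \<notin> V0}"
  shows "gain_walk H u ss v \<Longrightarrow>
    walk_gain \<Gamma> \<psi> ss \<in> carrier \<Gamma> \<and> (walk_gain \<Gamma> \<psi> ss = \<one>) = (s u = s v)"
proof (induction ss arbitrary: u)
  case Nil
  then show ?case by simp
next
  case (Cons st ss)
  obtain e b where st: "st = (e, b)"
    by (cases st)
  have e: "e \<in> A" "tail G e \<notin> V0" "head G e \<notin> V0"
    using Cons.prems H(3) st by auto
  then have \<psi>: "\<psi> e \<in> carrier \<Gamma>"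
    using \<psi>_carrier A by auto
  have IH: "walk_gain \<Gamma> \<psi> ss \<in> carrier \<Gamma>" "(walk_gain \<Gamma> \<psi> ss = \<one>) = (s (step_to H st) = s v)"
    using Cons by auto
  have "(s (tail G e) = s (head G e)) = (\<psi> e = \<one>)"
    using pot e by (auto simp: potential_def)
  moreover have "step_gain \<Gamma> \<psi> st = \<psi> e"
    using inv_carrier[OF \<psi>] by (simp add: st)
  moreover have "u = step_from H st"
    using Cons.prems by simp
  ultimately have "(step_gain \<Gamma> \<psi> st = \<one>) = (s u = s (step_to H st))"
    by (cases b) (auto simp: st H)
  then show ?case
    using IH \<psi> \<open>step_gain \<Gamma> \<psi> st = \<psi> e\<close> one_iff_mult[of "\<psi> e" "walk_gain \<Gamma> \<psi> ss"]
    by (cases "s u"; cases "s (step_to H st)"; cases "s v"; simp)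
qed

definition arc_subgraph :: "'e set \<Rightarrow> ('v, 'e) pre_digraph" where
  "arc_subgraph A = \<lparr>verts = vset (arc_edge ` A), arcs = A, tail = tail G, head = head G\<rparr>"

lemma arc_subgraph_simps [simp]: "verts (arc_subgraph A) = vset (arc_edge ` A)" "arcs (arc_subgraph A) = A"
  "tail (arc_subgraph A) = tail G" "head (arc_subgraph A) = head G"
  by (simp_all add: arc_subgraph_def)

lemma vset_arc_edge: "vset (arc_edge ` A) = (\<Union>e\<in>A. {tail G e, head G e})"
  by (simp add: vset_def ends_def)

lemma subgraph_arc_subgraph: "A \<subseteq> arcs G \<Longrightarrow> subgraph (arc_subgraph A) G"
  using fin_G in_verts
  by (auto simp: subgraph_def compatible_def wf_digraph_def fin_digraph_def vset_arc_edge)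

lemma balanced_arc_subgraph:
  assumes "A \<subseteq> arcs G" "bal (arc_edge ` A)"
  shows "balanced \<Gamma> V0 \<psi> (arc_subgraph A)"
  unfolding balanced_def
proof (intro allI impI)
  let ?H = "arc_subgraph A \<restriction> (verts (arc_subgraph A) - V0)"
  fix ss assume "gain_cycle ?H ss"
  then obtain u where u: "gain_walk ?H u ss u"
    by (auto simp: gain_cycle_def)
  obtain s where s: "potential s (arc_edge ` A)"
    using assms by (auto simp: bal_def)
  have "arcs ?H = {e \<in> A. tail G e \<notin> V0 \<and> head G e \<notin> V0}"
    by (auto simp: induce_subgraph_def vset_arc_edge)
  then show "walk_gain \<Gamma> \<psi> ss = \<one>"
    using potential_walk[OF s assms(1) _ _ _ u] by (simp add: induce_subgraph_def)
qed

text \<open>The balanced bound counts every vertex twice whereas \<open>weight\<close> counts fixed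
  ones once; \<open>nfix\<close> is the difference.\<close>

lemma gain_sparse_counts:
  assumes "gain_sparse 1 l \<Gamma> G V0 \<psi>" "H \<subseteq> arc_edge ` arcs G" "H \<noteq> {}"
  shows "int (card H) \<le> weight (vset H) - int l"
    and "bal H \<Longrightarrow> int (card H) \<le> weight (vset H) + int (nfix H) - 3"
proof -
  obtain A where A: "A \<subseteq> arcs G" "H = arc_edge ` A"
    using assms(2) by (auto simp: subset_image_iff)
  have fin: "finite A" "finite (vset H)"
    using A finite_G finite_subset[OF A(1)] by auto
  have cardH: "card H = card A"
    unfolding A(2) using inj_arc_edge A(1) by (intro card_image) (auto simp: inj_on_def)
  have ne: "arcs (arc_subgraph A) \<noteq> {}"
    using A assms by auto
  have w: "weight (vset H) = 2 * int (card (vset H - V0)) + int (card (vset H \<inter> V0))"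
    using weight_split[OF fin(2)] .
  have "card (vset H) = card (vset H - V0) + card (vset H \<inter> V0)"
    using fin(2) by (subst card_Un_disjoint[symmetric]) (auto intro: arg_cong[where f = card])
  then have cw: "2 * int (card (vset H)) = weight (vset H) + int (nfix H)"
    using w by (simp add: nfix_def)
  show "int (card H) \<le> weight (vset H) - int l"
  proof -
    have "int (card (arcs (arc_subgraph A))) \<le> 2 * int (card (verts (arc_subgraph A) - V0)) +
        int 1 * int (card (verts (arc_subgraph A) \<inter> V0)) - int l"
      using assms(1) subgraph_arc_subgraph[OF A(1)] ne unfolding gain_sparse_def by blast
    then show ?thesis
      unfolding arc_subgraph_simps A(2)[symmetric] using w cardH by linarith
  qed
  assume "bal H"
  then have "balanced \<Gamma> V0 \<psi> (arc_subgraph A)"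
    using balanced_arc_subgraph A by simp
  then have "int (card (arcs (arc_subgraph A))) \<le> 2 * int (card (verts (arc_subgraph A))) - 3"
    using assms(1) subgraph_arc_subgraph[OF A(1)] ne unfolding gain_sparse_def by blast
  then show "int (card H) \<le> weight (vset H) + int (nfix H) - 3"
    unfolding arc_subgraph_simps A(2)[symmetric] using cw cardH by linarith
qed

lemma sparse_3_arc_edges:
  assumes "gain_sparse 1 1 \<Gamma> G V0 \<psi>"
  shows "sparse 3 (arc_edge ` arcs G)"
  unfolding sparse_def
proof (intro conjI allI impI)
  fix H assume "H \<subseteq> arc_edge ` arcs G" "H \<noteq> {}"
  note c = gain_sparse_counts[OF assms this]
  show "int (card H) \<le> weight (vset H) - corank 3 H"
    using c by (cases "bal H") (auto simp: corank_def)
qed (simp add: finite_G)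

lemma anti_sparse_arc_edges:
  assumes "gain_sparse 1 2 \<Gamma> G V0 \<psi>"
  shows "anti_sparse (arc_edge ` arcs G)"
  unfolding anti_sparse_def
proof (intro conjI allI impI)
  fix H assume "H \<subseteq> arc_edge ` arcs G" "H \<noteq> {}"
  note c = gain_sparse_counts[OF assms this]
  show "int (card H) \<le> weight (vset H) - (if bal H \<and> nfix H = 0 then 3 else 2)"
    using c by (cases "bal H") auto
qed (simp add: finite_G)

section \<open>Lifting motions to the covering graph\<close>

definition row :: "nat \<Rightarrow> ('v \<Rightarrow> 'a) \<Rightarrow> ('v \<Rightarrow> 'a) \<Rightarrow> 'v gedge \<Rightarrow> ('v \<Rightarrow> 'a) \<times> ('v \<Rightarrow> 'a) \<Rightarrow> 'a::field" where
  "row j = (if j = 0 then symm_row else anti_row)"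

definition jmotions :: "nat \<Rightarrow> (('v \<Rightarrow> 'a::field) \<times> ('v \<Rightarrow> 'a)) set" where
  "jmotions j = (if j = 0 then motions else anti_motions)"

text \<open>Spreads values on the vertices of \<open>G\<close> over their orbits: the character
  contributes \<open>gsg \<Gamma> g ^ j\<close> to both components, and the reflection one more sign
  to the first.\<close>

fun lift :: "nat \<Rightarrow> ('v \<Rightarrow> complex) \<times> ('v \<Rightarrow> complex) \<Rightarrow> ('g, 'v) cov_vertex \<Rightarrow> complex^2" where
  "lift j m (Fixed v) = (if v \<in> V0 then vector [fst m v, snd m v] else 0)"
| "lift j m (Free g v) = (if g \<in> carrier \<Gamma> \<and> v \<in> verts G - V0
     then vector [gsg \<Gamma> g ^ (j + 1) * fst m v, gsg \<Gamma> g ^ j * snd m v] else 0)"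

abbreviation "CV \<equiv> cov_verts \<Gamma> G V0"
abbreviation "CE \<equiv> cov_edges \<Gamma> G V0 \<psi>"
abbreviation "VR \<equiv> V_rho \<Gamma> G V0 \<tau>"
abbreviation "WR \<equiv> W_rho \<Gamma> G V0 \<psi>"
abbreviation "RM p \<equiv> rigidity_map CE (cov_placement \<tau> p)"
abbreviation "cedge h e \<equiv> {cov_lift V0 h (tail G e), cov_lift V0 (h \<otimes> \<psi> e) (head G e)}"

lemma finite_cov: "finite CV" "finite CE"
proof -
  have "CV = Fixed ` V0 \<union> (\<lambda>(g, v). Free g v) ` (carrier \<Gamma> \<times> (verts G - V0))"
    by (auto simp: cov_verts_def)
  then show "finite CV"
    using finite_G V0_subset carrier_\<Gamma> finite_subset[of V0] by auto
  have "CE = (\<lambda>(h, e). cedge h e) ` (carrier \<Gamma> \<times> arcs G)"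
    by (auto simp: cov_edges_def)
  then show "finite CE"
    using finite_G carrier_\<Gamma> by simp
qed

lemma vec2_eq_iff: "x = y \<longleftrightarrow> x $ 1 = y $ 1 \<and> x $ 2 = y $ 2" for x y :: "'a^2"
  by (simp add: vec_eq_iff forall_2)

lemma \<tau>_apply:
  assumes "g \<in> carrier \<Gamma>"
  shows "(\<tau> g *v x) $ 1 = gsg \<Gamma> g * x $ 1" "(\<tau> g *v x) $ 2 = x $ 2"
    "(cmat_of (\<tau> g) *v z) $ 1 = gsg \<Gamma> g * z $ 1" "(cmat_of (\<tau> g) *v z) $ 2 = z $ 2"
proof -
  have "g = \<one> \<or> g = \<gamma>"
    using assms carrier_\<Gamma> by auto
  then have "(\<tau> g *v x) $ 1 = gsg \<Gamma> g * x $ 1 \<and> (\<tau> g *v x) $ 2 = x $ 2 \<and>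
    (cmat_of (\<tau> g) *v z) $ 1 = gsg \<Gamma> g * z $ 1 \<and> (cmat_of (\<tau> g) *v z) $ 2 = z $ 2"
    using \<gamma> by (auto simp: \<tau>_one \<tau>_\<gamma> reflection_y_def matrix_vector_mult_def sum_2 cmat_of_def
        map_matrix_def mat_def gsg_def)
  then show "(\<tau> g *v x) $ 1 = gsg \<Gamma> g * x $ 1" "(\<tau> g *v x) $ 2 = x $ 2"
    "(cmat_of (\<tau> g) *v z) $ 1 = gsg \<Gamma> g * z $ 1" "(cmat_of (\<tau> g) *v z) $ 2 = z $ 2"
    by auto
qed

lemma cnj_rho: "cnj (rho \<Gamma> j g) = gsg \<Gamma> g ^ j"
  by (simp add: rho_def gsg_def)

lemma rho_action:
  assumes "g \<in> carrier \<Gamma>"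
  shows "cnj (rho \<Gamma> j g) *s (cmat_of (\<tau> g) *v z) = vector [gsg \<Gamma> g ^ (j + 1) * z $ 1, gsg \<Gamma> g ^ j * z $ 2]"
  using \<tau>_apply[OF assms] by (simp add: vec2_eq_iff cnj_rho mult.assoc mult.left_commute)

lemma cov_act_verts: "g \<in> carrier \<Gamma> \<Longrightarrow> x \<in> CV \<Longrightarrow> cov_act \<Gamma> g x \<in> CV"
  by (auto simp: cov_verts_def)

lemma cov_act_cov_lift: "cov_act \<Gamma> g (cov_lift V0 h v) = cov_lift V0 (g \<otimes> h) v"
  by (simp add: cov_lift_def)

lemma cov_lift_verts: "g \<in> carrier \<Gamma> \<Longrightarrow> v \<in> verts G \<Longrightarrow> cov_lift V0 g v \<in> CV"
  by (auto simp: cov_lift_def cov_verts_def)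

lemma lift_displacement: "lift j m \<in> displacements CV"
proof -
  have "lift j m x = 0" if "x \<notin> CV" for x
    using that by (cases x) (auto simp: cov_verts_def)
  then show ?thesis
    by (simp add: displacements_def)
qed

lemma lift_VR:
  assumes "j < 2" "m \<in> jmotions j"
  shows "lift j m \<in> VR j"
  unfolding V_rho_def
proof (intro CollectI conjI lift_displacement ballI)
  fix g x assume g: "g \<in> carrier \<Gamma>" and x: "x \<in> CV"
  have j: "j = 0 \<or> j = 1"
    using assms by auto
  show "lift j m (cov_act \<Gamma> g x) = cnj (rho \<Gamma> j g) *s (cmat_of (\<tau> g) *v lift j m x)"
    unfolding rho_action[OF g]
  proof (cases x)
    case (Fixed v)
    then have "v \<in> V0"
      using x by (auto simp: cov_verts_def)
    then show "lift j m (cov_act \<Gamma> g x) =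
      vector [gsg \<Gamma> g ^ (j + 1) * lift j m x $ 1, gsg \<Gamma> g ^ j * lift j m x $ 2]"
      using Fixed j assms(2) by (auto simp: vec2_eq_iff jmotions_def motions_def anti_motions_def)
  next
    case (Free h v)
    then have "h \<in> carrier \<Gamma>" "v \<in> verts G - V0"
      using x by (auto simp: cov_verts_def)
    then show "lift j m (cov_act \<Gamma> g x) =
      vector [gsg \<Gamma> g ^ (j + 1) * lift j m x $ 1, gsg \<Gamma> g ^ j * lift j m x $ 2]"
      using Free g by (simp add: vec2_eq_iff gsg_mult power_mult_distrib)
  qed
qed

text \<open>The values at the lifts \<open>cov_lift V0 \<one> v\<close> determine the motion. A
  fixed vertex is stabilised by \<open>\<gamma>\<close>, so one component equals its own negative
  there; this is the condition in \<open>jmotions\<close>.\<close>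

lemma VR_lift:
  assumes "j < 2" "m \<in> VR j"
  obtains n where "n \<in> jmotions j" "m = lift j n"
proof -
  have j: "j = 0 \<or> j = 1"
    using assms by auto
  let ?c = "\<lambda>v. cov_lift V0 \<one> v"
  let ?n = "(\<lambda>v. m (?c v) $ 1, \<lambda>v. m (?c v) $ 2)"
  have act: "m (cov_act \<Gamma> g x) = vector [gsg \<Gamma> g ^ (j + 1) * m x $ 1, gsg \<Gamma> g ^ j * m x $ 2]"
    if "g \<in> carrier \<Gamma>" "x \<in> CV" for g x
    using assms(2) that rho_action[OF that(1)] by (simp add: V_rho_def)
  have n: "?n \<in> jmotions j"
  proof -
    have "(if j = 0 then m (Fixed v) $ 1 else m (Fixed v) $ 2) = 0" if "v \<in> V0" for v
    proof -
      have "Fixed v \<in> CV"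
        using that by (auto simp: cov_verts_def)
      then have "m (Fixed v) = vector [gsg \<Gamma> \<gamma> ^ (j + 1) * m (Fixed v) $ 1, gsg \<Gamma> \<gamma> ^ j * m (Fixed v) $ 2]"
        using act[of \<gamma> "Fixed v"] carrier_\<Gamma> by simp
      then show ?thesis
        using j \<gamma> by (auto simp: vec2_eq_iff gsg_def)
    qed
    then show ?thesis
      using j by (auto simp: jmotions_def motions_def anti_motions_def cov_lift_def split: if_splits)
  qed
  have "m x = lift j ?n x" for x
  proof (cases "x \<in> CV")
    case False
    then show ?thesis
      using assms(2) lift_displacement[of j ?n] by (simp add: V_rho_def displacements_def)
  next
    case True
    show ?thesis
    proof (cases x)
      case (Fixed v)
      then have "v \<in> V0"
        using True by (auto simp: cov_verts_def)
      then show ?thesis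
        using Fixed by (simp add: vec2_eq_iff cov_lift_def)
    next
      case (Free h v)
      then have h: "h \<in> carrier \<Gamma>" "v \<in> verts G - V0"
        using True by (auto simp: cov_verts_def)
      then have "Free \<one> v \<in> CV"
        by (auto simp: cov_verts_def)
      then show ?thesis
        using act[of h "Free \<one> v"] h Free by (simp add: vec2_eq_iff cov_lift_def)
    qed
  qed
  then have "m = lift j ?n"
    by (rule ext)
  then show thesis
    by (rule that[OF n])
qed

definition place1 :: "('v \<Rightarrow> real^2) \<Rightarrow> 'v \<Rightarrow> complex" where
  "place1 p v = of_real (p v $ 1)"

definition place2 :: "('v \<Rightarrow> real^2) \<Rightarrow> 'v \<Rightarrow> complex" where
  "place2 p v = of_real (p v $ 2)"

text \<open>Translating an edge by \<open>h\<close> only multiplies its value by the character, so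
  one edge of each orbit carries all information, and its value is a row of the reduced
  matrix.\<close>

lemma edge_value_lift:
  assumes "j < 2" "m \<in> jmotions j" "\<forall>v\<in>V0. p v $ 1 = 0" "h \<in> carrier \<Gamma>" "e \<in> arcs G"
  shows "RM p (lift j m) (cedge h e) = gsg \<Gamma> h ^ j * row j (place1 p) (place2 p) (arc_edge e) m"
proof -
  have j: "j = 0 \<or> j = 1"
    using assms by auto
  have "cedge h e \<in> CE"
    using assms by (auto simp: cov_edges_def)
  note val = rigidity_map_edge[OF this, of "cov_placement \<tau> p" "lift j m"]
  have \<psi>: "\<psi> e \<in> carrier \<Gamma>" "h \<otimes> \<psi> e \<in> carrier \<Gamma>"
    using assms \<psi>_carrier by auto
  obtain a b where m: "m = (a, b)"
    by (cases m)
  have V0: "v \<in> V0 \<Longrightarrow> (if j = 0 then a v else b v) = 0" "v \<in> V0 \<Longrightarrow> p v $ 1 = 0" for v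
    using assms(2,3) j by (auto simp: m jmotions_def motions_def anti_motions_def)
  have q: "cov_placement \<tau> p (cov_lift V0 g v) $ 1 = gsg \<Gamma> g * p v $ 1"
    "cov_placement \<tau> p (cov_lift V0 g v) $ 2 = p v $ 2" if "g \<in> carrier \<Gamma>" for g v
    using assms(3) \<tau>_apply[OF that] by (auto simp: cov_lift_def)
  have l: "lift j m (cov_lift V0 g v) $ 1 = (if j = 0 then gsg \<Gamma> g * a v else a v)"
    "lift j m (cov_lift V0 g v) $ 2 = (if j = 0 then b v else gsg \<Gamma> g * b v)"
    if "g \<in> carrier \<Gamma>" "v \<in> verts G" for g v
    using that j V0[of v] by (auto simp: cov_lift_def m)
  let ?H = "gsg \<Gamma> h :: complex" and ?S = "gsg \<Gamma> (\<psi> e) :: complex"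
  let ?x = "place1 p" and ?y = "place2 p" and ?u = "tail G e" and ?v = "head G e"
  let ?L = "\<lambda>g v. lift j m (cov_lift V0 g v)"
  have "RM p (lift j m) (cedge h e) =
    (?H * ?x ?u - ?H * ?S * ?x ?v) * (?L h ?u $ 1 - ?L (h \<otimes> \<psi> e) ?v $ 1) +
    (?y ?u - ?y ?v) * (?L h ?u $ 2 - ?L (h \<otimes> \<psi> e) ?v $ 2)"
    unfolding val edge_value_def sum_2
    by (simp add: cvec_of_def q[OF assms(4)] q[OF \<psi>(2)] gsg_mult[OF assms(4) \<psi>(1)] place1_def place2_def)
  also have "\<dots> = ?H ^ j * row j ?x ?y (arc_edge e) m"
  proof -
    have "?H = 1 \<or> ?H = - 1"
      by (simp add: gsg_def)
    moreover have "row j ?x ?y (arc_edge e) m = (if j = 0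
      then (?x ?u - ?S * ?x ?v) * (a ?u - ?S * a ?v) + (?y ?u - ?y ?v) * (b ?u - b ?v)
      else (?x ?u - ?S * ?x ?v) * (a ?u - a ?v) + (?y ?u - ?y ?v) * (b ?u - ?S * b ?v))"
      by (simp add: row_def symm_row_def anti_row_def alp_def bet_def m)
    ultimately show ?thesis
      unfolding l[OF assms(4) in_verts(1)[OF assms(5)]] l[OF \<psi>(2) in_verts(2)[OF assms(5)]]
        gsg_mult[OF assms(4) \<psi>(1)]
      using j by (elim disjE) (simp_all add: algebra_simps)
  qed
  finally show ?thesis .
qed

end

section \<open>The blocks of the rigidity map\<close>

lemma fun_sum_apply: "(\<Sum>i\<in>S. f i) x = (\<Sum>i\<in>S. f i x :: complex)"
  by (induction S rule: infinite_finite_induct) auto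

lemma indep_on_independent:
  assumes "finite J" "indep_on J UNIV A"
  shows "inj_on A J" "cfun.independent (A ` J)"
proof -
  show inj: "inj_on A J"
  proof (rule inj_onI)
    fix j k assume jk: "j \<in> J" "k \<in> J" "A j = A k"
    show "j = k"
    proof (rule ccontr)
      assume "j \<noteq> k"
      define \<omega> where "\<omega> i = (if i = j then 1 else if i = k then - 1 else (0 :: complex))" for i
      have "(\<Sum>i\<in>J. \<omega> i * A i x) = 0" for x
      proof -
        have "(\<Sum>i\<in>J. \<omega> i * A i x) = (\<Sum>i\<in>{j, k}. \<omega> i * A i x)"
          using jk assms(1) by (intro sum.mono_neutral_right) (auto simp: \<omega>_def)
        then show ?thesis
          using jk \<open>j \<noteq> k\<close> by (simp add: \<omega>_def)
      qed
      then have "\<omega> j = 0"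
        using indep_onD[OF assms(2), of \<omega> j] jk by blast
      then show False
        by (simp add: \<omega>_def)
    qed
  qed
  show "cfun.independent (A ` J)"
  proof
    assume "cfun.dependent (A ` J)"
    then have "\<exists>u. (\<exists>v\<in>A ` J. u v \<noteq> 0) \<and> (\<Sum>v\<in>A ` J. cfun_scale (u v) v) = 0"
      by (rule cfun.dependent_finite[OF finite_imageI[OF assms(1)], THEN iffD1])
    then obtain u v where u: "v \<in> A ` J" "u v \<noteq> 0" "(\<Sum>v\<in>A ` J. cfun_scale (u v) v) = 0"
      by (elim exE conjE bexE)
    from u(1) obtain j where j: "j \<in> J" "v = A j"
      by (elim imageE)
    have "(\<Sum>i\<in>J. u (A i) * A i x) = 0" for x
    proof -
      have "(\<Sum>i\<in>J. u (A i) * A i x) = (\<Sum>v\<in>A ` J. cfun_scale (u v) v) x"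
        unfolding sum.reindex[OF inj] o_def by (simp add: fun_sum_apply cfun_scale_def)
      then show ?thesis
        using u(3) by simp
    qed
    then have "u (A j) = 0"
      using indep_onD[OF assms(2), of "\<lambda>i. u (A i)" j] j by blast
    then show False
      using u j by simp
  qed
qed

lemma independent_indep_on:
  assumes "finite C" "cfun.independent C"
  shows "indep_on C UNIV (\<lambda>c. c)"
proof (rule indep_onI)
  fix \<omega> c assume \<omega>: "\<And>i. i \<in> UNIV \<Longrightarrow> (\<Sum>c\<in>C. \<omega> c * c i) = 0" and c: "c \<in> C"
  have "(\<Sum>v\<in>C. cfun_scale (\<omega> v) v) = 0"
    using \<omega> by (intro ext) (simp add: fun_sum_apply cfun_scale_def)
  then show "\<omega> c = 0"
    using cfun.independentD[OF assms(2,1) subset_refl] c by blast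
qed

lemma support_in_span:
  assumes "finite E" "\<And>e. e \<notin> E \<Longrightarrow> w e = 0"
  shows "w \<in> cfun.span ((\<lambda>e x. of_bool (x = e)) ` E)"
proof -
  have "w = (\<Sum>e\<in>E. cfun_scale (w e) (\<lambda>x. of_bool (x = e)))"
    using assms
    by (intro ext) (auto simp: fun_sum_apply cfun_scale_def of_bool_def if_distrib[of "\<lambda>z. _ * z"] cong: if_cong)
  also have "\<dots> \<in> cfun.span ((\<lambda>e x. of_bool (x = e)) ` E)"
    by (intro cfun.span_sum cfun.span_scale cfun.span_base) auto
  finally show ?thesis .
qed

text \<open>Tested on real motions, a complex dependence splits into two real ones, given by the
  real and imaginary parts of the coefficients.\<close>

lemma complex_indep_on:
  fixes A :: "'j \<Rightarrow> ('v \<Rightarrow> real) \<times> ('v \<Rightarrow> real) \<Rightarrow> real" and B :: "'j \<Rightarrow> ('v \<Rightarrow> complex) \<times> ('v \<Rightarrow> complex) \<Rightarrow> complex"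
  assumes "indep_on J M A"
    and "\<And>a b. (a, b) \<in> M \<Longrightarrow> (\<lambda>v. of_real (a v), \<lambda>v. of_real (b v)) \<in> N"
    and "\<And>j a b. B j (\<lambda>v. of_real (a v), \<lambda>v. of_real (b v)) = of_real (A j (a, b))"
  shows "indep_on J N B"
proof (rule indep_onI)
  fix \<omega> j assume \<omega>: "\<And>n. n \<in> N \<Longrightarrow> (\<Sum>j\<in>J. \<omega> j * B j n) = 0" and j: "j \<in> J"
  have "(\<Sum>j\<in>J. \<omega> j * of_real (A j (a, b))) = 0" if "(a, b) \<in> M" for a b
    using \<omega>[OF assms(2)[OF that]] by (simp add: assms(3))
  then have "Re (\<Sum>j\<in>J. \<omega> j * of_real (A j m)) = 0" "Im (\<Sum>j\<in>J. \<omega> j * of_real (A j m)) = 0" if "m \<in> M" for m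
    using that by (cases m; simp)+
  then have "Re (\<omega> j) = 0" "Im (\<omega> j) = 0"
    using indep_onD[OF assms(1), of "\<lambda>j. Re (\<omega> j)" j] indep_onD[OF assms(1), of "\<lambda>j. Im (\<omega> j)" j] j
    by simp_all
  then show "\<omega> j = 0"
    by (simp add: complex_eq_iff)
qed

context reflection_gain_graph
begin

lemma RM_edge:
  assumes "d \<in> CE"
  obtains u v where "u \<in> CV" "v \<in> CV" "d = {u, v}" "\<And>p m. RM p m d = edge_value (cov_placement \<tau> p) m u v"
proof -
  obtain h e where he: "h \<in> carrier \<Gamma>" "e \<in> arcs G" "d = cedge h e"
    using assms by (auto simp: cov_edges_def)
  then have "cov_lift V0 h (tail G e) \<in> CV" "cov_lift V0 (h \<otimes> \<psi> e) (head G e) \<in> CV"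
    using \<psi>_carrier in_verts by (auto intro: cov_lift_verts)
  then show thesis
    using that he(3) rigidity_map_edge[of _ _ CE] assms by blast
qed

lemma RM_outside: "d \<notin> CE \<Longrightarrow> RM p m d = 0"
  by (simp add: rigidity_map_def)

lemma RM_add: "RM p (m + n) = RM p m + RM p n"
proof
  fix d show "RM p (m + n) d = (RM p m + RM p n) d"
  proof (cases "d \<in> CE")
    case True
    then obtain u v where uv: "\<And>p m. RM p m d = edge_value (cov_placement \<tau> p) m u v"
      using RM_edge by metis
    show ?thesis
      unfolding uv plus_fun_apply by (simp add: edge_value_def sum_2 algebra_simps)
  qed (simp add: RM_outside)
qed

lemma RM_scale: "RM p (cvec_scale c m) = cfun_scale c (RM p m)"
proof
  fix d show "RM p (cvec_scale c m) d = cfun_scale c (RM p m) d"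
  proof (cases "d \<in> CE")
    case True
    then obtain u v where uv: "\<And>p m. RM p m d = edge_value (cov_placement \<tau> p) m u v"
      using RM_edge by metis
    show ?thesis
      unfolding uv cfun_scale_def by (simp add: edge_value_def sum_2 algebra_simps cvec_scale_def)
  qed (simp add: RM_outside cfun_scale_def)
qed

lemma RM_zero: "RM p 0 = 0"
  using RM_scale[of p 0 0] by (simp add: cvec_scale_def cfun_scale_def zero_fun_def)

text \<open>The rigidity map is linear in the placement, so along a line its entries are polynomials
  of degree at most one.\<close>

lemma RM_segment:
  "RM (\<lambda>v. p v + t *\<^sub>R (q v - p v)) m d = RM p m d + of_real t * (RM q m d - RM p m d)"
proof (cases "d \<in> CE")
  case True
  have pl: "cov_placement \<tau> (\<lambda>v. p v + t *\<^sub>R (q v - p v)) x =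
    cov_placement \<tau> p x + t *\<^sub>R (cov_placement \<tau> q x - cov_placement \<tau> p x)" for x
    by (cases x) (simp_all add: matrix_vector_right_distrib matrix_vector_mult_diff_distrib
        matrix_scaleR_vector_ac scaleR_matrix_vector_assoc scaleR_diff_right)
  obtain u v where uv: "\<And>p m. RM p m d = edge_value (cov_placement \<tau> p) m u v"
    using True RM_edge by metis
  show ?thesis
    unfolding uv edge_value_def sum_2 pl by (simp add: cvec_of_def algebra_simps)
qed (simp add: RM_outside)

lemma subspace_RM_image: "cvec.subspace U \<Longrightarrow> cfun.subspace (RM p ` U)"
  unfolding cfun.subspace_def
proof (intro conjI ballI allI)
  assume U: "cvec.subspace U"
  show "0 \<in> RM p ` U"
    using cvec.subspace_0[OF U] RM_zero by (metis image_eqI)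
  fix x assume "x \<in> RM p ` U"
  then obtain m where m: "m \<in> U" "x = RM p m"
    by blast
  show "cfun_scale c x \<in> RM p ` U" for c
    using cvec.subspace_scale[OF U m(1), of c] m(2) by (auto simp flip: RM_scale)
  fix y assume "y \<in> RM p ` U"
  then obtain n where "n \<in> U" "y = RM p n"
    by blast
  then show "x + y \<in> RM p ` U"
    using cvec.subspace_add[OF U m(1)] m(2) by (auto simp flip: RM_add)
qed

lemma cov_act_edge:
  assumes "g \<in> carrier \<Gamma>" "h \<in> carrier \<Gamma>" "e \<in> arcs G"
  shows "cov_act \<Gamma> g ` cedge h e = cedge (g \<otimes> h) e"
  using assms \<psi>_carrier by (simp add: cov_act_cov_lift m_assoc)

lemma RM_WR:
  assumes "j < 2" "m \<in> VR j" "\<forall>v\<in>V0. p v $ 1 = 0"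
  shows "RM p m \<in> WR j"
  unfolding W_rho_def
proof (intro CollectI conjI allI impI ballI)
  fix g d assume g: "g \<in> carrier \<Gamma>" and "d \<in> CE"
  then obtain h e where he: "h \<in> carrier \<Gamma>" "e \<in> arcs G" "d = cedge h e"
    by (auto simp: cov_edges_def)
  obtain n where n: "n \<in> jmotions j" "m = lift j n"
    using VR_lift[OF assms(1,2)] by blast
  have gh: "g \<otimes> h \<in> carrier \<Gamma>"
    using g he by simp
  show "RM p m (cov_act \<Gamma> g ` d) = cnj (rho \<Gamma> j g) * RM p m d"
    unfolding he(3) n(2) cov_act_edge[OF g he(1,2)] edge_value_lift[OF assms(1) n(1) assms(3) gh he(2)]
      edge_value_lift[OF assms(1) n(1) assms(3) he(1,2)] cnj_rho
    using g he(1) by (simp add: gsg_mult power_mult_distrib)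
qed (simp add: RM_outside)

lemma WR_act: "w \<in> WR j \<Longrightarrow> g \<in> carrier \<Gamma> \<Longrightarrow> d \<in> CE \<Longrightarrow> w (cov_act \<Gamma> g ` d) = gsg \<Gamma> g ^ j * w d"
  by (simp add: W_rho_def cnj_rho)

lemma WR_cedge:
  assumes "w \<in> WR j" "h \<in> carrier \<Gamma>" "e \<in> arcs G"
  shows "w (cedge h e) = gsg \<Gamma> h ^ j * w (cedge \<one> e)"
proof -
  have one: "\<one> \<in> carrier \<Gamma>"
    by simp
  have "cedge \<one> e \<in> CE"
    using assms one by (auto simp: cov_edges_def)
  from WR_act[OF assms(1,2) this] show ?thesis
    unfolding cov_act_edge[OF assms(2) one assms(3)] using assms(2) by simp
qed

lemma WR_eqI:
  assumes "w \<in> WR j" "w' \<in> WR j" "\<And>e. e \<in> arcs G \<Longrightarrow> w (cedge \<one> e) = w' (cedge \<one> e)"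
  shows "w = w'"
proof
  fix d show "w d = w' d"
  proof (cases "d \<in> CE")
    case True
    then obtain h e where he: "h \<in> carrier \<Gamma>" "e \<in> arcs G" and d: "d = cedge h e"
      by (auto simp: cov_edges_def)
    show ?thesis
      unfolding d WR_cedge[OF assms(1) he] WR_cedge[OF assms(2) he] assms(3)[OF he(2)] ..
  next
    case False
    then show ?thesis
      using assms by (simp add: W_rho_def)
  qed
qed

text \<open>On the intersection \<open>\<gamma>\<close> acts both as 1 and as -1.\<close>

lemma WR_Int: "w \<in> WR 0 \<Longrightarrow> w \<in> WR 1 \<Longrightarrow> w = 0"
proof
  fix d assume w: "w \<in> WR 0" "w \<in> WR 1"
  show "w d = 0 d"
  proof (cases "d \<in> CE")
    case True
    have "\<gamma> \<in> carrier \<Gamma>"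
      using carrier_\<Gamma> by simp
    then have "gsg \<Gamma> \<gamma> ^ 0 * w d = gsg \<Gamma> \<gamma> ^ 1 * w d"
      using WR_act[OF w(1) _ True] WR_act[OF w(2) _ True] by metis
    then show ?thesis
      using \<gamma> by (simp add: gsg_def eq_neg_iff_add_eq_0)
  next
    case False
    then show ?thesis
      using w by (simp add: W_rho_def)
  qed
qed

lemma displacement_split:
  assumes "m \<in> displacements CV"
  obtains m0 m1 where "m0 \<in> VR 0" "m1 \<in> VR 1" "m = m0 + m1"
proof -
  \<comment> \<open>The image of \<open>m\<close> under the action of \<open>\<gamma>\<close> on
    displacements; \<open>m0\<close> and \<open>m1\<close> are the symmetrisation and the
    antisymmetrisation of \<open>m\<close>.\<close>
  define sw :: "('g, 'v) cov_vertex \<Rightarrow> complex^2" where "sw x = (if x \<in> CV then vector [- m (cov_act \<Gamma> \<gamma> x) $ 1, m (cov_act \<Gamma> \<gamma> x) $ 2] else 0)" for x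
  define m0 where "m0 = (\<lambda>x. (1/2) *s (m x + sw x))"
  define m1 where "m1 = (\<lambda>x. (1/2) *s (m x - sw x))"
  have c: "\<one> \<in> carrier \<Gamma>" "\<gamma> \<in> carrier \<Gamma>"
    using carrier_\<Gamma> by auto
  have act1: "cov_act \<Gamma> \<one> x = x" if "x \<in> CV" for x
    using that by (auto simp: cov_verts_def)
  have act2: "cov_act \<Gamma> \<gamma> (cov_act \<Gamma> \<gamma> x) = x" if "x \<in> CV" for x
    using that c \<gamma>_square by (auto simp: cov_verts_def simp flip: m_assoc)
  have m: "m x = 0" if "x \<notin> CV" for x
    using assms that by (simp add: displacements_def)
  have "m0 \<in> VR 0"
    unfolding V_rho_def
  proof (intro CollectI conjI ballI)
    show "m0 \<in> displacements CV"
      using m by (auto simp: displacements_def m0_def sw_def)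
    fix g x assume g: "g \<in> carrier \<Gamma>" "x \<in> CV"
    have "g = \<one> \<or> g = \<gamma>"
      using g carrier_\<Gamma> by auto
    then show "m0 (cov_act \<Gamma> g x) = cnj (rho \<Gamma> 0 g) *s (cmat_of (\<tau> g) *v m0 x)"
      unfolding rho_action[OF g(1)] using g(2) act1 act2 cov_act_verts[OF c(2) g(2)] \<gamma>
      by (elim disjE) (simp_all add: m0_def sw_def vec2_eq_iff gsg_def)
  qed
  moreover have "m1 \<in> VR 1"
    unfolding V_rho_def
  proof (intro CollectI conjI ballI)
    show "m1 \<in> displacements CV"
      using m by (auto simp: displacements_def m1_def sw_def)
    fix g x assume g: "g \<in> carrier \<Gamma>" "x \<in> CV"
    have "g = \<one> \<or> g = \<gamma>"
      using g carrier_\<Gamma> by auto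
    then show "m1 (cov_act \<Gamma> g x) = cnj (rho \<Gamma> 1 g) *s (cmat_of (\<tau> g) *v m1 x)"
      unfolding rho_action[OF g(1)] using g(2) act1 act2 cov_act_verts[OF c(2) g(2)] \<gamma>
      by (elim disjE) (simp_all add: m1_def sw_def vec2_eq_iff gsg_def)
  qed
  moreover have "m = m0 + m1"
    by (auto simp: m0_def m1_def vec2_eq_iff fun_eq_iff field_simps)
  ultimately show thesis
    using that by blast
qed

lemma WR_finite_span: "WR j \<subseteq> cfun.span ((\<lambda>e x. of_bool (x = e)) ` CE)"
  using support_in_span[OF finite_cov(2)] by (fastforce simp: W_rho_def)

lemma independent_WR_finite: "cfun.independent C \<Longrightarrow> C \<subseteq> WR j \<Longrightarrow> finite C"
  using cfun.independent_span_bound[of "(\<lambda>e x. of_bool (x = e)) ` CE" C] WR_finite_span finite_cov(2)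
  by (meson finite_imageI subset_trans)

lemma symmetric_cov_placement:
  assumes "\<forall>v\<in>V0. p v $ 1 = 0"
  shows "symmetric_realisation \<Gamma> G V0 \<tau> (cov_placement \<tau> p)"
  unfolding symmetric_realisation_def
proof (intro ballI)
  fix g x assume g: "g \<in> carrier \<Gamma>" and x: "x \<in> CV"
  show "cov_placement \<tau> p (cov_act \<Gamma> g x) = \<tau> g *v cov_placement \<tau> p x"
  proof (cases x)
    case (Fixed v)
    then have "v \<in> V0"
      using x by (auto simp: cov_verts_def)
    then show ?thesis
      using Fixed assms \<tau>_apply[OF g] by (simp add: vec2_eq_iff)
  next
    case (Free h v)
    then have "h \<in> carrier \<Gamma>"
      using x by (auto simp: cov_verts_def)
    then show ?thesis
      using Free g by (simp add: vec2_eq_iff \<tau>_apply gsg_mult)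
  qed
qed

end

section \<open>Dimension counts, row dependences and dual motions\<close>

lemma cfun_card_le_dim:
  assumes "finite T" "V \<subseteq> cfun.span T" "X \<subseteq> V" "cfun.independent X"
  shows "card X \<le> cfun.dim V"
proof -
  obtain B where B: "B \<subseteq> V" "cfun.independent B" "V \<subseteq> cfun.span B" "card B = cfun.dim V"
    by (rule cfun.basis_exists)
  have "finite B"
    using cfun.independent_span_bound[OF assms(1) B(2)] B(1) assms(2) by blast
  then show ?thesis
    using cfun.independent_span_bound[OF _ assms(4), of B] assms(3) B(3,4) by auto
qed

text \<open>The functional of \<open>k\<close> vanishes on \<open>Y\<close> and on the other vectors
  \<open>z l\<close> but not on \<open>z k\<close>, which therefore lies outside their span.\<close>

lemma independent_with_dual:
  fixes \<phi> :: "'k \<Rightarrow> ('a \<Rightarrow> complex^2) \<Rightarrow> complex"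
  assumes "finite K" "cvec.independent Y" "finite Y"
    and add: "\<And>k x y. \<phi> k (x + y) = \<phi> k x + \<phi> k y" and scale: "\<And>k c x. \<phi> k (cvec_scale c x) = c * \<phi> k x"
    and Y: "\<And>k y. k \<in> K \<Longrightarrow> y \<in> Y \<Longrightarrow> \<phi> k y = 0"
    and z: "\<And>k l. k \<in> K \<Longrightarrow> l \<in> K \<Longrightarrow> \<phi> k (z l) = (if k = l then 1 else 0)"
  shows "cvec.independent (Y \<union> z ` K) \<and> card (Y \<union> z ` K) = card Y + card K"
  using assms(1) Y z
proof (induction K rule: finite_induct)
  case empty
  then show ?case
    using assms by simp
next
  case (insert k K)
  have zero: "\<phi> k 0 = 0"
    using scale[of k 0 0] by (simp add: cvec_scale_def zero_fun_def)
  have "cvec.subspace {x. \<phi> k x = 0}"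
    unfolding cvec.subspace_def using zero add scale by simp
  moreover have "Y \<union> z ` K \<subseteq> {x. \<phi> k x = 0}"
    using insert by auto
  ultimately have "cvec.span (Y \<union> z ` K) \<subseteq> {x. \<phi> k x = 0}"
    by (intro cvec.span_minimal)
  moreover have "\<phi> k (z k) = 1"
    using insert.prems(2)[of k k] by simp
  ultimately have notin: "z k \<notin> cvec.span (Y \<union> z ` K)"
    by force
  have "z k \<notin> Y \<union> z ` K"
    using notin cvec.span_base[of "z k"] by (rule contrapos_nn)
  moreover have IH: "cvec.independent (Y \<union> z ` K)" "card (Y \<union> z ` K) = card Y + card K"
    using insert.IH insert.prems by auto
  moreover have "Y \<union> z ` insert k K = insert (z k) (Y \<union> z ` K)"
    by simp
  ultimately show ?case
    using cvec.independent_insertI[OF notin IH(1)] insert.hyps assms(3) by simp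
qed

lemma trivial_on_subspace: "cvec.subspace {m. trivial_on V q m}"
  unfolding cvec.subspace_def
proof (intro conjI ballI allI)
  show "0 \<in> {m. trivial_on V q m}"
    unfolding trivial_on_def mem_Collect_eq by (intro exI[of _ 0]) (simp add: transpose_def vec_eq_iff)
next
  fix m n assume "m \<in> {m. trivial_on V q m}" "n \<in> {m. trivial_on V q m}"
  then obtain M t N s where *: "transpose M = - M" "\<forall>u\<in>V. m u = M *v cvec_of (q u) + t"
    "transpose N = - N" "\<forall>u\<in>V. n u = N *v cvec_of (q u) + s"
    unfolding trivial_on_def mem_Collect_eq by (elim exE conjE)
  have "transpose (M + N) = transpose M + transpose N"
    by (simp add: transpose_def vec_eq_iff)
  then have "transpose (M + N) = - (M + N)"
    unfolding *(1,3) by simp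
  moreover have "\<forall>u\<in>V. (m + n) u = (M + N) *v cvec_of (q u) + (t + s)"
    using *(2,4) by (simp add: matrix_vector_mult_add_rdistrib)
  ultimately show "m + n \<in> {m. trivial_on V q m}"
    unfolding trivial_on_def mem_Collect_eq by blast
next
  fix c m assume "m \<in> {m. trivial_on V q m}"
  then obtain M t where *: "transpose M = - M" "\<forall>u\<in>V. m u = M *v cvec_of (q u) + t"
    unfolding trivial_on_def mem_Collect_eq by (elim exE conjE)
  let ?N = "\<chi> i j. c * M $ i $ j"
  have "transpose ?N = (\<chi> i j. c * transpose M $ i $ j)"
    by (simp add: transpose_def vec_eq_iff)
  then have "transpose ?N = - ?N"
    unfolding *(1) by (simp add: vec_eq_iff)
  moreover have "\<forall>u\<in>V. cvec_scale c m u = ?N *v cvec_of (q u) + c *s t"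
    using *(2) by (simp add: cvec_scale_def vec_eq_iff matrix_vector_mult_def sum_2 algebra_simps)
  ultimately show "cvec_scale c m \<in> {m. trivial_on V q m}"
    unfolding trivial_on_def mem_Collect_eq by blast
qed

lemma cvec_sum_apply: "(\<Sum>i\<in>S. f i) x $ k = (\<Sum>i\<in>S. f i x $ k)" for f :: "'i \<Rightarrow> 'a \<Rightarrow> complex^2"
  by (induction S rule: infinite_finite_induct) auto

text \<open>A row dependence is a linear functional on the codomain that vanishes on the image of
  \<open>R\<close>; as the image is everything, it vanishes on each basis vector \<open>c\<close>,
  where its value is the coefficient.\<close>

lemma onto_no_row_dependence:
  assumes W: "cfun.span C = W" "W \<subseteq> R ` V" and C: "cfun.independent C" "finite C" and B: "cvec.span B = V"
    and R: "\<And>x y. R (x + y) = R x + R y" "\<And>c x. R (cvec_scale c x) = cfun_scale c (R x)" "R ` V \<subseteq> W"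
  shows "no_row_dependence R B C"
  unfolding no_row_dependence_def block_entry_def
proof (intro allI impI ballI)
  fix a c assume a: "\<forall>b\<in>B. (\<Sum>c\<in>C. a c * cfun.representation C (R b) c) = 0" and c: "c \<in> C"
  define L where "L w = (\<Sum>c\<in>C. a c * cfun.representation C w c)" for w
  have V: "cvec.subspace V"
    using B cvec.subspace_span by blast
  have span: "R x \<in> cfun.span C" if "x \<in> V" for x
    using R(3) W(1) that by blast
  have zero: "R 0 = 0"
    using R(2)[of 0 0] by (simp add: cvec_scale_def cfun_scale_def zero_fun_def)
  have "cvec.subspace {x \<in> V. L (R x) = 0}"
    unfolding cvec.subspace_def
  proof (intro conjI ballI allI)
    show "0 \<in> {x \<in> V. L (R x) = 0}"
      using cvec.subspace_0[OF V] by (simp add: L_def zero cfun.representation_zero)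
  next
    fix x y assume "x \<in> {x \<in> V. L (R x) = 0}" "y \<in> {x \<in> V. L (R x) = 0}"
    then show "x + y \<in> {x \<in> V. L (R x) = 0}"
      using cvec.subspace_add[OF V] span
      by (simp add: L_def R(1) cfun.representation_add[OF C(1)] distrib_left sum.distrib)
  next
    fix k x assume "x \<in> {x \<in> V. L (R x) = 0}"
    then have "x \<in> V" "L (R x) = 0"
      by auto
    moreover have "L (R (cvec_scale k x)) = k * L (R x)"
      using span[OF \<open>x \<in> V\<close>]
      by (simp add: L_def R(2) cfun.representation_scale[OF C(1)] sum_distrib_left mult.left_commute)
    ultimately show "cvec_scale k x \<in> {x \<in> V. L (R x) = 0}"
      using cvec.subspace_scale[OF V] by simp
  qed
  moreover have "B \<subseteq> {x \<in> V. L (R x) = 0}"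
    using a B cvec.span_superset[of B] by (auto simp: L_def)
  ultimately have "V \<subseteq> {x \<in> V. L (R x) = 0}"
    using cvec.span_minimal B by metis
  moreover have "c \<in> R ` V"
    using c W cfun.span_base by blast
  ultimately have "L c = 0"
    by auto
  moreover have "L c = a c"
    using c C(2) by (simp add: L_def cfun.representation_basis[OF C(1) c] if_distrib[of "\<lambda>z. _ * z"] cong: if_cong)
  ultimately show "a c = 0"
    by simp
qed

context reflection_gain_graph
begin

text \<open>A right inverse of the block, given on the edges \<open>cedge \<one> e\<close> that
  represent the orbits.\<close>

definition dual_motions :: "nat \<Rightarrow> ('v \<Rightarrow> real^2) \<Rightarrow> ('e \<Rightarrow> ('g, 'v) cov_vertex \<Rightarrow> complex^2) \<Rightarrow> bool" where
  "dual_motions j p z \<longleftrightarrow> (\<forall>e\<in>arcs G. z e \<in> VR j \<and>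
     (\<forall>k\<in>arcs G. RM p (z e) (cedge \<one> k) = (if k = e then 1 else 0)))"

lemma RM_zero_apply: "RM p 0 d = 0"
  unfolding RM_zero by simp

lemma RM_sum:
  "RM p (\<Sum>e\<in>A. cvec_scale (c e) (z e)) d = (\<Sum>e\<in>A. c e * RM p (z e) d)"
proof (induction A rule: infinite_finite_induct)
  case (insert x F)
  show ?case
    unfolding sum.insert[OF insert.hyps] RM_add RM_scale
    unfolding plus_fun_apply insert.IH cfun_scale_def ..
qed (simp_all only: sum.infinite sum.empty RM_zero_apply simp_thms)

lemma dual_motions_onto:
  assumes "j < 2" "\<forall>v\<in>V0. p v $ 1 = 0" "dual_motions j p z"
  shows "WR j \<subseteq> RM p ` VR j"
proof
  fix w assume w: "w \<in> WR j"
  let ?m = "\<Sum>e\<in>arcs G. cvec_scale (w (cedge \<one> e)) (z e)"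
  have m: "?m \<in> VR j"
    using assms(3) unfolding dual_motions_def
    by (intro cvec.subspace_sum[OF V_rho_subspace] cvec.subspace_scale[OF V_rho_subspace]) blast
  have "w = RM p ?m"
  proof (rule WR_eqI[OF w RM_WR[OF assms(1) m assms(2)]])
    fix k assume k: "k \<in> arcs G"
    have "RM p ?m (cedge \<one> k) = (\<Sum>e\<in>arcs G. w (cedge \<one> e) * (if k = e then 1 else 0))"
      unfolding RM_sum using assms(3) k by (intro sum.cong) (auto simp: dual_motions_def)
    also have "\<dots> = w (cedge \<one> k)"
      using k finite_G by (simp add: if_distrib[of "\<lambda>z. _ * z"] cong: if_cong)
    finally show "w (cedge \<one> k) = RM p ?m (cedge \<one> k)"
      by simp
  qed
  then show "w \<in> RM p ` VR j"
    using m by blast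
qed

lemma place_of_real: "place1 p = (\<lambda>v. of_real (p v $ 1))" "place2 p = (\<lambda>v. of_real (p v $ 2))"
  by (auto simp: place1_def place2_def)

lemma dual_motions_exist:
  assumes j: "j < 2" and p: "\<forall>v\<in>V0. p v $ 1 = 0"
    and ind: "indep_on (arc_edge ` arcs G) (jmotions j) (row j (\<lambda>v. p v $ 1) (\<lambda>v. p v $ 2))"
  shows "\<exists>z. dual_motions j p z"
proof -
  have j': "j = 0 \<or> j = 1"
    using j by auto
  have alp: "alp f (\<lambda>v. complex_of_real (a v)) = of_real (alp f a)" and bet: "bet f (\<lambda>v. complex_of_real (a v)) = of_real (bet f a)"
    for f :: "'v gedge" and a
    by (simp_all add: alp_def bet_def gsign_def)
  let ?R = "row j (place1 p) (place2 p)"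
  have ind': "indep_on (arc_edge ` arcs G) (jmotions j) ?R"
  proof (rule complex_indep_on[OF ind])
    show "(\<lambda>v. of_real (a v), \<lambda>v. of_real (b v)) \<in> jmotions j" if "(a, b) \<in> jmotions j" for a b :: "'v \<Rightarrow> real"
      using that j' by (auto simp: jmotions_def motions_def anti_motions_def)
    show "?R f (\<lambda>v. of_real (a v), \<lambda>v. of_real (b v)) = of_real (row j (\<lambda>v. p v $ 1) (\<lambda>v. p v $ 2) f (a, b))" for f a b
      unfolding place_of_real using j' by (auto simp: row_def symm_row_def anti_row_def alp bet)
  qed
  have "\<exists>n. n \<in> jmotions j \<and> (\<forall>k\<in>arcs G. ?R (arc_edge k) n = (if k = e then 1 else 0))" if e: "e \<in> arcs G" for e
  proof -
    obtain n where n: "n \<in> jmotions j" "?R (arc_edge e) n = 1"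
      "\<And>f. f \<in> arc_edge ` arcs G \<Longrightarrow> f \<noteq> arc_edge e \<Longrightarrow> ?R f n = 0"
    proof (rule indep_on_dual[OF finite_imageI[OF finite_G(2)] ind' imageI[OF e],
          where lc = "\<lambda>z c z'. (\<lambda>v. fst z v + c * fst z' v, \<lambda>v. snd z v + c * snd z' v)"])
      fix z z' :: "('v \<Rightarrow> complex) \<times> ('v \<Rightarrow> complex)" and c
      assume "z \<in> jmotions j" "z' \<in> jmotions j"
      then show "(\<lambda>v. fst z v + c * fst z' v, \<lambda>v. snd z v + c * snd z' v) \<in> jmotions j"
        using j' by (auto simp: jmotions_def motions_def anti_motions_def)
      show "?R f (\<lambda>v. fst z v + c * fst z' v, \<lambda>v. snd z v + c * snd z' v) = ?R f z + c * ?R f z'" for f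
        using j' by (auto simp: row_def symm_row_def anti_row_def alp_def bet_def algebra_simps)
    qed blast
    have "?R (arc_edge k) n = (if k = e then 1 else 0)" if k: "k \<in> arcs G" for k
      using n(2) n(3)[OF imageI[OF k]] inj_onD[OF inj_arc_edge _ k e] by auto
    then show ?thesis
      using n(1) by blast
  qed
  then obtain n where n: "\<And>e. e \<in> arcs G \<Longrightarrow> n e \<in> jmotions j"
    "\<And>e k. e \<in> arcs G \<Longrightarrow> k \<in> arcs G \<Longrightarrow> ?R (arc_edge k) (n e) = (if k = e then 1 else 0)"
    by metis
  have "dual_motions j p (\<lambda>e. lift j (n e))"
    unfolding dual_motions_def
  proof (intro ballI conjI)
    fix e k assume e: "e \<in> arcs G"
    show "lift j (n e) \<in> VR j"
      by (rule lift_VR[OF j n(1)[OF e]])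
    assume k: "k \<in> arcs G"
    show "RM p (lift j (n e)) (cedge \<one> k) = (if k = e then 1 else 0)"
      unfolding edge_value_lift[OF j n(1)[OF e] p one_closed k] n(2)[OF e k] by simp
  qed
  then show ?thesis
    by blast
qed

subsection \<open>Transfer to generic placements\<close>

text \<open>The competitor \<open>r\<close> on the line has rank at least
  \<open>card C + card B\<close>, and \<open>p\<close> has rank at most
  \<open>card C' + card B\<close>. Maximality gives \<open>card C \<le> card C'\<close>, so the
  basis \<open>C'\<close> of the image at \<open>p\<close> spans \<open>WR j\<close>.\<close>

lemma generic_onto:
  assumes j: "j < 2" and p: "\<forall>v\<in>V0. p v $ 1 = 0" and gen: "Cs_generic \<Gamma> G V0 \<psi> \<tau> p"
    and q: "\<forall>v\<in>V0. q v $ 1 = 0" and onto: "WR j \<subseteq> RM q ` VR j"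
  shows "WR j \<subseteq> RM p ` VR j"
proof -
  define i where "i = 1 - j"
  have i: "i < 2"
    by (simp add: i_def)
  obtain C where C: "cfun.independent C" "cfun.span C = WR j"
    using W_rho_basis by blast
  have CW: "C \<subseteq> WR j"
    using C(2) cfun.span_superset by blast
  have finC: "finite C"
    by (rule independent_WR_finite[OF C(1) CW])
  have "\<forall>c\<in>C. \<exists>m. m \<in> VR j \<and> RM q m = c"
    using CW onto by blast
  then obtain n where n: "\<And>c. c \<in> C \<Longrightarrow> n c \<in> VR j" "\<And>c. c \<in> C \<Longrightarrow> RM q (n c) = c"
    by metis
  obtain B where B: "B \<subseteq> RM p ` VR i" "cfun.independent B" "RM p ` VR i \<subseteq> cfun.span B"
    by (rule cfun.basis_exists)
  have BW: "B \<subseteq> WR i"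
    using B(1) RM_WR[OF i _ p] by blast
  have finB: "finite B"
    by (rule independent_WR_finite[OF B(2) BW])
  have "\<forall>b\<in>B. \<exists>m. m \<in> VR i \<and> RM p m = b"
    using B(1) by blast
  then obtain m where m: "\<And>b. b \<in> B \<Longrightarrow> m b \<in> VR i" "\<And>b. b \<in> B \<Longrightarrow> RM p (m b) = b"
    by metis
  \<comment> \<open>The edge value as a polynomial in the line parameter, with \<open>p\<close> at 0
    and \<open>q\<close> at 1. Block \<open>j\<close> is known to be good at 1 and the other block
    at 0.\<close>
  define f where "f x d = [:RM p x d, RM q x d - RM p x d:]" for x d
  have "indep_on C UNIV (\<lambda>c d. poly (f (n c) d) 1) = indep_on C UNIV (\<lambda>c. c)"
    using n(2) by (intro indep_on_cong) (simp add: f_def)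
  then have T1: "finite {t. \<not> indep_on C UNIV (\<lambda>c d. poly (f (n c) d) t)}"
    using independent_indep_on[OF finC C(1)] by (intro finite_dependent_parameters[OF finC]) simp
  have "indep_on B UNIV (\<lambda>b d. poly (f (m b) d) 0) = indep_on B UNIV (\<lambda>b. b)"
    using m(2) by (intro indep_on_cong) (simp add: f_def)
  then have T2: "finite {t. \<not> indep_on B UNIV (\<lambda>b d. poly (f (m b) d) t)}"
    using independent_indep_on[OF finB B(2)] by (intro finite_dependent_parameters[OF finB]) simp
  let ?T = "{t. \<not> indep_on C UNIV (\<lambda>c d. poly (f (n c) d) t)} \<union> {t. \<not> indep_on B UNIV (\<lambda>b d. poly (f (m b) d) t)}"
  \<comment> \<open>The bad parameters are complex numbers, but a placement needs a real one;
    finitely many of the reals are bad.\<close>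
  have "finite (complex_of_real -` ?T)"
    using T1 T2 by (intro finite_vimageI inj_onI) auto
  then obtain t where "t \<notin> complex_of_real -` ?T"
    using ex_new_if_finite[OF infinite_UNIV_char_0] by blast
  then have t: "indep_on C UNIV (\<lambda>c d. poly (f (n c) d) (of_real t))" "indep_on B UNIV (\<lambda>b d. poly (f (m b) d) (of_real t))"
    by auto
  define r where "r = (\<lambda>v. p v + t *\<^sub>R (q v - p v))"
  have r: "\<forall>v\<in>V0. r v $ 1 = 0"
    using p q by (simp add: r_def)
  have RMr: "poly (f x d) (of_real t) = RM r x d" for x d
    unfolding r_def RM_segment by (simp add: f_def)
  have tC: "indep_on C UNIV (\<lambda>c. RM r (n c))" and tB: "indep_on B UNIV (\<lambda>b. RM r (m b))"
    using t unfolding RMr by simp_all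
  let ?A = "case_sum (\<lambda>c. RM r (n c)) (\<lambda>b. RM r (m b))"
  \<comment> \<open>The two images lie in \<open>WR j\<close> and \<open>WR i\<close>, which meet
    only in 0, so both independent families stay independent together.\<close>
  have "indep_on (C <+> B) UNIV ?A"
  proof (rule indep_onI)
    fix \<omega> x assume \<omega>: "\<And>d. d \<in> UNIV \<Longrightarrow> (\<Sum>k\<in>C <+> B. \<omega> k * ?A k d) = 0" and x: "x \<in> C <+> B"
    define u where "u = (\<Sum>c\<in>C. cfun_scale (\<omega> (Inl c)) (RM r (n c)))"
    define v where "v = (\<Sum>b\<in>B. cfun_scale (\<omega> (Inr b)) (RM r (m b)))"
    have uv: "u d + v d = 0" for d
      using \<omega>[of d] finC finB by (simp add: sum.Plus u_def v_def fun_sum_apply cfun_scale_def)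
    have u: "u \<in> WR j"
      unfolding u_def using n(1) RM_WR[OF j _ r]
      by (intro cfun.subspace_sum[OF W_rho_subspace] cfun.subspace_scale[OF W_rho_subspace]) blast
    have v: "v \<in> WR i"
      unfolding v_def using m(1) RM_WR[OF i _ r]
      by (intro cfun.subspace_sum[OF W_rho_subspace] cfun.subspace_scale[OF W_rho_subspace]) blast
    have uv': "u = cfun_scale (- 1) v"
      using uv by (intro ext) (simp add: cfun_scale_def eq_neg_iff_add_eq_0)
    have "u \<in> WR i"
      unfolding uv' by (rule cfun.subspace_scale[OF W_rho_subspace v])
    moreover have "j = 0 \<and> i = 1 \<or> j = 1 \<and> i = 0"
      using j by (auto simp: i_def)
    ultimately have "u = 0"
      using u WR_Int[of u] by auto
    then have ud: "u d = 0" and vd: "v d = 0" for d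
      using uv[of d] by simp_all
    have "\<omega> (Inl c) = 0" if "c \<in> C" for c
      using ud that by (intro indep_onD[OF tC, of "\<lambda>c. \<omega> (Inl c)"])
        (simp_all add: u_def fun_sum_apply cfun_scale_def)
    moreover have "\<omega> (Inr b) = 0" if "b \<in> B" for b
      using vd that by (intro indep_onD[OF tB, of "\<lambda>b. \<omega> (Inr b)"])
        (simp_all add: v_def fun_sum_apply cfun_scale_def)
    ultimately show "\<omega> x = 0"
      using x by (elim PlusE) simp_all
  qed
  note indA = indep_on_independent[OF finite_Plus[OF finC finB] this]
  have displ: "VR l \<subseteq> displacements CV" for l
    by (auto simp: V_rho_def)
  have "?A ` (C <+> B) \<subseteq> RM r ` displacements CV"
  proof (intro image_subsetI)
    fix x assume "x \<in> C <+> B"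
    then show "?A x \<in> RM r ` displacements CV"
      using n(1) m(1) displ[of i] displ[of j] by (elim PlusE) (simp_all add: subset_iff)
  qed
  moreover have "RM r ` displacements CV \<subseteq> cfun.span ((\<lambda>e x. of_bool (x = e)) ` CE)"
    by (intro image_subsetI support_in_span[OF finite_cov(2)] RM_outside)
  ultimately have "card (?A ` (C <+> B)) \<le> rigidity_rank CV CE (cov_placement \<tau> r)"
    unfolding rigidity_rank_def
    using cfun_card_le_dim[OF finite_imageI[OF finite_cov(2)] _ _ indA(2)] by blast
  also have "\<dots> \<le> rigidity_rank CV CE (cov_placement \<tau> p)"
    using gen symmetric_cov_placement[OF r] by (simp add: Cs_generic_def)
  finally have rank: "card C + card B \<le> rigidity_rank CV CE (cov_placement \<tau> p)"
    using finC finB by (simp add: card_image[OF indA(1)] card_Plus)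
  obtain C' where C': "C' \<subseteq> RM p ` VR j" "cfun.independent C'" "RM p ` VR j \<subseteq> cfun.span C'"
    by (rule cfun.basis_exists)
  have C'W: "C' \<subseteq> WR j"
    using C'(1) RM_WR[OF j _ p] by blast
  have finC': "finite C'"
    by (rule independent_WR_finite[OF C'(2) C'W])
  \<comment> \<open>Every displacement is a sum of motions from the two blocks, which bounds the
    rank at \<open>p\<close> from above.\<close>
  have "RM p ` displacements CV \<subseteq> cfun.span (C' \<union> B)"
  proof (intro image_subsetI)
    fix x assume "x \<in> displacements CV"
    then obtain m0 m1 where m01: "m0 \<in> VR 0" "m1 \<in> VR 1" "x = m0 + m1"
      by (rule displacement_split)
    have "RM p y \<in> cfun.span (C' \<union> B)" if "y \<in> VR j \<or> y \<in> VR i" for y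
      using that C'(3) B(3) cfun.span_mono[of C' "C' \<union> B"] cfun.span_mono[of B "C' \<union> B"] by blast
    moreover have "VR 0 \<subseteq> VR j \<union> VR i" "VR 1 \<subseteq> VR j \<union> VR i"
      using j by (auto simp: i_def less_2_cases_iff)
    ultimately show "RM p x \<in> cfun.span (C' \<union> B)"
      unfolding m01(3) RM_add using m01(1,2) by (intro cfun.span_add) blast+
  qed
  then have "rigidity_rank CV CE (cov_placement \<tau> p) \<le> card (C' \<union> B)"
    unfolding rigidity_rank_def using finC' finB by (intro cfun.dim_le_card) auto
  also have "\<dots> \<le> card C' + card B"
    by (rule card_Un_le)
  finally have CC': "card C \<le> card C'"
    using rank by simp
  have "WR j \<subseteq> cfun.span C'"
  proof
    fix w assume w: "w \<in> WR j"
    show "w \<in> cfun.span C'"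
    proof (rule ccontr)
      assume nw: "w \<notin> cfun.span C'"
      have "insert w C' \<subseteq> cfun.span C"
        using w C'W C(2) by simp
      then have "card (insert w C') \<le> card C"
        using cfun.independent_span_bound[OF finC cfun.independent_insertI[OF nw C'(2)]] by simp
      moreover have "w \<notin> C'"
        using nw cfun.span_base by blast
      ultimately show False
        using CC' finC' by simp
    qed
  qed
  moreover have "cfun.span C' \<subseteq> RM p ` VR j"
    by (rule cfun.span_minimal[OF C'(1) subspace_RM_image[OF V_rho_subspace]])
  ultimately show ?thesis
    by blast
qed

subsection \<open>The kernel of a block\<close>

definition unit1 :: "'v \<Rightarrow> ('v \<Rightarrow> complex) \<times> ('v \<Rightarrow> complex)" where
  "unit1 v = ((\<lambda>u. if u = v then 1 else 0), (\<lambda>_. 0))"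

definition unit2 :: "'v \<Rightarrow> ('v \<Rightarrow> complex) \<times> ('v \<Rightarrow> complex)" where
  "unit2 v = ((\<lambda>_. 0), (\<lambda>u. if u = v then 1 else 0))"

definition unit_lifts :: "nat \<Rightarrow> (('g, 'v) cov_vertex \<Rightarrow> complex^2) set" where
  "unit_lifts j = (\<lambda>v. lift j (unit1 v)) ` (if j = 0 then verts G - V0 else verts G) \<union>
     (\<lambda>v. lift j (unit2 v)) ` (if j = 0 then verts G else verts G - V0)"

lemma finite_unit_lifts: "finite (unit_lifts j)"
  using finite_G by (simp add: unit_lifts_def)

lemma card_unit_lifts: "card (unit_lifts j) \<le> 2 * card (verts G - V0) + card (verts G \<inter> V0)"
proof -
  let ?S = "if j = 0 then verts G - V0 else verts G" and ?T = "if j = 0 then verts G else verts G - V0"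
  have "(verts G - V0) \<union> (verts G \<inter> V0) = verts G" "(verts G - V0) \<inter> (verts G \<inter> V0) = {}"
    by auto
  then have "card (verts G) = card (verts G - V0) + card (verts G \<inter> V0)"
    using finite_G card_Un_disjoint[of "verts G - V0" "verts G \<inter> V0"] by simp
  then have "card ?S + card ?T = 2 * card (verts G - V0) + card (verts G \<inter> V0)"
    by simp
  moreover have "card (unit_lifts j) \<le> card ((\<lambda>v. lift j (unit1 v)) ` ?S) + card ((\<lambda>v. lift j (unit2 v)) ` ?T)"
    unfolding unit_lifts_def by (rule card_Un_le)
  moreover have "card ((\<lambda>v. lift j (unit1 v)) ` ?S) \<le> card ?S" "card ((\<lambda>v. lift j (unit2 v)) ` ?T) \<le> card ?T"
    using finite_G by (auto intro!: card_image_le)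
  ultimately show ?thesis
    by linarith
qed

lemma lift_decomposition:
  "lift j (a, b) = (\<Sum>v\<in>verts G. cvec_scale (a v) (lift j (unit1 v)) + cvec_scale (b v) (lift j (unit2 v)))"
proof
  fix x
  let ?f = "\<lambda>v. cvec_scale (a v) (lift j (unit1 v)) + cvec_scale (b v) (lift j (unit2 v))"
  have f: "?f v x $ k = a v * lift j (unit1 v) x $ k + b v * lift j (unit2 v) x $ k" for v k
    by (simp add: cvec_scale_def)
  show "lift j (a, b) x = (\<Sum>v\<in>verts G. ?f v) x"
    unfolding vec2_eq_iff cvec_sum_apply f
  proof (cases x)
    case (Fixed u)
    show "lift j (a, b) x $ 1 = (\<Sum>v\<in>verts G. a v * lift j (unit1 v) x $ 1 + b v * lift j (unit2 v) x $ 1) \<and>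
      lift j (a, b) x $ 2 = (\<Sum>v\<in>verts G. a v * lift j (unit1 v) x $ 2 + b v * lift j (unit2 v) x $ 2)"
      using V0_subset finite_G
      by (cases "u \<in> V0") (auto simp: Fixed unit1_def unit2_def if_distrib[of "\<lambda>z. _ * z"] cong: if_cong)
  next
    case (Free g u)
    show "lift j (a, b) x $ 1 = (\<Sum>v\<in>verts G. a v * lift j (unit1 v) x $ 1 + b v * lift j (unit2 v) x $ 1) \<and>
      lift j (a, b) x $ 2 = (\<Sum>v\<in>verts G. a v * lift j (unit1 v) x $ 2 + b v * lift j (unit2 v) x $ 2)"
      using finite_G
      by (cases "g \<in> carrier \<Gamma> \<and> u \<in> verts G - V0")
        (auto simp: Free unit1_def unit2_def if_distrib[of "\<lambda>z. _ * z"] cong: if_cong)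
  qed
qed

lemma VR_span:
  assumes "j < 2"
  shows "VR j \<subseteq> cvec.span (unit_lifts j)"
proof
  fix m assume "m \<in> VR j"
  then obtain n where n: "n \<in> jmotions j" "m = lift j n"
    by (rule VR_lift[OF assms])
  obtain a b where ab: "n = (a, b)"
    by (cases n)
  have z: "cvec_scale 0 f = 0" for f :: "('g, 'v) cov_vertex \<Rightarrow> complex^2"
    by (rule cvec.scale_zero_left)
  have one: "cvec_scale (a v) (lift j (unit1 v)) \<in> cvec.span (unit_lifts j)" if v: "v \<in> verts G" for v
  proof (cases "j = 0 \<and> v \<in> V0")
    case True
    then have "a v = 0"
      using n(1) by (simp add: ab jmotions_def motions_def)
    then show ?thesis
      by (simp only: z cvec.span_zero)
  next
    case False
    then have "lift j (unit1 v) \<in> unit_lifts j"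
      using v by (auto simp: unit_lifts_def)
    then show ?thesis
      by (intro cvec.span_scale cvec.span_base)
  qed
  have two: "cvec_scale (b v) (lift j (unit2 v)) \<in> cvec.span (unit_lifts j)" if v: "v \<in> verts G" for v
  proof (cases "j \<noteq> 0 \<and> v \<in> V0")
    case True
    then have "b v = 0"
      using n(1) by (simp add: ab jmotions_def anti_motions_def)
    then show ?thesis
      by (simp only: z cvec.span_zero)
  next
    case False
    then have "lift j (unit2 v) \<in> unit_lifts j"
      using v by (auto simp: unit_lifts_def)
    then show ?thesis
      by (intro cvec.span_scale cvec.span_base)
  qed
  show "m \<in> cvec.span (unit_lifts j)"
    unfolding n(2) ab lift_decomposition by (intro cvec.span_sum cvec.span_add one two)
qed

text \<open>\<open>Y\<close> and the dual motions are independent and already as numerous as the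
  spanning set \<open>unit_lifts j\<close> permits, so no kernel vector outside the span of
  \<open>Y\<close> fits in.\<close>

lemma kernel_in_span:
  assumes j: "j < 2" and dual: "dual_motions j p z"
    and Y: "finite Y" "cvec.independent Y" "Y \<subseteq> VR j" "\<And>y. y \<in> Y \<Longrightarrow> RM p y = 0"
    and card: "2 * card (verts G - V0) + card (verts G \<inter> V0) \<le> card Y + card (arcs G)"
    and m: "m \<in> VR j" "RM p m = 0"
  shows "m \<in> cvec.span Y"
proof (rule ccontr)
  assume nm: "m \<notin> cvec.span Y"
  then have mY: "m \<notin> Y"
    by (rule contrapos_nn) (rule cvec.span_base)
  have "cvec.independent (insert m Y \<union> z ` arcs G) \<and>
    card (insert m Y \<union> z ` arcs G) = card (insert m Y) + card (arcs G)"
  proof (rule independent_with_dual[where \<phi> = "\<lambda>k m. RM p m (cedge \<one> k)"])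
    show "finite (arcs G)" "finite (insert m Y)"
      using finite_G Y by simp_all
    show "cvec.independent (insert m Y)"
      by (rule cvec.independent_insertI[OF nm Y(2)])
    show "RM p (x + y) (cedge \<one> k) = RM p x (cedge \<one> k) + RM p y (cedge \<one> k)" for k x y
      unfolding RM_add by (rule plus_fun_apply)
    show "RM p (cvec_scale c x) (cedge \<one> k) = c * RM p x (cedge \<one> k)" for k c x
      unfolding RM_scale by (simp add: cfun_scale_def)
    show "RM p y (cedge \<one> k) = 0" if "y \<in> insert m Y" for k y
    proof -
      have "RM p y = 0"
        using that m(2) Y(4) by (elim insertE) simp_all
      then show ?thesis
        by simp
    qed
    show "RM p (z l) (cedge \<one> k) = (if k = l then 1 else 0)" if "k \<in> arcs G" "l \<in> arcs G" for k l
      using dual that unfolding dual_motions_def by blast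
  qed
  then have ind: "cvec.independent (insert m Y \<union> z ` arcs G)"
    and cardI: "card (insert m Y \<union> z ` arcs G) = Suc (card Y) + card (arcs G)"
    using mY Y(1) by simp_all
  have "z ` arcs G \<subseteq> VR j"
    using dual unfolding dual_motions_def by blast
  then have "insert m Y \<union> z ` arcs G \<subseteq> cvec.span (unit_lifts j)"
    using m(1) Y(3) VR_span[OF j] by blast
  then have "card (insert m Y \<union> z ` arcs G) \<le> card (unit_lifts j)"
    using cvec.independent_span_bound[OF finite_unit_lifts ind] by blast
  then show False
    using cardI card card_unit_lifts[of j] by linarith
qed

text \<open>The trivial motions split between the blocks: translation along the mirror is fully
  symmetric, translation across it and rotation are anti-symmetric. These numbers 1 and 2 are the
  last parameters of the two tightness counts.\<close>

definition trans_y :: "('g, 'v) cov_vertex \<Rightarrow> complex^2" where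
  "trans_y = lift 0 ((\<lambda>_. 0), (\<lambda>_. 1))"

definition trans_x :: "('g, 'v) cov_vertex \<Rightarrow> complex^2" where
  "trans_x = lift 1 ((\<lambda>_. 1), (\<lambda>_. 0))"

definition rotation :: "('v \<Rightarrow> real^2) \<Rightarrow> ('g, 'v) cov_vertex \<Rightarrow> complex^2" where
  "rotation p = lift 1 ((\<lambda>v. - place2 p v), place1 p)"

lemma lift_in_kernel:
  assumes "j < 2" "n \<in> jmotions j" "\<forall>v\<in>V0. p v $ 1 = 0"
    and "\<And>e. row j (place1 p) (place2 p) e n = 0"
  shows "lift j n \<in> VR j" "RM p (lift j n) = 0"
proof -
  show n: "lift j n \<in> VR j"
    by (rule lift_VR[OF assms(1,2)])
  show "RM p (lift j n) = 0"
  proof (rule WR_eqI[OF RM_WR[OF assms(1) n assms(3)] cfun.subspace_0[OF W_rho_subspace]])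
    fix e assume "e \<in> arcs G"
    show "RM p (lift j n) (cedge \<one> e) = 0 (cedge \<one> e)"
      unfolding edge_value_lift[OF assms(1-3) one_closed \<open>e \<in> arcs G\<close>] assms(4) by simp
  qed
qed

lemma trans_y_kernel: "\<forall>v\<in>V0. p v $ 1 = 0 \<Longrightarrow> trans_y \<in> VR 0 \<and> RM p trans_y = 0"
  unfolding trans_y_def
  using lift_in_kernel[of 0 "((\<lambda>_. 0), (\<lambda>_. 1))" p]
  by (simp add: jmotions_def motions_def row_def symm_row_def bet_def)

lemma trans_x_kernel: "\<forall>v\<in>V0. p v $ 1 = 0 \<Longrightarrow> trans_x \<in> VR 1 \<and> RM p trans_x = 0"
  unfolding trans_x_def
  using lift_in_kernel[of 1 "((\<lambda>_. 1), (\<lambda>_. 0))" p]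
  by (simp add: jmotions_def anti_motions_def row_def anti_row_def bet_def)

lemma rotation_kernel: "\<forall>v\<in>V0. p v $ 1 = 0 \<Longrightarrow> rotation p \<in> VR 1 \<and> RM p (rotation p) = 0"
  unfolding rotation_def
  using lift_in_kernel[of 1 "((\<lambda>v. - place2 p v), place1 p)" p]
  by (simp add: jmotions_def anti_motions_def row_def anti_row_def bet_def alp_def place1_def algebra_simps)

lemma trans_y_value: "x \<in> CV \<Longrightarrow> trans_y x = vector [0, 1]"
  by (cases x) (auto simp: trans_y_def cov_verts_def)

lemma trans_x_value: "x \<in> CV \<Longrightarrow> trans_x x = vector [1, 0]"
  by (cases x) (auto simp: trans_x_def cov_verts_def power2_eq_square vec2_eq_iff)

lemma rotation_value:
  assumes "\<forall>v\<in>V0. p v $ 1 = 0" "x \<in> CV"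
  shows "rotation p x = vector [- of_real (cov_placement \<tau> p x $ 2), of_real (cov_placement \<tau> p x $ 1)]"
proof (cases x)
  case (Fixed v)
  then show ?thesis
    using assms by (auto simp: rotation_def cov_verts_def place1_def place2_def)
next
  case (Free g v)
  then have "g \<in> carrier \<Gamma>" "v \<in> verts G - V0"
    using assms by (auto simp: cov_verts_def)
  then show ?thesis
    using Free by (simp add: rotation_def place1_def place2_def \<tau>_apply power2_eq_square vec2_eq_iff)
qed

lemma trivial_trans_y: "trivial_on CV q trans_y"
  unfolding trivial_on_def
  by (rule exI[of _ 0], rule exI[of _ "vector [0, 1]"]) (simp add: trans_y_value transpose_def vec_eq_iff)

lemma trivial_trans_x: "trivial_on CV q trans_x"
  unfolding trivial_on_def
  by (rule exI[of _ 0], rule exI[of _ "vector [1, 0]"]) (simp add: trans_x_value transpose_def vec_eq_iff)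

lemma trivial_rotation: "\<forall>v\<in>V0. p v $ 1 = 0 \<Longrightarrow> trivial_on CV (cov_placement \<tau> p) (rotation p)"
  unfolding trivial_on_def
  by (rule exI[of _ "vector [vector [0, - 1], vector [1, 0]]"], rule exI[of _ 0])
    (simp add: rotation_value transpose_def vec_eq_iff forall_2 matrix_vector_mult_def sum_2 cvec_of_def)

lemma trivial_in_span:
  assumes "m \<in> cvec.span Y" "\<And>y. y \<in> Y \<Longrightarrow> trivial_on V q y"
  shows "trivial_on V q m"
proof -
  have "cvec.span Y \<subseteq> {m. trivial_on V q m}"
    using assms(2) by (intro cvec.span_minimal trivial_on_subspace) blast
  then show ?thesis
    using assms(1) by blast
qed

lemma independent_trans_y:
  assumes "CV \<noteq> {}"
  shows "cvec.independent {trans_y}"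
proof -
  obtain x where "x \<in> CV"
    using assms by blast
  then have "trans_y \<noteq> 0"
    using trans_y_value[of x] by (auto simp: vec2_eq_iff)
  then show ?thesis
    by (simp add: cvec.dependent_single)
qed

text \<open>If the rotation were a multiple of the translation, all points would lie on the mirror
  at one height and could not affinely span the plane.\<close>

lemma independent_trans_x_rotation:
  assumes "\<forall>v\<in>V0. p v $ 1 = 0" "affine hull (cov_placement \<tau> p ` CV) = UNIV"
  shows "rotation p \<noteq> trans_x \<and> cvec.independent {rotation p, trans_x}"
proof -
  have ne: "cov_placement \<tau> p ` CV \<noteq> {}"
    using assms(2) by force
  then obtain x0 where x0: "x0 \<in> CV"
    by blast
  have "rotation p \<notin> cvec.span {trans_x}"
  proof
    assume "rotation p \<in> cvec.span {trans_x}"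
    then obtain k where k: "rotation p = cvec_scale k trans_x"
      unfolding cvec.span_singleton by blast
    have pt: "cov_placement \<tau> p x = vector [0, - Re k]" if x: "x \<in> CV" for x
    proof -
      have "rotation p x = k *s trans_x x"
        by (simp add: k cvec_scale_def)
      then have "vector [- of_real (cov_placement \<tau> p x $ 2), of_real (cov_placement \<tau> p x $ 1)] = (vector [k, 0] :: complex^2)"
        unfolding rotation_value[OF assms(1) x] trans_x_value[OF x] by (simp add: vec2_eq_iff)
      then have "k = - of_real (cov_placement \<tau> p x $ 2)" "cov_placement \<tau> p x $ 1 = 0"
        by (simp_all add: vec2_eq_iff)
      then show ?thesis
        by (simp add: vec2_eq_iff)
    qed
    then have "cov_placement \<tau> p ` CV \<subseteq> {vector [0, - Re k]}"
      by blast
    then have "affine hull (cov_placement \<tau> p ` CV) \<subseteq> affine hull {vector [0, - Re k]}"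
      by (rule hull_mono)
    then have "UNIV \<subseteq> {vector [0, - Re k] :: real^2}"
      unfolding assms(2) by simp
    then have "(vector [1, 0] :: real^2) = vector [0, - Re k]"
      by blast
    then show False
      by (simp add: vec2_eq_iff)
  qed
  moreover have "trans_x \<noteq> 0"
    using trans_x_value[OF x0] by (auto simp: vec2_eq_iff)
  ultimately show ?thesis
    using cvec.independent_insertI[of "rotation p" "{trans_x}"] cvec.span_base[of "rotation p" "{trans_x}"]
    by (auto simp: cvec.dependent_single)
qed

lemma isostatic_of_placement:
  fixes x y :: "'v \<Rightarrow> real"
  assumes j: "j < 2" and p: "\<forall>v\<in>V0. p v $ 1 = 0" and gen: "Cs_generic \<Gamma> G V0 \<psi> \<tau> p"
    and xy: "\<forall>v\<in>V0. x v = 0" "indep_on (arc_edge ` arcs G) (jmotions j) (row j x y)"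
    and Y: "finite Y" "cvec.independent Y" "Y \<subseteq> VR j" "\<And>m. m \<in> Y \<Longrightarrow> RM p m = 0"
      "\<And>m. m \<in> Y \<Longrightarrow> trivial_on CV (cov_placement \<tau> p) m"
    and card: "2 * card (verts G - V0) + card (verts G \<inter> V0) \<le> card Y + card (arcs G)"
  shows "rho_isostatic j \<Gamma> G V0 \<psi> \<tau> p"
proof -
  define q :: "'v \<Rightarrow> real^2" where "q v = vector [x v, y v]" for v
  have q: "\<forall>v\<in>V0. q v $ 1 = 0"
    using xy(1) by (simp add: q_def)
  have "(\<lambda>v. q v $ 1) = x" "(\<lambda>v. q v $ 2) = y"
    by (simp_all add: q_def)
  then obtain z where z: "dual_motions j q z"
    using dual_motions_exist[OF j q] xy(2) by auto
  have onto: "WR j \<subseteq> RM p ` VR j"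
    by (rule generic_onto[OF j p gen q dual_motions_onto[OF j q z]])
  \<comment> \<open>Surjectivity at \<open>p\<close> transports the dual motions: those at
    \<open>q\<close> are replaced by motions with the same edge values at \<open>p\<close>.\<close>
  have "\<exists>m. m \<in> VR j \<and> RM p m = RM q (z e)" if "e \<in> arcs G" for e
  proof -
    have "RM q (z e) \<in> WR j"
      using z that RM_WR[OF j _ q] unfolding dual_motions_def by blast
    then show ?thesis
      using onto by force
  qed
  then obtain z' where z': "\<And>e. e \<in> arcs G \<Longrightarrow> z' e \<in> VR j \<and> RM p (z' e) = RM q (z e)"
    by metis
  have dual: "dual_motions j p z'"
    using z unfolding dual_motions_def by (simp add: z')
  have "trivial_on CV (cov_placement \<tau> p) m" if m: "m \<in> VR j" "RM p m = 0" for m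
    by (rule trivial_in_span[OF kernel_in_span[OF j dual Y(1-4) card m] Y(5)])
  moreover have "no_row_dependence (RM p) B C"
    if BC: "cvec.independent B" "cvec.span B = VR j" "cfun.independent C" "cfun.span C = WR j" for B C
  proof (rule onto_no_row_dependence[OF BC(4) onto BC(3) _ BC(2) RM_add RM_scale])
    show "finite C"
      using independent_WR_finite[OF BC(3)] BC(4) cfun.span_superset[of C] by blast
    show "RM p ` VR j \<subseteq> WR j"
      using RM_WR[OF j _ p] by blast
  qed
  ultimately show ?thesis
    unfolding rho_isostatic_def Let_def by blast
qed

end

theorem theorem7p7:
  fixes \<Gamma> :: "('g, 'b) monoid_scheme"
    and G :: "('v, 'e) pre_digraph"
    and V0 :: "'v set"
    and \<psi> :: "'e \<Rightarrow> 'g"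
    and \<tau> :: "'g \<Rightarrow> real^2^2"
    and p :: "'v \<Rightarrow> real^2"
  assumes "group \<Gamma>" and "cyclic_group \<Gamma>" and "order \<Gamma> = 2"
    and "gain_graph \<Gamma> G V0 \<psi>"
    and "\<tau> \<in> hom \<Gamma> C_s" and "inj_on \<tau> (carrier \<Gamma>)"
    and "covering_framework \<Gamma> G V0 \<tau> p"
    and "Cs_generic \<Gamma> G V0 \<psi> \<tau> p"
  shows "(gain_tight 1 1 \<Gamma> G V0 \<psi> \<longrightarrow> rho_isostatic 0 \<Gamma> G V0 \<psi> \<tau> p) \<and>
         (gain_tight 1 2 \<Gamma> G V0 \<psi> \<longrightarrow> rho_isostatic 1 \<Gamma> G V0 \<psi> \<tau> p)"
proof -
  interpret group \<Gamma> by fact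
  have "card (carrier \<Gamma>) = 2"
    using assms(3) by (simp add: order_def)
  then have "card (carrier \<Gamma> - {\<one>\<^bsub>\<Gamma>\<^esub>}) = 1"
    by simp
  then obtain \<gamma> where "carrier \<Gamma> - {\<one>\<^bsub>\<Gamma>\<^esub>} = {\<gamma>}"
    by (rule card_1_singletonE)
  then have \<gamma>: "carrier \<Gamma> = {\<one>\<^bsub>\<Gamma>\<^esub>, \<gamma>}" "\<gamma> \<noteq> \<one>\<^bsub>\<Gamma>\<^esub>"
    by auto
  have \<tau>: "\<tau> \<one>\<^bsub>\<Gamma>\<^esub> \<in> {mat 1, reflection_y}" "\<tau> \<gamma> \<in> {mat 1, reflection_y}" "\<tau> \<gamma> \<noteq> \<tau> \<one>\<^bsub>\<Gamma>\<^esub>"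
    "\<tau> (\<one>\<^bsub>\<Gamma>\<^esub> \<otimes>\<^bsub>\<Gamma>\<^esub> \<one>\<^bsub>\<Gamma>\<^esub>) = \<tau> \<one>\<^bsub>\<Gamma>\<^esub> ** \<tau> \<one>\<^bsub>\<Gamma>\<^esub>"
    using assms(5,6) \<gamma> by (auto simp: hom_def C_s_def inj_on_def)
  have refl2: "reflection_y ** reflection_y = mat 1"
    by (simp add: reflection_y_def matrix_matrix_mult_def mat_def vec_eq_iff forall_2 sum_2)
  \<comment> \<open>The image of the identity is idempotent, and both candidates square to
    \<open>mat 1\<close>.\<close>
  have \<tau>_one: "\<tau> \<one>\<^bsub>\<Gamma>\<^esub> = mat 1"
    using \<tau>(1,4) refl2 by auto
  have gg: "fin_digraph G" "V0 \<subseteq> verts G" "\<And>e. e \<in> arcs G \<Longrightarrow> \<psi> e \<in> carrier \<Gamma>"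
    using assms(4) unfolding gain_graph_def by blast+
  obtain label :: "'e \<Rightarrow> nat" where label: "inj_on label (arcs G)"
    using finite_imp_inj_to_nat_seg[OF fin_digraph.finite_arcs[OF gg(1)]] by blast
  interpret reflection_gain_graph \<Gamma> V0 G \<psi> \<tau> \<gamma> label
  proof (intro reflection_gain_graph.intro reflection_gain_graph_axioms.intro)
    show "group \<Gamma>"
      by fact
    show "\<tau> \<gamma> = reflection_y"
      using \<tau>(2,3) \<tau>_one by auto
  qed (use \<gamma> \<tau>_one gg label in simp_all)
  have p: "\<forall>v\<in>V0. p v $ 1 = 0" and hull: "affine hull (cov_placement \<tau> p ` CV) = UNIV"
    using assms(7) by (simp_all add: covering_framework_def)
  have CV: "CV \<noteq> {}"
    using hull by force
  have "rho_isostatic 0 \<Gamma> G V0 \<psi> \<tau> p" if tight: "gain_tight 1 1 \<Gamma> G V0 \<psi>"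
  proof -
    have "gain_sparse 1 1 \<Gamma> G V0 \<psi>" and card: "2 * card (verts G - V0) + card (verts G \<inter> V0) \<le> 1 + card (arcs G)"
      using tight by (simp_all add: gain_tight_def)
    then obtain x y :: "'v \<Rightarrow> real" where "\<forall>u\<in>V0. x u = 0" "indep_on (arc_edge ` arcs G) motions (symm_row x y)"
      using sparse_3_placement[OF sparse_3_arc_edges] by blast
    then show ?thesis
      using isostatic_of_placement[of 0 p x y "{trans_y}"] p assms(8) trans_y_kernel[OF p]
        independent_trans_y[OF CV] trivial_trans_y card
      by (simp add: jmotions_def row_def)
  qed
  moreover have "rho_isostatic 1 \<Gamma> G V0 \<psi> \<tau> p" if tight: "gain_tight 1 2 \<Gamma> G V0 \<psi>"
  proof -
    have "gain_sparse 1 2 \<Gamma> G V0 \<psi>" and card: "2 * card (verts G - V0) + card (verts G \<inter> V0) \<le> 2 + card (arcs G)"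
      using tight by (simp_all add: gain_tight_def)
    then obtain x y :: "'v \<Rightarrow> real" where xy: "\<forall>u\<in>V0. x u = 0" "indep_on (arc_edge ` arcs G) anti_motions (anti_row x y)"
      using anti_sparse_placement[OF anti_sparse_arc_edges] by blast
    note ind = independent_trans_x_rotation[OF p hull]
    have triv: "trivial_on CV (cov_placement \<tau> p) m" if "m \<in> {rotation p, trans_x}" for m
      using that trivial_rotation[OF p] trivial_trans_x by (elim insertE) simp_all
    have ker: "RM p m = 0" if "m \<in> {rotation p, trans_x}" for m
      using that rotation_kernel[OF p] trans_x_kernel[OF p] by (elim insertE) simp_all
    show ?thesis
    proof (rule isostatic_of_placement[OF _ p assms(8) xy(1) _ _ conjunct2[OF ind] _ ker triv])
      show "indep_on (arc_edge ` arcs G) (jmotions 1) (row 1 x y)"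
        using xy(2) by (simp add: jmotions_def row_def)
      show "{rotation p, trans_x} \<subseteq> VR 1"
        using rotation_kernel[OF p] trans_x_kernel[OF p] by blast
      show "2 * card (verts G - V0) + card (verts G \<inter> V0) \<le> card {rotation p, trans_x} + card (arcs G)"
        using card conjunct1[OF ind] by simp
    qed simp_all
  qed
  ultimately show ?thesis
    by blast
qed

end
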